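(* Let $(L,\mathcal G)$ be a stable nestoid, let $R=\{f,g_1,\dots,g_k\}$ be a causal region in $\mathcal G$ with maximal element $f$ and pairwise incomparable remaining elements $g_1,\dots,g_k$, and set $\mathcal H:=\mathcal G^{\lfloor R\rfloor}\cup\{f\}$ and $E_R:=E_f^++E_{g_1}^-+\dots+E_{g_k}^-$. Then $$\frac1{E_R}\operatorname*{Res}_{E_R=0}\Psi(L,\mathcal G)=A_E^{sh}([\hat 0,f],\mathcal G^{\lceil R\rceil})\cdot\Psi(L,\mathcal H),$$ in the sense that after multiplying both sides by $E_R$ they agree as rational functions on the hyperplane $E_R=0$. Here $A_E^{sh}([\hat 0,f],\mathcal G^{\lceil R\rceil})$ is obtained from $A_E([\hat 0,f],\mathcal G^{\lceil R\rceil})$ by substituting $$E_h^+\mapsto E_h^++\sum_{g_i\le h}E_{g_i}^-,\qquad E_h^-\mapsto E_h^--\sum_{g_i\le h}E_{g_i}^- .$$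
   Context: All lattices are finite. Let $L$ be a lattice with minimum $\hat 0$ and maximum $\hat 1$. A subset $\mathcal G\subseteq L_{>\hat 0}$ is nestable if $\hat 1\in\mathcal G$ and for any two incomparable $f,g\in\mathcal G$, $f\vee g\notin\mathcal G$ implies $f\wedge g=\hat 0$. A subset $N\subseteq\mathcal G$ is nested if for all $k\ge 2$ and pairwise incomparable $f_1,\dots,f_k\in N$ one has $f_1\vee\dots\vee f_k\notin\mathcal G$. $\mathcal N(L,\mathcal G)$ is the simplicial complex of nested sets. $(L,\mathcal G)$ is a nestoid if $\mathcal G$ is nestable and for every $f\in\mathcal G$ the complex $\mathcal N([\hat 0,f],\mathcal G\cap[\hat 0,f])$ is pure. A nestoid is stable if for all $f,g_1,\dots,g_k\in\mathcal G$ with $f\vee g_i\notin\mathcal G$ for all $i$ one has $f\vee g_1\vee\dots\vee g_k\notin\mathcal G$. $\mathbb R^{2\mathcal G}$ is the real vector space with basis $f^+,f^-$ ($f\in\mathcal G$), with the lattice spanned by this basis; $p_f,m_f$ are the dual coordinates. For a nested set $N$, $\mathbb R_+^{2N}$ is the cone spanned by $f^+,f^-$, $f\in N$. The fan $\Sigma^{2\mathcal G}$ consists of all faces of the cones $\mathbb R_+^{2N}$, $N\in\mathcal N(L,\mathcal G)$. For $g\in\mathcal G$ put $F_g:=p_{\hat 1}+\sum_{f\in\mathcal G,\ g<f<\hat 1}(p_f-m_f)-m_g$. The causal cone is $\{m_{\hat 1}=0,\ p_g\ge0,\ m_g\ge0,\ F_g\ge 0\ \forall g\in\mathcal G\}$.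 The universe fan $\mathcal U_{\mathcal G}$ is obtained by intersecting the cones of $\Sigma^{2\mathcal G}$ with the causal cone (its cones are these intersections and all their faces). The Laplace transform of a fan is $\sum_C\int_C e^{-x\cdot y}\,dx$, the sum over maximal cones $C$, where each integral (convergent for $y$ in the interior of the dual cone) is taken with respect to the measure on $\mathrm{span}(C)$ normalized by the lattice and regarded as a rational function of $y$. The wavefunction $\Psi(L,\mathcal G)$ is the Laplace transform of $\mathcal U_{\mathcal G}$, a rational function in variables $E_f^\pm$, where $E_f^\pm$ is the variable (coordinate of $y$) corresponding to the basis vector $f^\pm$. For a nestoid with top element $\hat 1$, $A_E(L,\mathcal G):=\sum_N\prod_{h\in N\setminus\{\hat 1\}}\frac1{E_h^+E_h^-}$, the sum over maximal nested sets $N$; for $([\hat 0,f],\mathcal G^{\lceil R\rceil})$ the top element is $f$. $\operatorname*{Res}_{E=0}\Psi$, for a linear form $E$ along which $\Psi$ has at most a simple pole, is the restriction of $E\cdot\Psi$ to $E=0$. A causal region is a nested set $R=\{r_*,r_1,\dots,r_k\}$ ($k\ge0$) with unique maximal element $r_*$ and $r_1,\dots,r_k$ pairwise incomparable. For $f\in\mathcal G$: $\mathcal G^{\lceil f\rceil}:=\{g\in\mathcal G\mid g\le f\}$ and $\mathcal G^{\lfloor f\rfloor}:=\{g\in\mathcal G\mid g>f\text{ or }g\vee f\notin\mathcal G\}$. For $R=\{f,g_1,\dots,g_k\}$ as in the claim, $\mathcal G^{\lceil R\rceil}$ is obtained from $\mathcal G$ by applying successively $\lceil f\rceil,\lfloor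 g_1\rfloor,\dots,\lfloor g_k\rfloor$, i.e. $\mathcal G^{\lceil R\rceil}=\{h\in\mathcal G\mid h\le f,\text{ and for each } i:\ h>g_i\text{ or }h\vee g_i\notin\mathcal G\}$; and $\mathcal G^{\lfloor R\rfloor}:=\mathcal G^{\lfloor f\rfloor}\cup\mathcal G^{\lceil g_1\rceil}\cup\dots\cup\mathcal G^{\lceil g_k\rceil}$. *)

theory Defs
  imports
    "HOL-Analysis.Analysis"
    "HOL-Computational_Algebra.Fraction_Field"
begin

section \<open>Rational functions on a Euclidean space\<close>

text \<open>
  Polynomial functions on a Euclidean space form an integral domain; its field of fractions
  is the field of rational functions (real coefficients, variables the coordinates).
\<close>

typedef (overloaded) 'v polyfun = "{f :: 'v::euclidean_space \<Rightarrow> real. real_polynomial_function f}"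
  morphisms peval Abs_polyfun
  by (rule exI[of _ "\<lambda>_. 0"]) (simp add: real_polynomial_function.intros(2))

setup_lifting type_definition_polyfun

lemma real_polynomial_function_no_zero_divisors:
  fixes p q :: "'v::euclidean_space \<Rightarrow> real"
  assumes p: "real_polynomial_function p" and q: "real_polynomial_function q"
    and a: "p a \<noteq> 0" and b: "q b \<noteq> 0"
  shows "\<exists>x. p x * q x \<noteq> 0"
proof -
  define l where "l = (\<lambda>t::real. a + t *\<^sub>R (b - a))"
  have l: "polynomial_function l"
    unfolding l_def
    by (intro polynomial_function_add polynomial_function_const polynomial_function_mult
        polynomial_function_id)
  have fin: "finite {t. r (l t) = 0}"
    if r: "real_polynomial_function r" and nz: "r (l t0) \<noteq> 0" for r :: "'v \<Rightarrow> real" and t0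
  proof -
    have "real_polynomial_function (r \<circ> l)"
      using l r by (rule real_polynomial_function_compose)
    then obtain c n where c: "r \<circ> l = (\<lambda>x. \<Sum>i\<le>n. c i * x ^ i)"
      using real_polynomial_function_iff_sum by blast
    have e: "r (l t) = (\<Sum>i\<le>n. c i * t ^ i)" for t
      using fun_cong[OF c, of t] by simp
    have "\<exists>i\<le>n. c i \<noteq> 0"
      using nz by (auto simp: e intro!: sum.neutral)
    then have "finite {t. (\<Sum>i\<le>n. c i * t ^ i) = 0}"
      using polyfun_finite_roots by blast
    then show ?thesis by (simp add: e)
  qed
  have "finite {t. p (l t) = 0}" by (rule fin[OF p, of 0]) (simp add: l_def a)
  moreover have "finite {t. q (l t) = 0}" by (rule fin[OF q, of 1]) (simp add: l_def b)
  ultimately have "finite ({t. p (l t) = 0} \<union> {t. q (l t) = 0})" by simp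
  then have "{t. p (l t) = 0} \<union> {t. q (l t) = 0} \<noteq> UNIV"
    using infinite_UNIV_char_0[where 'a = real] by metis
  then obtain t where "p (l t) \<noteq> 0" "q (l t) \<noteq> 0" by auto
  then show ?thesis by (intro exI[of _ "l t"]) simp
qed

instantiation polyfun :: (euclidean_space) idom
begin

lift_definition zero_polyfun :: "'a polyfun" is "\<lambda>_. 0"
  by (rule real_polynomial_function.intros(2))
lift_definition one_polyfun :: "'a polyfun" is "\<lambda>_. 1"
  by (rule real_polynomial_function.intros(2))
lift_definition plus_polyfun :: "'a polyfun \<Rightarrow> 'a polyfun \<Rightarrow> 'a polyfun" is "\<lambda>p q x. p x + q x"
  by (rule real_polynomial_function.intros(3))
lift_definition minus_polyfun :: "'a polyfun \<Rightarrow> 'a polyfun \<Rightarrow> 'a polyfun" is "\<lambda>p q x. p x - q x"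
  by (rule real_polynomial_function_diff)
lift_definition uminus_polyfun :: "'a polyfun \<Rightarrow> 'a polyfun" is "\<lambda>p x. - p x"
  by (rule real_polynomial_function_minus)
lift_definition times_polyfun :: "'a polyfun \<Rightarrow> 'a polyfun \<Rightarrow> 'a polyfun" is "\<lambda>p q x. p x * q x"
  by (rule real_polynomial_function.intros(4))

instance
proof
  fix p q r :: "'a polyfun"
  show "p * q * r = p * (q * r)" by transfer (simp add: fun_eq_iff algebra_simps)
  show "p * q = q * p" by transfer (simp add: fun_eq_iff algebra_simps)
  show "1 * p = p" by transfer simp
  show "p + q + r = p + (q + r)" by transfer (simp add: fun_eq_iff algebra_simps)
  show "p + q = q + p" by transfer (simp add: fun_eq_iff algebra_simps)
  show "0 + p = p" by transfer simp
  show "- p + p = 0" by transfer simp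
  show "p - q = p + - q" by transfer simp
  show "(p + q) * r = p * r + q * r" by transfer (simp add: fun_eq_iff algebra_simps)
  show "p * (q + r) = p * q + p * r" by transfer (simp add: fun_eq_iff algebra_simps)
  show "0 * p = 0" by transfer simp
  show "p * 0 = 0" by transfer simp
  show "(0::'a polyfun) \<noteq> 1" by transfer (simp add: fun_eq_iff)
  show "p * q \<noteq> 0" if "p \<noteq> 0" "q \<noteq> 0"
    using that
  proof transfer
    fix p q :: "'a \<Rightarrow> real"
    assume "real_polynomial_function p" "real_polynomial_function q"
      and "p \<noteq> (\<lambda>_. 0)" "q \<noteq> (\<lambda>_. 0)"
    then show "(\<lambda>x. p x * q x) \<noteq> (\<lambda>_. 0)"
      using real_polynomial_function_no_zero_divisors[of p q] by (metis ext)
  qed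
qed

end

type_synonym 'v ratfun = "'v polyfun fract"

definition of_polyfun :: "'v::euclidean_space polyfun \<Rightarrow> 'v ratfun" where
  "of_polyfun P = Fract P 1"

lift_definition linear_form :: "'v::euclidean_space \<Rightarrow> 'v polyfun" is "\<lambda>v y. v \<bullet> y"
  by (rule real_polynomial_function.intros(1)) (rule bounded_linear_inner_right)

definition vanishes_along :: "'v::euclidean_space polyfun \<Rightarrow> 'v polyfun \<Rightarrow> bool" where
  "vanishes_along E Q \<longleftrightarrow> (\<forall>y. peval E y = 0 \<longrightarrow> peval Q y = 0)"

definition regular_along :: "'v::euclidean_space polyfun \<Rightarrow> 'v ratfun \<Rightarrow> bool" where
  "regular_along E r \<longleftrightarrow> (\<exists>P Q. r = Fract P Q \<and> \<not> vanishes_along E Q)"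

text \<open>
  The restriction of \<open>r\<close> to the hyperplane \<open>E = 0\<close>. A rational function on the hyperplane is
  given as an equivalence class of fractions \<open>p/q\<close> with \<open>q\<close> not identically zero on the
  hyperplane, where two fractions are identified if cross-multiplication gives an identity on
  the hyperplane. If \<open>r\<close> is not regular along \<open>E = 0\<close>, the result is the empty set.
\<close>

definition restriction ::
    "'v::euclidean_space polyfun \<Rightarrow> 'v ratfun \<Rightarrow> ('v polyfun \<times> 'v polyfun) set" where
  "restriction E r = {(p, q). \<not> vanishes_along E q \<and>
     (\<exists>P Q. r = Fract P Q \<and> \<not> vanishes_along E Q \<and>
        (\<forall>y. peval E y = 0 \<longrightarrow> peval p y * peval Q y = peval P y * peval q y))}"

definition at_most_simple_pole :: "'v::euclidean_space polyfun \<Rightarrow> 'v ratfun \<Rightarrow> bool" where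
  "at_most_simple_pole E r \<longleftrightarrow> regular_along E (of_polyfun E * r)"

definition residue ::
    "'v::euclidean_space polyfun \<Rightarrow> 'v ratfun \<Rightarrow> ('v polyfun \<times> 'v polyfun) set" where
  "residue E r = restriction E (of_polyfun E * r)"


section \<open>Laplace transforms of fans\<close>

definition maximal_sets :: "'b set set \<Rightarrow> 'b set set" where
  "maximal_sets K = {C \<in> K. \<forall>D\<in>K. C \<subseteq> D \<longrightarrow> C = D}"

definition lattice_basis :: "'v::euclidean_space set \<Rightarrow> 'v set \<Rightarrow> bool" where
  "lattice_basis S B \<longleftrightarrow> independent B \<and> span B = S \<and>
     {x \<in> S. \<forall>b\<in>Basis. x \<bullet> b \<in> \<int>} = {\<Sum>b\<in>B. of_int (c b) *\<^sub>R b | c. True}"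

text \<open>
  The Lebesgue measure on a rational subspace \<open>S\<close> for which a fundamental cell of the lattice of
  integral points of \<open>S\<close> has volume one. It does not depend on the lattice basis chosen.
\<close>

definition lattice_measure :: "'v::euclidean_space set \<Rightarrow> 'v measure" where
  "lattice_measure S =
     (let B = (SOME B. lattice_basis S B)
      in distr (PiM B (\<lambda>_. lborel)) borel (\<lambda>c. \<Sum>b\<in>B. c b *\<^sub>R b))"

definition dual_cone :: "'v::euclidean_space set \<Rightarrow> 'v set" where
  "dual_cone C = {y. \<forall>x\<in>C. x \<bullet> y \<ge> 0}"

text \<open>
  The rational function given on the interior of the dual cone by the convergent integral. It is
  unique if this interior is nonempty, i.e. if \<open>C\<close> contains no line.
\<close>

definition cone_laplace :: "'v::euclidean_space set \<Rightarrow> 'v ratfun" where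
  "cone_laplace C = (THE r. \<exists>P Q. r = Fract P Q \<and>
     (\<forall>y \<in> interior (dual_cone C).
        set_integrable (lattice_measure (span C)) C (\<lambda>x. exp (- (x \<bullet> y))) \<and>
        peval Q y \<noteq> 0 \<and>
        peval P y / peval Q y = (LINT x:C|lattice_measure (span C). exp (- (x \<bullet> y)))))"

definition fan_laplace :: "'v::euclidean_space set set \<Rightarrow> 'v ratfun" where
  "fan_laplace \<Sigma> = (\<Sum>C\<in>maximal_sets \<Sigma>. cone_laplace C)"


section \<open>Nestoids\<close>

text \<open>
  The lattice \<open>L\<close> is the whole type, which is finite. Intervals \<open>[bot, f]\<close> have the same joins,
  meets and bottom as \<open>L\<close>, so the nested sets of an interval depend only on the set \<open>G\<close>.
\<close>

definition incomparable :: "'a::order \<Rightarrow> 'a \<Rightarrow> bool" where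
  "incomparable x y \<longleftrightarrow> \<not> x \<le> y \<and> \<not> y \<le> x"

definition nestable :: "'a::bounded_lattice set \<Rightarrow> bool" where
  "nestable G \<longleftrightarrow> G \<subseteq> {bot<..} \<and> top \<in> G \<and>
     (\<forall>f\<in>G. \<forall>g\<in>G. incomparable f g \<longrightarrow> sup f g \<notin> G \<longrightarrow> inf f g = bot)"

definition nested_sets :: "'a::lattice set \<Rightarrow> 'a set set" where
  "nested_sets G = {N. N \<subseteq> G \<and>
     (\<forall>S\<subseteq>N. finite S \<longrightarrow> card S \<ge> 2 \<longrightarrow> pairwise incomparable S \<longrightarrow> Sup_fin S \<notin> G)}"

definition pure_complex :: "'b set set \<Rightarrow> bool" where
  "pure_complex K \<longleftrightarrow> (\<forall>M\<in>maximal_sets K. \<forall>N\<in>maximal_sets K. card M = card N)"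

definition nestoid :: "'a::{finite, bounded_lattice} set \<Rightarrow> bool" where
  "nestoid G \<longleftrightarrow> nestable G \<and> (\<forall>f\<in>G. pure_complex (nested_sets (G \<inter> {bot..f})))"

definition stable_nestoid :: "'a::{finite, bounded_lattice} set \<Rightarrow> bool" where
  "stable_nestoid G \<longleftrightarrow> nestoid G \<and>
     (\<forall>f\<in>G. \<forall>S\<subseteq>G. S \<noteq> {} \<longrightarrow> (\<forall>g\<in>S. sup f g \<notin> G) \<longrightarrow> Sup_fin (insert f S) \<notin> G)"


section \<open>The universe fan and the wavefunction\<close>

text \<open>
  All spaces \<open>\<real>\<^sup>2\<^sup>G\<close> are regarded as coordinate subspaces of the space of pairs \<open>(p, m)\<close> of vectors
  indexed by the whole lattice. The variable \<open>y\<close> of a Laplace transform lives in the same space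
  via the inner product, and its coordinates \<open>fst y $ f\<close>, \<open>snd y $ f\<close> are the energies of \<open>f\<close>;
  energies of elements outside \<open>G\<close> do not occur in the Laplace transform of a cone in \<open>\<real>\<^sup>2\<^sup>G\<close>.
\<close>

type_synonym 'a energy_space = "(real ^ 'a) \<times> (real ^ 'a)"

definition plus_vec :: "'a::finite \<Rightarrow> 'a energy_space" where
  "plus_vec f = (axis f 1, 0)"

definition minus_vec :: "'a::finite \<Rightarrow> 'a energy_space" where
  "minus_vec f = (0, axis f 1)"

abbreviation p_coord :: "'a::finite \<Rightarrow> 'a energy_space \<Rightarrow> real" where
  "p_coord f x \<equiv> fst x $ f"

abbreviation m_coord :: "'a::finite \<Rightarrow> 'a energy_space \<Rightarrow> real" where
  "m_coord f x \<equiv> snd x $ f"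

definition nested_cone :: "'a::finite set \<Rightarrow> 'a energy_space set" where
  "nested_cone N = convex_cone hull (plus_vec ` N \<union> minus_vec ` N)"

definition nested_fan :: "'a::{finite, bounded_lattice} set \<Rightarrow> 'a energy_space set set" where
  "nested_fan G = {F. F \<noteq> {} \<and> (\<exists>N\<in>nested_sets G. F face_of nested_cone N)}"

definition causal_form :: "'a::{finite, bounded_lattice} set \<Rightarrow> 'a \<Rightarrow> 'a energy_space \<Rightarrow> real" where
  "causal_form G g x =
     p_coord top x + (\<Sum>f\<in>{f\<in>G. g < f \<and> f < top}. p_coord f x - m_coord f x) - m_coord g x"

definition causal_cone :: "'a::{finite, bounded_lattice} set \<Rightarrow> 'a energy_space set" where
  "causal_cone G = {x \<in> span (plus_vec ` G \<union> minus_vec ` G). m_coord top x = 0 \<and>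
     (\<forall>g\<in>G. p_coord g x \<ge> 0 \<and> m_coord g x \<ge> 0 \<and> causal_form G g x \<ge> 0)}"

definition universe_fan :: "'a::{finite, bounded_lattice} set \<Rightarrow> 'a energy_space set set" where
  "universe_fan G = {F. F \<noteq> {} \<and> (\<exists>C\<in>nested_fan G. F face_of (C \<inter> causal_cone G))}"

definition wavefunction :: "'a::{finite, bounded_lattice} set \<Rightarrow> 'a energy_space ratfun" where
  "wavefunction G = fan_laplace (universe_fan G)"

definition E_plus :: "'a::finite \<Rightarrow> 'a energy_space polyfun" where
  "E_plus f = linear_form (plus_vec f)"

definition E_minus :: "'a::finite \<Rightarrow> 'a energy_space polyfun" where
  "E_minus f = linear_form (minus_vec f)"


section \<open>Amplitudes and causal regions\<close>

text \<open>
  The amplitude of a nestoid \<open>G\<close> with top element \<open>t\<close>, evaluated at \<open>E\<^sub>h\<^sup>+ = u h\<close>, \<open>E\<^sub>h\<^sup>- = v h\<close>.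
\<close>

definition amplitude_at ::
    "'a::lattice \<Rightarrow> 'a set \<Rightarrow> ('a \<Rightarrow> 'k::field) \<Rightarrow> ('a \<Rightarrow> 'k) \<Rightarrow> 'k" where
  "amplitude_at t G u v = (\<Sum>N\<in>maximal_sets (nested_sets G). \<Prod>h\<in>N - {t}. 1 / (u h * v h))"

definition causal_region :: "'a::lattice set \<Rightarrow> 'a set \<Rightarrow> bool" where
  "causal_region G R \<longleftrightarrow> R \<in> nested_sets G \<and>
     (\<exists>r. {s\<in>R. \<forall>t\<in>R. \<not> s < t} = {r} \<and> pairwise incomparable (R - {r}))"

definition lower_part :: "'a::lattice set \<Rightarrow> 'a \<Rightarrow> 'a set" where
  "lower_part G f = {g\<in>G. g \<le> f}"

definition upper_part :: "'a::lattice set \<Rightarrow> 'a \<Rightarrow> 'a set" where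
  "upper_part G f = {g\<in>G. g > f \<or> sup g f \<notin> G}"

text \<open>
  In the following, a causal region is given by its maximal element \<open>f\<close> and the set \<open>A\<close> of its
  remaining elements.
\<close>

definition region_inside :: "'a::lattice set \<Rightarrow> 'a \<Rightarrow> 'a set \<Rightarrow> 'a set" where
  "region_inside G f A = {h\<in>G. h \<le> f \<and> (\<forall>g\<in>A. h > g \<or> sup h g \<notin> G)}"

definition region_outside :: "'a::lattice set \<Rightarrow> 'a \<Rightarrow> 'a set \<Rightarrow> 'a set" where
  "region_outside G f A = upper_part G f \<union> (\<Union>g\<in>A. lower_part G g)"

definition region_energy :: "'a::finite \<Rightarrow> 'a set \<Rightarrow> 'a energy_space polyfun" where
  "region_energy f A = E_plus f + (\<Sum>g\<in>A. E_minus g)"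

definition shifted_amplitude ::
    "'a::{finite, bounded_lattice} \<Rightarrow> 'a set \<Rightarrow> 'a set \<Rightarrow> 'a energy_space ratfun" where
  "shifted_amplitude t G A = amplitude_at t G
     (\<lambda>h. of_polyfun (E_plus h + (\<Sum>g\<in>{g\<in>A. g \<le> h}. E_minus g)))
     (\<lambda>h. of_polyfun (E_minus h - (\<Sum>g\<in>{g\<in>A. g \<le> h}. E_minus g)))"

end

theory Submission
  imports Defs
begin

text \<open>
  Let \<open>\<psi>\<^sub>N\<close> be the Laplace transform of the cone that the causal cone cuts out of the orthant of a
  maximal nested set \<open>N\<close>. The maximal cones of the universe fan are exactly these cones, so the
  wavefunction is the sum of the \<open>\<psi>\<^sub>N\<close> (\<open>wavefunction_eq_sum\<close>).

  In a nested set the elements above a given one form a chain, so \<open>N\<close> is a rooted tree with root \<open>top\<close>,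
  and its cone is given by \<open>0 \<le> p\<^sub>c\<close> and \<open>0 \<le> m\<^sub>c \<le> q\<^sub>c\<close>, where \<open>q\<^sub>c\<close> is \<open>p\<close> at the root plus the sum of
  \<open>p\<^sub>h - m\<^sub>h\<close> over the \<open>h\<close> strictly between \<open>c\<close> and the root. Integrating out a leaf \<open>c\<close> produces
  \<open>(1 - exp (- E\<^sub>c\<^sup>- q\<^sub>c)) / (E\<^sub>c\<^sup>+ E\<^sub>c\<^sup>-)\<close>, and the exponential only shifts the energies of the elements above \<open>c\<close>.
  Iterating this gives the closed formula \<open>tree_wave\<close>,
  \<open>\<psi>\<^sub>N = \<Sum>S. (-1)\<^sup>|\<^sup>S\<^sup>| \<Prod>c. 1 / (E\<^sub>c\<^sup>+ + x\<^sub>c) \<Prod>c. 1 / (E\<^sub>c\<^sup>- - x\<^sub>c)\<close>,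
  where \<open>S\<close> ranges over the sets of non-root elements of \<open>N\<close>, the second product omits the root, and \<open>x\<^sub>c\<close>
  is the sum of \<open>E\<^sub>d\<^sup>-\<close> over the maximal elements \<open>d\<close> of \<open>S\<close> below \<open>c\<close>.

  For a causal region consisting of \<open>f\<close> and the set \<open>A\<close> below it, the only factor with a pole along the
  hyperplane \<open>E\<^sub>R = 0\<close> is \<open>1 / (E\<^sub>f\<^sup>+ + x\<^sub>f)\<close>, for those \<open>S\<close> whose set of maximal elements below \<open>f\<close> is \<open>A\<close>. In
  such a summand \<open>x\<^sub>h\<close> is the sum of the \<open>E\<^sub>g\<^sup>-\<close> with \<open>g \<in> A\<close> and \<open>g \<le> h\<close> for every element \<open>h \<noteq> f\<close> of \<open>N\<close> inside
  the region, so the factors of \<open>h\<close> form the shifted propagator of the amplitude, and all remaining factors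
  depend only on the part of \<open>N\<close> in \<open>H\<close> (\<open>singular_part_Un\<close>). By stability, nestedness is a condition on
  pairs; it follows that the maximal nested sets containing the region are exactly the unions of a maximal
  nested set inside the region and a maximal nested set of \<open>H\<close> (\<open>maximal_nested_sets_region\<close>). Therefore
  the wavefunction of \<open>G\<close> and the product of the shifted amplitude with the wavefunction of \<open>H\<close> differ by a
  function that is regular along the hyperplane, and their residues agree (\<open>residue_eqI\<close>).

  Two points need care in identifying \<open>\<psi>\<^sub>N\<close>. The closed formula has spurious poles where the integral
  converges; since the integral is continuous there, they cancel (\<open>Fract_cancel_spurious_poles\<close>). And the
  normalisation of the measure refers to an arbitrary lattice basis; any two of them define the same
  measure, by uniqueness of translation-invariant measures (\<open>basis_measure_eq_if_lattice_basis\<close>).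
\<close>

section \<open>Rational functions and their poles along a hyperplane\<close>

lemma continuous_on_peval: "continuous_on S (peval p)"
  by (metis continuous_on_polymonial_function mem_Collect_eq peval real_polynomial_function_eq)

lemma polyfun_eq_iff: "p = q \<longleftrightarrow> (\<forall>y. peval p y = peval q y)"
  by (metis peval_inject ext)

lemma peval_simps [simp]:
  "peval 0 y = 0" "peval 1 y = 1" "peval (p + q) y = peval p y + peval q y"
  "peval (p - q) y = peval p y - peval q y" "peval (- p) y = - peval p y"
  "peval (p * q) y = peval p y * peval q y" "peval (linear_form v) y = v \<bullet> y"
  by (simp_all add: zero_polyfun.rep_eq one_polyfun.rep_eq plus_polyfun.rep_eq
      minus_polyfun.rep_eq uminus_polyfun.rep_eq times_polyfun.rep_eq linear_form.rep_eq)

text \<open>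
  Restrict to the lines through a point of the open set: a univariate polynomial with infinitely many
  zeros vanishes.
\<close>

lemma polyfun_zero_on_open:
  assumes "open W" "w \<in> W" and z: "\<And>y. y \<in> W \<Longrightarrow> peval p y = 0"
  shows "p = 0"
proof (rule ccontr)
  assume "p \<noteq> 0"
  then obtain b where b: "peval p b \<noteq> 0" by (auto simp: polyfun_eq_iff)
  define l where "l = (\<lambda>t::real. w + t *\<^sub>R (b - w))"
  have l: "polynomial_function l"
    unfolding l_def
    by (intro polynomial_function_add polynomial_function_const polynomial_function_mult
        polynomial_function_id)
  have "real_polynomial_function (peval p \<circ> l)"
    using l peval[of p] real_polynomial_function_compose by blast
  then obtain c n where c: "peval p \<circ> l = (\<lambda>x. \<Sum>i\<le>n. c i * x ^ i)"
    using real_polynomial_function_iff_sum by blast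
  have e: "peval p (l t) = (\<Sum>i\<le>n. c i * t ^ i)" for t
    using fun_cong[OF c, of t] by simp
  have "\<exists>i\<le>n. c i \<noteq> 0"
    using b e[of 1] by (auto simp: l_def intro!: sum.neutral)
  then have fin: "finite {t. (\<Sum>i\<le>n. c i * t ^ i) = 0}"
    using polyfun_finite_roots by blast
  have "continuous_on UNIV l" unfolding l_def by (intro continuous_intros)
  then have "open (l -` W)" using \<open>open W\<close> by (simp add: open_vimage)
  moreover have "0 \<in> l -` W" using assms by (simp add: l_def)
  ultimately have "infinite (l -` W)"
    by (metis empty_iff finite_imp_not_open)
  moreover have "l -` W \<subseteq> {t. (\<Sum>i\<le>n. c i * t ^ i) = 0}"
    using z by (auto simp: e[symmetric])
  ultimately show False using fin finite_subset by blast
qed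


text \<open>
  The non-vanishing locus of a nonzero polynomial is dense, so an identity of continuous functions
  need only be checked at generic points.
\<close>

lemma polyfun_eq_on_open:
  assumes "open U" "continuous_on U F" "continuous_on U G" "q \<noteq> 0" "y \<in> U"
    and eq: "\<And>y. y \<in> U \<Longrightarrow> peval q y \<noteq> 0 \<Longrightarrow> F y = G (y :: 'v::euclidean_space)"
  shows "F y = (G y :: real)"
proof (rule ccontr)
  assume ne: "F y \<noteq> G y"
  define W where "W = U \<inter> (\<lambda>y. F y - G y) -` (- {0})"
  have "open W"
    unfolding W_def
    by (rule continuous_open_preimage) (use assms in \<open>auto intro!: continuous_intros\<close>)
  moreover have "y \<in> W" using ne assms by (auto simp: W_def)
  moreover have "peval q z = 0" if "z \<in> W" for z
    using that eq[of z] by (auto simp: W_def)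
  ultimately have "q = 0" by (rule polyfun_zero_on_open)
  then show False using assms by simp
qed

definition hyperplane_proj :: "'v::euclidean_space \<Rightarrow> 'v \<Rightarrow> 'v" where
  "hyperplane_proj l y = y - ((l \<bullet> y) / (l \<bullet> l)) *\<^sub>R l"

lemma inner_hyperplane_proj: "l \<noteq> 0 \<Longrightarrow> l \<bullet> hyperplane_proj l y = 0"
  by (simp add: hyperplane_proj_def inner_diff_right)

lemma hyperplane_proj_id: "l \<bullet> y = 0 \<Longrightarrow> hyperplane_proj l y = y"
  by (simp add: hyperplane_proj_def)

lemma polynomial_hyperplane_proj: "polynomial_function (hyperplane_proj l)"
proof -
  have "bounded_linear (hyperplane_proj l)"
    unfolding hyperplane_proj_def
    by (intro bounded_linear_sub bounded_linear_ident bounded_linear_compose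
        [OF bounded_linear_scaleR_left] bounded_linear_divide[THEN bounded_linear_compose]
        bounded_linear_inner_right)
  then show ?thesis by (rule polynomial_function_bounded_linear)
qed

lift_definition restrict_poly :: "'v::euclidean_space \<Rightarrow> 'v polyfun \<Rightarrow> 'v polyfun" is
  "\<lambda>l p y. p (hyperplane_proj l y)"
  using real_polynomial_function_compose[OF polynomial_hyperplane_proj] by (simp add: o_def)

lemma peval_restrict_poly [simp]: "peval (restrict_poly l p) y = peval p (hyperplane_proj l y)"
  by (simp add: restrict_poly.rep_eq)

text \<open>
  The difference of a polynomial and its composition with the orthogonal projection to
  \<open>l = 0\<close> is divisible by \<open>l\<close>; this passes through sums and products like a Leibniz rule.
\<close>

lemma polyfun_divide_linear_form:
  fixes p :: "'v::euclidean_space polyfun"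
  shows "\<exists>q. \<forall>y. peval p y = peval p (hyperplane_proj l y) + (l \<bullet> y) * peval q y"
proof -
  have "\<exists>q. real_polynomial_function q \<and> (\<forall>y. f y = f (hyperplane_proj l y) + (l \<bullet> y) * q y)"
    if "real_polynomial_function f" for f :: "'v::euclidean_space \<Rightarrow> real"
    using that
  proof induction
    case (linear f)
    have "f y = f (hyperplane_proj l y) + (l \<bullet> y) * (f l / (l \<bullet> l))" for y
      using linear by (simp add: hyperplane_proj_def bounded_linear.linear linear_diff linear_scale)
    then show ?case
      by (intro exI[of _ "\<lambda>_. f l / (l \<bullet> l)"] conjI real_polynomial_function.intros(2) allI)
  next
    case (const c)
    then show ?case by (intro exI[of _ "\<lambda>_. 0"]) auto
  next
    case (add f g)
    then obtain q r where q:
      "real_polynomial_function q" "\<And>y. f y = f (hyperplane_proj l y) + (l \<bullet> y) * q y"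
      "real_polynomial_function r" "\<And>y. g y = g (hyperplane_proj l y) + (l \<bullet> y) * r y"
      by blast
    have "f y + g y = f (hyperplane_proj l y) + g (hyperplane_proj l y)
        + (l \<bullet> y) * (q y + r y)" for y
      by (subst q(2), subst q(4)) (simp add: algebra_simps)
    moreover have "real_polynomial_function (\<lambda>y. q y + r y)"
      using q by blast
    ultimately show ?case by blast
  next
    case (mult f g)
    then obtain q r where q:
      "real_polynomial_function q" "\<And>y. f y = f (hyperplane_proj l y) + (l \<bullet> y) * q y"
      "real_polynomial_function r" "\<And>y. g y = g (hyperplane_proj l y) + (l \<bullet> y) * r y"
      by blast
    have f: "real_polynomial_function (\<lambda>y. f (hyperplane_proj l y))"
      using real_polynomial_function_compose[OF polynomial_hyperplane_proj mult.hyps(1)]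
      by (simp add: o_def)
    have "f y * g y = f (hyperplane_proj l y) * g (hyperplane_proj l y)
        + (l \<bullet> y) * (q y * g y + f (hyperplane_proj l y) * r y)" for y
    proof -
      have "f y * g y = f (hyperplane_proj l y) * g y + (l \<bullet> y) * (q y * g y)"
        by (subst q(2)) (simp add: algebra_simps)
      also have "f (hyperplane_proj l y) * g y = f (hyperplane_proj l y) * g (hyperplane_proj l y)
          + (l \<bullet> y) * (f (hyperplane_proj l y) * r y)"
        by (subst q(4)) (simp add: algebra_simps)
      finally show ?thesis by (simp add: algebra_simps)
    qed
    moreover have "real_polynomial_function (\<lambda>y. q y * g y + f (hyperplane_proj l y) * r y)"
      by (rule real_polynomial_function.intros(3)
          [OF real_polynomial_function.intros(4)[OF q(1) mult.hyps(2)]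
            real_polynomial_function.intros(4)[OF f q(3)]])
    ultimately show ?case by blast
  qed
  from this[OF peval[of p, simplified]] obtain q where q: "real_polynomial_function q"
    "\<forall>y. peval p y = peval p (hyperplane_proj l y) + (l \<bullet> y) * q y" by blast
  then show ?thesis by (intro exI[of _ "Abs_polyfun q"]) (metis Abs_polyfun_inverse mem_Collect_eq)
qed

lemma linear_form_eq_0_iff [simp]: "linear_form l = 0 \<longleftrightarrow> l = 0"
  by (auto simp: polyfun_eq_iff dest: spec[of _ l])

text \<open>
  Vanishing on an open piece of the hyperplane forces vanishing on all of it, so the previous
  division leaves no remainder.
\<close>

lemma linear_form_dvd_if_vanishing_locally:
  assumes U: "open U" and l: "l \<noteq> 0" and y0: "y0 \<in> U" "l \<bullet> y0 = 0"
    and z: "\<And>y. y \<in> U \<Longrightarrow> l \<bullet> y = 0 \<Longrightarrow> peval p y = 0"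
  shows "linear_form l dvd p"
proof -
  have c: "continuous_on UNIV (hyperplane_proj l)"
    by (simp add: continuous_on_polymonial_function polynomial_hyperplane_proj)
  have "restrict_poly l p = 0"
  proof (rule polyfun_zero_on_open)
    show "open (hyperplane_proj l -` U)" using c U by (simp add: open_vimage)
    show "y0 \<in> hyperplane_proj l -` U" using y0 by (simp add: hyperplane_proj_id)
    show "peval (restrict_poly l p) y = 0" if "y \<in> hyperplane_proj l -` U" for y
      using that by (simp add: z inner_hyperplane_proj l)
  qed
  then have r: "peval p (hyperplane_proj l y) = 0" for y
    by (metis peval_restrict_poly peval_simps(1))
  obtain q where "\<forall>y. peval p y = peval p (hyperplane_proj l y) + (l \<bullet> y) * peval q y"
    using polyfun_divide_linear_form by blast
  then have "p = linear_form l * q" by (simp add: polyfun_eq_iff r)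
  then show ?thesis by simp
qed

lemma peval_prod_list: "peval (prod_list ps) y = prod_list (map (\<lambda>p. peval p y) ps)"
  by (induction ps) simp_all

text \<open>
  If a quotient of a polynomial by linear forms extends to a continuous function \<open>I\<close> on an open set,
  then every linear form with a zero in that set divides the numerator. Cancelling these forms leaves
  a denominator without zeros there, which is the shape required of the Laplace transform of a cone.
\<close>

lemma Fract_cancel_spurious_poles:
  fixes I :: "'v::euclidean_space \<Rightarrow> real"
  assumes U: "open U" and I: "continuous_on U I" and ls: "0 \<notin> set ls"
    and eq: "\<And>y. y \<in> U \<Longrightarrow> peval P y = I y * (\<Prod>l\<leftarrow>ls. l \<bullet> y)"
  shows "\<exists>P' Q'. Fract P (\<Prod>l\<leftarrow>ls. linear_form l) = Fract P' Q' \<and> (U \<noteq> {} \<longrightarrow> Q' \<noteq> 0) \<and>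
    (\<forall>y\<in>U. peval Q' y \<noteq> 0 \<and> peval P' y / peval Q' y = I y)"
  using I ls eq
proof (induction ls arbitrary: P I)
  case Nil
  then show ?case by (intro exI[of _ P] exI[of _ 1]) auto
next
  case (Cons l ls)
  show ?case
  proof (cases "\<exists>y0\<in>U. l \<bullet> y0 = 0")
    case True
    then obtain y0 where y0: "y0 \<in> U" "l \<bullet> y0 = 0" by blast
    have "linear_form l dvd P"
      by (rule linear_form_dvd_if_vanishing_locally[OF U _ y0]) (use Cons.prems in auto)
    then obtain P2 where P2: "P = linear_form l * P2" by (elim dvdE)
    have "peval P2 y = I y * (\<Prod>l\<leftarrow>ls. l \<bullet> y)" if "y \<in> U" for y
    proof (rule polyfun_eq_on_open[where q = "linear_form l" and U = U and F = "peval P2"])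
      have "continuous_on U (\<lambda>y. peval (\<Prod>l\<leftarrow>ls. linear_form l) y)" by (rule continuous_on_peval)
      then show "continuous_on U (\<lambda>y. I y * (\<Prod>l\<leftarrow>ls. l \<bullet> y))"
        using Cons.prems(1) by (intro continuous_intros) (simp_all add: peval_prod_list o_def)
      show "open U" "continuous_on U (peval P2)" using U by (simp_all add: continuous_on_peval)
      show "linear_form l \<noteq> 0" using Cons.prems by auto
      show "y \<in> U" by fact
      show "peval P2 y = I y * (\<Prod>l\<leftarrow>ls. l \<bullet> y)" if "y \<in> U" "peval (linear_form l) y \<noteq> 0" for y
        using Cons.prems(3)[OF that(1)] that(2) by (simp add: P2)
    qed
    from Cons.IH[OF Cons.prems(1) _ this] Cons.prems(2)
    show ?thesis by (simp add: P2 mult_fract_cancel)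
  next
    case False
    have c: "continuous_on U (\<lambda>y. I y * (l \<bullet> y))"
      using Cons.prems(1) by (intro continuous_intros)
    have "\<exists>P' Q'. Fract P (\<Prod>l\<leftarrow>ls. linear_form l) = Fract P' Q' \<and> (U \<noteq> {} \<longrightarrow> Q' \<noteq> 0) \<and>
      (\<forall>y\<in>U. peval Q' y \<noteq> 0 \<and> peval P' y / peval Q' y = I y * (l \<bullet> y))"
      by (rule Cons.IH[OF c]) (use Cons.prems in \<open>auto simp: algebra_simps\<close>)
    then obtain P' Q' where *: "Fract P (\<Prod>l\<leftarrow>ls. linear_form l) = Fract P' Q'"
      "U \<noteq> {} \<Longrightarrow> Q' \<noteq> 0" 
      "\<And>y. y \<in> U \<Longrightarrow> peval Q' y \<noteq> 0 \<and> peval P' y / peval Q' y = I y * (l \<bullet> y)"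
      by blast
    have "Fract P (\<Prod>l\<leftarrow>l # ls. linear_form l) = Fract P (\<Prod>l\<leftarrow>ls. linear_form l) * Fract 1 (linear_form l)"
      by (simp add: mult.commute)
    also have "\<dots> = Fract P' (linear_form l * Q')" by (simp add: *(1) mult.commute)
    finally show ?thesis
    proof (intro exI conjI)
      show "\<forall>y\<in>U. peval (linear_form l * Q') y \<noteq> 0 \<and>
          peval P' y / peval (linear_form l * Q') y = I y"
      proof
        fix y assume "y \<in> U"
        with *(3)[OF this] False show "peval (linear_form l * Q') y \<noteq> 0 \<and>
            peval P' y / peval (linear_form l * Q') y = I y"
          by (simp add: divide_eq_eq mult_ac)
      qed
      show "U \<noteq> {} \<longrightarrow> linear_form l * Q' \<noteq> 0" using * Cons.prems(2) by auto
    qed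
  qed
qed

lemma vanishes_along_linear_formD:
  assumes "vanishes_along (linear_form r) (linear_form l)"
  shows "l \<in> span {r}"
proof -
  define y where "y = hyperplane_proj r l"
  have r: "r \<bullet> y = 0"
    by (cases "r = 0") (simp_all add: y_def inner_hyperplane_proj)
  then have "l \<bullet> y = 0" using assms by (simp add: vanishes_along_def)
  moreover have "y = l - ((r \<bullet> l) / (r \<bullet> r)) *\<^sub>R r" by (simp add: y_def hyperplane_proj_def)
  ultimately have "y \<bullet> y = 0" using r by (simp add: inner_diff_left)
  then have "l = ((r \<bullet> l) / (r \<bullet> r)) *\<^sub>R r" by (simp add: y_def hyperplane_proj_def)
  then show ?thesis by (metis insertI1 span_base span_scale)
qed

text \<open>
  The hyperplane is itself an affine space: restriction to it is composition with the projection, and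
  polynomials form an integral domain.
\<close>

lemma vanishes_along_mult_iff:
  assumes "r \<noteq> 0"
  shows "vanishes_along (linear_form r) (p * q) \<longleftrightarrow>
    vanishes_along (linear_form r) p \<or> vanishes_along (linear_form r) q"
proof -
  have v: "vanishes_along (linear_form r) p \<longleftrightarrow> restrict_poly r p = 0" for p
  proof
    assume "vanishes_along (linear_form r) p"
    then show "restrict_poly r p = 0"
      using assms by (simp add: vanishes_along_def polyfun_eq_iff inner_hyperplane_proj)
  next
    assume "restrict_poly r p = 0"
    then have "peval p (hyperplane_proj r y) = 0" for y
      by (metis peval_restrict_poly peval_simps(1))
    then show "vanishes_along (linear_form r) p"
      by (metis vanishes_along_def hyperplane_proj_id peval_simps(7))
  qed
  have "restrict_poly r (p * q) = restrict_poly r p * restrict_poly r q"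
    by (simp add: polyfun_eq_iff)
  then show ?thesis by (simp add: v)
qed

lemma not_vanishes_along_1: "\<not> vanishes_along (linear_form r) 1"
  by (auto simp: vanishes_along_def intro!: exI[of _ 0])

lemma vanishes_along_0: "vanishes_along E 0"
  by (simp add: vanishes_along_def)

lemma regular_alongE:
  assumes "regular_along E r"
  obtains P Q where "r = Fract P Q" "\<not> vanishes_along E Q" "Q \<noteq> 0"
  using assms vanishes_along_0 unfolding regular_along_def by metis

lemma regular_along_Fract: "\<not> vanishes_along E Q \<Longrightarrow> regular_along E (Fract P Q)"
  unfolding regular_along_def by blast

context
  fixes r :: "'v::euclidean_space"
  assumes r: "r \<noteq> 0"
begin

lemma regular_along_add:
  assumes "regular_along (linear_form r) a" "regular_along (linear_form r) b"
  shows "regular_along (linear_form r) (a + b)"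
  using assms by (elim regular_alongE) (simp add: regular_along_Fract vanishes_along_mult_iff r)

lemma regular_along_diff:
  assumes "regular_along (linear_form r) a" "regular_along (linear_form r) b"
  shows "regular_along (linear_form r) (a - b)"
  using assms by (elim regular_alongE) (simp add: regular_along_Fract vanishes_along_mult_iff r)

lemma regular_along_mult:
  assumes "regular_along (linear_form r) a" "regular_along (linear_form r) b"
  shows "regular_along (linear_form r) (a * b)"
  using assms by (elim regular_alongE) (simp add: regular_along_Fract vanishes_along_mult_iff r)

lemma regular_along_of_polyfun: "regular_along (linear_form r) (of_polyfun p)"
  by (simp add: of_polyfun_def regular_along_Fract not_vanishes_along_1)

lemma regular_along_1: "regular_along (linear_form r) 1"
  by (simp add: One_fract_def regular_along_Fract not_vanishes_along_1)

lemma regular_along_0: "regular_along (linear_form r) 0"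
  by (simp add: Zero_fract_def regular_along_Fract not_vanishes_along_1)

lemma regular_along_sum:
  "(\<And>x. x \<in> X \<Longrightarrow> regular_along (linear_form r) (a x)) \<Longrightarrow> regular_along (linear_form r) (sum a X)"
  by (induction X rule: infinite_finite_induct) (auto simp: regular_along_0 intro: regular_along_add)

lemma regular_along_prod:
  "(\<And>x. x \<in> X \<Longrightarrow> regular_along (linear_form r) (a x)) \<Longrightarrow> regular_along (linear_form r) (prod a X)"
  by (induction X rule: infinite_finite_induct) (auto simp: regular_along_1 intro: regular_along_mult)

lemma regular_along_inverse_linear_form:
  assumes "l \<notin> span {r}"
  shows "regular_along (linear_form r) (inverse (of_polyfun (linear_form l)))"
  unfolding of_polyfun_def
  using assms vanishes_along_linear_formD[of r l] by (auto intro: regular_along_Fract)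

text \<open>
  Identities that hold on the hyperplane after cross-multiplication are composed by cancelling
  denominators that do not vanish identically there. The hypotheses are symmetric up to sign, so the
  inclusion is in fact an equality.
\<close>

lemma restriction_subset_if_difference_vanishes:
  assumes b: "regular_along (linear_form r) b"
    and ab: "a - b = of_polyfun (linear_form r) * c" "regular_along (linear_form r) c"
  shows "restriction (linear_form r) a \<subseteq> restriction (linear_form r) b"
proof
  fix pq assume pq: "pq \<in> restriction (linear_form r) a"
  obtain p q where [simp]: "pq = (p, q)" by (cases pq)
  let ?van = "vanishes_along (linear_form r)"
  obtain P Q where 1: "\<not> ?van q" "a = Fract P Q" "\<not> ?van Q"
    "\<And>y. r \<bullet> y = 0 \<Longrightarrow> peval p y * peval Q y = peval P y * peval q y"
    using pq by (auto simp: restriction_def)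
  obtain P' Q' where 2: "b = Fract P' Q'" "\<not> ?van Q'" "Q' \<noteq> 0"
    using b by (elim regular_alongE)
  obtain P'' Q'' where 3: "c = Fract P'' Q''" "\<not> ?van Q''" "Q'' \<noteq> 0"
    using ab(2) by (elim regular_alongE)
  have Q: "Q \<noteq> 0" using 1 vanishes_along_0 by auto
  have "Fract (P * Q' - P' * Q) (Q * Q') = Fract (linear_form r * P'') Q''"
    using ab(1) 1 2 3 Q by (simp add: of_polyfun_def)
  then have e: "(P * Q' - P' * Q) * Q'' = linear_form r * P'' * (Q * Q')"
    using Q 2 3 by (simp add: eq_fract)
  have "?van ((P * Q' - P' * Q) * Q'')"
    unfolding e by (simp add: vanishes_along_def)
  then have "?van (P * Q' - P' * Q)" using 3 by (simp add: vanishes_along_mult_iff r)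
  then have e2: "peval P y * peval Q' y = peval P' y * peval Q y" if "r \<bullet> y = 0" for y
    using that by (simp add: vanishes_along_def)
  have "?van ((p * Q' - P' * q) * Q)"
    unfolding vanishes_along_def
  proof safe
    fix y assume "peval (linear_form r) y = 0"
    then have y: "r \<bullet> y = 0" by simp
    have "peval p y * peval Q' y * peval Q y = peval P y * peval Q' y * peval q y"
      using 1(4)[OF y] by (simp add: mult_ac)
    also have "\<dots> = peval P' y * peval q y * peval Q y" using e2[OF y] by (simp add: mult_ac)
    finally show "peval ((p * Q' - P' * q) * Q) y = 0" by (simp add: left_diff_distrib)
  qed
  then have "?van (p * Q' - P' * q)" using 1 by (simp add: vanishes_along_mult_iff r)
  then show "pq \<in> restriction (linear_form r) b"
    using 1 2 by (auto simp: restriction_def vanishes_along_def)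
qed

text \<open>
  The residue formula is proved by comparing singular summands. These agree as rational functions, so the
  difference of the two sides has no pole along the hyperplane at all.
\<close>

lemma residue_eqI:
  assumes b: "regular_along (linear_form r) (of_polyfun (linear_form r) * b)"
    and ab: "regular_along (linear_form r) (a - b)"
  shows "at_most_simple_pole (linear_form r) a"
    and "residue (linear_form r) a = restriction (linear_form r) (of_polyfun (linear_form r) * b)"
proof -
  let ?E = "of_polyfun (linear_form r)"
  have a: "regular_along (linear_form r) (?E * a)"
    using regular_along_add[OF b regular_along_mult[OF regular_along_of_polyfun[of "linear_form r"] ab]]
    by (simp add: right_diff_distrib)
  then show "at_most_simple_pole (linear_form r) a"
    by (simp add: at_most_simple_pole_def)
  have ba: "regular_along (linear_form r) (b - a)"
    using regular_along_diff[OF regular_along_0 ab] by simp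
  show "residue (linear_form r) a = restriction (linear_form r) (?E * b)"
    unfolding residue_def
    using restriction_subset_if_difference_vanishes[OF b _ ab, of "?E * a"]
      restriction_subset_if_difference_vanishes[OF a _ ba, of "?E * b"]
    by (simp add: right_diff_distrib)
qed

end

lemma of_polyfun_simps:
  "of_polyfun (p + q) = of_polyfun p + of_polyfun q"
  "of_polyfun (p - q) = of_polyfun p - of_polyfun q"
  "of_polyfun (p * q) = of_polyfun p * of_polyfun q"
  "of_polyfun 0 = 0" "of_polyfun 1 = 1"
  by (simp_all add: of_polyfun_def Zero_fract_def One_fract_def)

lemma of_polyfun_sum: "of_polyfun (sum p X) = (\<Sum>x\<in>X. of_polyfun (p x))"
  by (induction X rule: infinite_finite_induct) (simp_all add: of_polyfun_simps)

lemma linear_form_simps: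
  "linear_form (v + w) = linear_form v + linear_form w"
  "linear_form (v - w) = linear_form v - linear_form w" "linear_form 0 = 0"
  by (simp_all add: polyfun_eq_iff inner_add_left inner_diff_left)

lemma linear_form_sum: "linear_form (sum v X) = (\<Sum>x\<in>X. linear_form (v x))"
  by (induction X rule: infinite_finite_induct) (simp_all add: linear_form_simps)

text \<open>
  The values of a rational function off given hyperplanes. Denominators are kept as products of linear
  forms, so that the forms that turn out to be spurious can be cancelled one by one.
\<close>

definition evaluates_off :: "'v::euclidean_space set \<Rightarrow> 'v ratfun \<Rightarrow> ('v \<Rightarrow> real) \<Rightarrow> bool" where
  "evaluates_off Ls r F \<longleftrightarrow> (\<exists>P ls. set ls \<subseteq> Ls \<and> r = Fract P (\<Prod>l\<leftarrow>ls. linear_form l) \<and>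
     (\<forall>y. (\<forall>l\<in>Ls. l \<bullet> y \<noteq> 0) \<longrightarrow> peval P y = F y * (\<Prod>l\<leftarrow>ls. l \<bullet> y)))"

lemma prod_list_linear_form_nz: "0 \<notin> set ls \<Longrightarrow> (\<Prod>l\<leftarrow>ls. linear_form l) \<noteq> 0"
  by (induction ls) auto

context
  fixes Ls :: "'v::euclidean_space set"
  assumes Ls: "0 \<notin> Ls"
begin

lemma evaluates_off_add:
  assumes "evaluates_off Ls r F" "evaluates_off Ls s H"
  shows "evaluates_off Ls (r + s) (\<lambda>y. F y + H y)"
proof -
  obtain P ls where 1: "set ls \<subseteq> Ls" "r = Fract P (\<Prod>l\<leftarrow>ls. linear_form l)"
    "\<And>y. (\<forall>l\<in>Ls. l \<bullet> y \<noteq> 0) \<Longrightarrow> peval P y = F y * (\<Prod>l\<leftarrow>ls. l \<bullet> y)"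
    using assms(1) unfolding evaluates_off_def by blast
  obtain P' ls' where 2: "set ls' \<subseteq> Ls" "s = Fract P' (\<Prod>l\<leftarrow>ls'. linear_form l)"
    "\<And>y. (\<forall>l\<in>Ls. l \<bullet> y \<noteq> 0) \<Longrightarrow> peval P' y = H y * (\<Prod>l\<leftarrow>ls'. l \<bullet> y)"
    using assms(2) unfolding evaluates_off_def by blast
  have nz: "(\<Prod>l\<leftarrow>ls. linear_form l) \<noteq> 0" "(\<Prod>l\<leftarrow>ls'. linear_form l) \<noteq> 0"
    using 1 2 Ls by (auto intro!: prod_list_linear_form_nz)
  show ?thesis
    unfolding evaluates_off_def
    using 1 2 nz
    by (intro exI[of _ "P * (\<Prod>l\<leftarrow>ls'. linear_form l) + P' * (\<Prod>l\<leftarrow>ls. linear_form l)"]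
        exI[of _ "ls @ ls'"])
      (auto simp: peval_prod_list o_def algebra_simps)
qed

lemma evaluates_off_mult:
  assumes "evaluates_off Ls r F" "evaluates_off Ls s H"
  shows "evaluates_off Ls (r * s) (\<lambda>y. F y * H y)"
proof -
  obtain P ls where 1: "set ls \<subseteq> Ls" "r = Fract P (\<Prod>l\<leftarrow>ls. linear_form l)"
    "\<And>y. (\<forall>l\<in>Ls. l \<bullet> y \<noteq> 0) \<Longrightarrow> peval P y = F y * (\<Prod>l\<leftarrow>ls. l \<bullet> y)"
    using assms(1) unfolding evaluates_off_def by blast
  obtain P' ls' where 2: "set ls' \<subseteq> Ls" "s = Fract P' (\<Prod>l\<leftarrow>ls'. linear_form l)"
    "\<And>y. (\<forall>l\<in>Ls. l \<bullet> y \<noteq> 0) \<Longrightarrow> peval P' y = H y * (\<Prod>l\<leftarrow>ls'. l \<bullet> y)"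
    using assms(2) unfolding evaluates_off_def by blast
  show ?thesis
    unfolding evaluates_off_def
    using 1 2 by (intro exI[of _ "P * P'"] exI[of _ "ls @ ls'"]) auto
qed

lemma evaluates_off_of_polyfun: "evaluates_off Ls (of_polyfun p) (peval p)"
  unfolding evaluates_off_def of_polyfun_def
  by (intro exI[of _ p] exI[of _ "[]"]) simp

lemma evaluates_off_inverse:
  "l \<in> Ls \<Longrightarrow> evaluates_off Ls (inverse (of_polyfun (linear_form l))) (\<lambda>y. inverse (l \<bullet> y))"
  unfolding evaluates_off_def of_polyfun_def
  by (intro exI[of _ 1] exI[of _ "[l]"]) auto

lemma evaluates_off_sum:
  "(\<And>x. x \<in> X \<Longrightarrow> evaluates_off Ls (a x) (F x)) \<Longrightarrow>
    evaluates_off Ls (sum a X) (\<lambda>y. \<Sum>x\<in>X. F x y)"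
proof (induction X rule: infinite_finite_induct)
  case (insert x X)
  then show ?case using evaluates_off_add[of "a x" "F x" "sum a X"] by simp
qed (use evaluates_off_of_polyfun[of 0] in \<open>simp_all add: of_polyfun_simps zero_polyfun.rep_eq\<close>)

lemma evaluates_off_prod:
  "(\<And>x. x \<in> X \<Longrightarrow> evaluates_off Ls (a x) (F x)) \<Longrightarrow>
    evaluates_off Ls (prod a X) (\<lambda>y. \<Prod>x\<in>X. F x y)"
proof (induction X rule: infinite_finite_induct)
  case (insert x X)
  then show ?case using evaluates_off_mult[of "a x" "F x" "prod a X"] by simp
qed (use evaluates_off_of_polyfun[of 1] in \<open>simp_all add: of_polyfun_simps one_polyfun.rep_eq\<close>)

end

section \<open>The lattice measure does not depend on the lattice basis\<close>

text \<open>The measure underlying \<open>lattice_measure\<close>, for an explicitly given basis.\<close>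

definition basis_measure :: "'v::euclidean_space set \<Rightarrow> 'v measure" where
  "basis_measure B = distr (PiM B (\<lambda>_. lborel)) borel (\<lambda>c. \<Sum>b\<in>B. c b *\<^sub>R b)"

interpretation product_lborel: product_sigma_finite "\<lambda>_. lborel :: real measure"
  by standard

lemma measurable_lincomb [measurable]:
  "(\<lambda>c. \<Sum>b\<in>B. c b *\<^sub>R (b :: 'v::euclidean_space)) \<in> borel_measurable (PiM B (\<lambda>_. lborel))"
proof -
  have "(\<lambda>c. c b) \<in> borel_measurable (PiM B (\<lambda>_. lborel :: real measure))" if "b \<in> B" for b
    using measurable_component_singleton[OF that, of "\<lambda>_. lborel :: real measure"] by simp
  then show ?thesis by (intro borel_measurable_sum borel_measurable_scaleR) auto
qed

lemma sets_basis_measure [measurable_cong, simp]: "sets (basis_measure B) = sets borel"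
  by (simp add: basis_measure_def)

lemma space_basis_measure [simp]: "space (basis_measure B) = UNIV"
  by (simp add: basis_measure_def)

lemma nn_integral_basis_measure:
  assumes [measurable]: "f \<in> borel_measurable borel"
  shows "(\<integral>\<^sup>+x. f x \<partial>basis_measure B) = (\<integral>\<^sup>+c. f (\<Sum>b\<in>B. c b *\<^sub>R b) \<partial>PiM B (\<lambda>_. lborel))"
  unfolding basis_measure_def by (rule nn_integral_distr) auto

text \<open>
  The recursion on which all later integrals are based: one basis vector is integrated out at a time.
\<close>

lemma nn_integral_basis_measure_insert:
  assumes "finite B" "b \<notin> B" and [measurable]: "f \<in> borel_measurable borel"
  shows "(\<integral>\<^sup>+x. f x \<partial>basis_measure (insert b B)) =
    (\<integral>\<^sup>+x. (\<integral>\<^sup>+t. f (x + t *\<^sub>R b) \<partial>lborel) \<partial>basis_measure B)"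
proof -
  have "(\<integral>\<^sup>+x. f x \<partial>basis_measure (insert b B)) =
      (\<integral>\<^sup>+c. (\<integral>\<^sup>+t. f (\<Sum>b'\<in>insert b B. (c(b := t)) b' *\<^sub>R b') \<partial>lborel) \<partial>PiM B (\<lambda>_. lborel))"
    using assms by (subst nn_integral_basis_measure) (simp_all add: product_lborel.product_nn_integral_insert)
  also have "\<dots> = (\<integral>\<^sup>+c. (\<integral>\<^sup>+t. f ((\<Sum>b'\<in>B. c b' *\<^sub>R b') + t *\<^sub>R b) \<partial>lborel) \<partial>PiM B (\<lambda>_. lborel))"
  proof -
    have "(\<Sum>b'\<in>insert b B. (c(b := t)) b' *\<^sub>R b') = (\<Sum>b'\<in>B. c b' *\<^sub>R b') + t *\<^sub>R b" for c t
    proof -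
      have "(\<Sum>b'\<in>B. (c(b := t)) b' *\<^sub>R b') = (\<Sum>b'\<in>B. c b' *\<^sub>R b')"
        using assms by (intro sum.cong) auto
      then show ?thesis using assms by simp
    qed
    then show ?thesis by simp
  qed
  also have "\<dots> = (\<integral>\<^sup>+x. (\<integral>\<^sup>+t. f (x + t *\<^sub>R b) \<partial>lborel) \<partial>basis_measure B)"
    by (subst nn_integral_basis_measure) auto
  finally show ?thesis .
qed

lemma nn_integral_basis_measure_empty:
  assumes [measurable]: "f \<in> borel_measurable borel"
  shows "(\<integral>\<^sup>+x. f x \<partial>basis_measure {}) = f 0"
  by (subst nn_integral_basis_measure) (auto simp: product_lborel.nn_integral_empty simp del: nn_integral_const)

lemma nn_integral_basis_measure_translate:
  assumes "finite B" "s \<in> span B" and f: "f \<in> borel_measurable borel"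
  shows "(\<integral>\<^sup>+x. f (x + s) \<partial>basis_measure B) = (\<integral>\<^sup>+x. f x \<partial>basis_measure B)"
  using assms
proof (induction B arbitrary: s f rule: finite_induct)
  case empty
  then show ?case by simp
next
  case (insert b B)
  note [measurable] = insert.prems(2)
  obtain k where k: "s - k *\<^sub>R b \<in> span B" using insert.prems(1) by (auto simp: span_insert)
  define s' where "s' = s - k *\<^sub>R b"
  have "(\<integral>\<^sup>+x. f (x + s) \<partial>basis_measure (insert b B)) =
      (\<integral>\<^sup>+x. (\<integral>\<^sup>+t. f (x + s' + (k + t) *\<^sub>R b) \<partial>lborel) \<partial>basis_measure B)"
    using insert.hyps by (subst nn_integral_basis_measure_insert) (simp_all add: s'_def algebra_simps)
  also have "\<dots> = (\<integral>\<^sup>+x. (\<integral>\<^sup>+t. f (x + s' + t *\<^sub>R b) \<partial>lborel) \<partial>basis_measure B)"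
  proof (rule nn_integral_cong)
    fix x
    show "(\<integral>\<^sup>+t. f (x + s' + (k + t) *\<^sub>R b) \<partial>lborel) = (\<integral>\<^sup>+t. f (x + s' + t *\<^sub>R b) \<partial>lborel)"
      using nn_integral_real_affine[of "\<lambda>t. f (x + s' + t *\<^sub>R b)" 1 k] by simp
  qed
  also have "\<dots> = (\<integral>\<^sup>+x. (\<integral>\<^sup>+t. f (x + t *\<^sub>R b) \<partial>lborel) \<partial>basis_measure B)"
    using insert.IH[of s' "\<lambda>x. \<integral>\<^sup>+t. f (x + t *\<^sub>R b) \<partial>lborel"] k by (simp add: s'_def)
  also have "\<dots> = (\<integral>\<^sup>+x. f x \<partial>basis_measure (insert b B))"
    using insert.hyps by (subst nn_integral_basis_measure_insert) simp_all
  finally show ?case .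
qed

lemma nn_integral_basis_measure_reflect:
  assumes "finite B" and f: "f \<in> borel_measurable borel"
  shows "(\<integral>\<^sup>+x. f (- x) \<partial>basis_measure B) = (\<integral>\<^sup>+x. f x \<partial>basis_measure B)"
  using assms
proof (induction B arbitrary: f rule: finite_induct)
  case empty
  then show ?case by (subst (1 2) nn_integral_basis_measure_empty) auto
next
  case (insert b B)
  note [measurable] = insert.prems
  have "(\<integral>\<^sup>+x. f (- x) \<partial>basis_measure (insert b B)) =
      (\<integral>\<^sup>+x. (\<integral>\<^sup>+t. f (- x + (- t) *\<^sub>R b) \<partial>lborel) \<partial>basis_measure B)"
    using insert.hyps by (subst nn_integral_basis_measure_insert) (simp_all add: algebra_simps)
  also have "\<dots> = (\<integral>\<^sup>+x. (\<integral>\<^sup>+t. f (- x + t *\<^sub>R b) \<partial>lborel) \<partial>basis_measure B)"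
  proof (rule nn_integral_cong)
    fix x
    show "(\<integral>\<^sup>+t. f (- x + (- t) *\<^sub>R b) \<partial>lborel) = (\<integral>\<^sup>+t. f (- x + t *\<^sub>R b) \<partial>lborel)"
      using nn_integral_real_affine[of "\<lambda>t. f (- x + t *\<^sub>R b)" "-1" 0] by simp
  qed
  also have "\<dots> = (\<integral>\<^sup>+x. (\<integral>\<^sup>+t. f (x + t *\<^sub>R b) \<partial>lborel) \<partial>basis_measure B)"
    using insert.IH[of "\<lambda>x. \<integral>\<^sup>+t. f (x + t *\<^sub>R b) \<partial>lborel"] by simp
  also have "\<dots> = (\<integral>\<^sup>+x. f x \<partial>basis_measure (insert b B))"
    using insert.hyps by (subst nn_integral_basis_measure_insert) simp_all
  finally show ?case .
qed

text \<open>
  Fubini for two different bases; it holds because both measures are images of \<open>\<sigma>\<close>-finite products.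
\<close>

lemma nn_integral_basis_measure_swap:
  assumes "finite B" "finite C" and [measurable]: "case_prod f \<in> borel_measurable (borel \<Otimes>\<^sub>M borel)"
  shows "(\<integral>\<^sup>+x. (\<integral>\<^sup>+y. f x y \<partial>basis_measure C) \<partial>basis_measure B) =
    (\<integral>\<^sup>+y. (\<integral>\<^sup>+x. f x y \<partial>basis_measure B) \<partial>basis_measure C)"
proof -
  interpret B: finite_product_sigma_finite "\<lambda>_. lborel :: real measure" B
    by standard fact
  interpret C: finite_product_sigma_finite "\<lambda>_. lborel :: real measure" C
    by standard fact
  interpret BC: pair_sigma_finite "PiM B (\<lambda>_. lborel :: real measure)" "PiM C (\<lambda>_. lborel :: real measure)"
    by standard
  have "(\<integral>\<^sup>+x. (\<integral>\<^sup>+y. f x y \<partial>basis_measure C) \<partial>basis_measure B) =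
      (\<integral>\<^sup>+c. (\<integral>\<^sup>+d. f (\<Sum>b\<in>B. c b *\<^sub>R b) (\<Sum>b\<in>C. d b *\<^sub>R b) \<partial>PiM C (\<lambda>_. lborel)) \<partial>PiM B (\<lambda>_. lborel))"
    by (simp add: nn_integral_basis_measure)
  also have "\<dots> = (\<integral>\<^sup>+d. (\<integral>\<^sup>+c. f (\<Sum>b\<in>B. c b *\<^sub>R b) (\<Sum>b\<in>C. d b *\<^sub>R b) \<partial>PiM B (\<lambda>_. lborel)) \<partial>PiM C (\<lambda>_. lborel))"
    by (rule BC.Fubini'[symmetric]) measurable
  also have "\<dots> = (\<integral>\<^sup>+y. (\<integral>\<^sup>+x. f x y \<partial>basis_measure B) \<partial>basis_measure C)"
    by (simp add: nn_integral_basis_measure)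
  finally show ?thesis .
qed

lemma AE_basis_measure_span: "AE x in basis_measure B. x \<in> span B"
proof -
  have "(\<Sum>b\<in>B. c b *\<^sub>R b) \<in> span B" for c
    by (intro span_sum span_scale span_base)
  then show ?thesis
    unfolding basis_measure_def
    by (subst AE_distr_iff) (simp_all add: borel_closed closed_subspace[OF subspace_span])
qed

text \<open>
  Uniqueness of translation-invariant measures. For \<open>g = 1\<^sub>D\<close> and \<open>h = 1\<^sub>X\<close>, the double integral of
  \<open>h(x) g(y + x)\<close> over the two measures can be evaluated in both orders; since \<open>D\<close> has measure one for
  both of them, the result is the measure of \<open>X\<close> with respect to either.
\<close>

lemma basis_measure_eqI:
  fixes B C :: "'v::euclidean_space set"
  assumes fin: "finite B" "finite C" and span: "span B = span C"
    and [measurable]: "D \<in> sets borel"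
    and D: "emeasure (basis_measure B) D = 1" "emeasure (basis_measure C) D = 1"
  shows "basis_measure B = basis_measure C"
proof (rule measure_eqI)
  fix X assume "X \<in> sets (basis_measure B)"
  then have [measurable]: "X \<in> sets borel" by simp
  define g h where "g = (indicator D :: 'v \<Rightarrow> ennreal)" and "h = (indicator X :: 'v \<Rightarrow> ennreal)"
  have [measurable]: "g \<in> borel_measurable borel" "h \<in> borel_measurable borel"
    by (simp_all add: g_def h_def)
  have "emeasure (basis_measure B) X = (\<integral>\<^sup>+x. h x * (\<integral>\<^sup>+y. g y \<partial>basis_measure C) \<partial>basis_measure B)"
    using D by (simp add: g_def h_def)
  also have "\<dots> = (\<integral>\<^sup>+x. h x * (\<integral>\<^sup>+y. g (y + x) \<partial>basis_measure C) \<partial>basis_measure B)"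
    using AE_basis_measure_span[of B] by (intro nn_integral_cong_AE, elim eventually_mono)
      (simp add: nn_integral_basis_measure_translate fin span)
  also have "\<dots> = (\<integral>\<^sup>+x. (\<integral>\<^sup>+y. h x * g (y + x) \<partial>basis_measure C) \<partial>basis_measure B)"
    by (simp add: nn_integral_cmult)
  also have "\<dots> = (\<integral>\<^sup>+y. (\<integral>\<^sup>+x. h x * g (y + x) \<partial>basis_measure B) \<partial>basis_measure C)"
    by (rule nn_integral_basis_measure_swap) (use fin in measurable)
  also have "\<dots> = (\<integral>\<^sup>+y. (\<integral>\<^sup>+x. h (x + - y) * g x \<partial>basis_measure B) \<partial>basis_measure C)"
  proof (rule nn_integral_cong_AE, use AE_basis_measure_span[of C] in \<open>elim eventually_mono\<close>)
    fix y assume "y \<in> span C"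
    then have "y \<in> span B" by (simp add: span)
    then show "(\<integral>\<^sup>+x. h x * g (y + x) \<partial>basis_measure B) = (\<integral>\<^sup>+x. h (x + - y) * g x \<partial>basis_measure B)"
      using nn_integral_basis_measure_translate[of B y "\<lambda>x. h (x + - y) * g x"] fin
      by (simp add: add.commute)
  qed
  also have "\<dots> = (\<integral>\<^sup>+x. (\<integral>\<^sup>+y. h (x + - y) * g x \<partial>basis_measure C) \<partial>basis_measure B)"
    by (rule nn_integral_basis_measure_swap[symmetric]) (use fin in measurable)
  also have "\<dots> = (\<integral>\<^sup>+x. (\<integral>\<^sup>+y. h (- y + x) \<partial>basis_measure C) * g x \<partial>basis_measure B)"
    by (simp add: nn_integral_multc add.commute)
  also have "\<dots> = (\<integral>\<^sup>+x. (\<integral>\<^sup>+y. h (y + x) \<partial>basis_measure C) * g x \<partial>basis_measure B)"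
  proof (intro nn_integral_cong)
    fix x
    show "(\<integral>\<^sup>+y. h (- y + x) \<partial>basis_measure C) * g x = (\<integral>\<^sup>+y. h (y + x) \<partial>basis_measure C) * g x"
      using nn_integral_basis_measure_reflect[of C "\<lambda>y. h (y + x)"] fin by simp
  qed
  also have "\<dots> = (\<integral>\<^sup>+x. (\<integral>\<^sup>+y. h y \<partial>basis_measure C) * g x \<partial>basis_measure B)"
    using AE_basis_measure_span[of B] by (intro nn_integral_cong_AE, elim eventually_mono)
      (simp add: nn_integral_basis_measure_translate fin span)
  also have "\<dots> = emeasure (basis_measure C) X"
    using D by (simp add: g_def h_def nn_integral_cmult)
  finally show "emeasure (basis_measure B) X = emeasure (basis_measure C) X" .
qed simp

definition fundamental_domain :: "'v::real_vector set \<Rightarrow> 'v set \<Rightarrow> 'v set \<Rightarrow> bool" where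
  "fundamental_domain S Z D \<longleftrightarrow> D \<subseteq> S \<and> (\<forall>x\<in>S. \<exists>!z. z \<in> Z \<and> x - z \<in> D)"

text \<open>
  Each of the two domains is cut into pieces by the lattice translates of the other one, and the pieces
  agree up to translation by lattice vectors.
\<close>

lemma emeasure_fundamental_domains:
  fixes B :: "'v::euclidean_space set"
  assumes fin: "finite B" and Z: "countable Z" "Z \<subseteq> span B" "\<And>z. z \<in> Z \<Longrightarrow> - z \<in> Z"
    and [measurable]: "C \<in> sets borel" "D \<in> sets borel"
    and C: "fundamental_domain (span B) Z C" and D: "fundamental_domain (span B) Z D"
  shows "emeasure (basis_measure B) C = emeasure (basis_measure B) D"
proof -
  have piece: "emeasure (basis_measure B) X = (\<integral>\<^sup>+z. emeasure (basis_measure B) {x \<in> X. x - z \<in> Y} \<partial>count_space Z)"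
    if [measurable]: "X \<in> sets borel" "Y \<in> sets borel" and X: "fundamental_domain (span B) Z X"
      and Y: "fundamental_domain (span B) Z Y" for X Y
  proof -
    have "X = (\<Union>z\<in>Z. {x \<in> X. x - z \<in> Y})"
      using X Y unfolding fundamental_domain_def by blast
    moreover have "disjoint_family_on (\<lambda>z. {x \<in> X. x - z \<in> Y}) Z"
      using X Y unfolding fundamental_domain_def disjoint_family_on_def by blast
    moreover have "{x \<in> X. x - z \<in> Y} \<in> sets borel" for z
    proof -
      have "{x \<in> X. x - z \<in> Y} = X \<inter> (\<lambda>x. x - z) -` Y" by blast
      moreover have "(\<lambda>x. x - z) -` Y \<in> sets borel"
        using measurable_sets[of "\<lambda>x. x - z" borel borel Y] by simp
      ultimately show ?thesis by simp
    qed
    ultimately show ?thesis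
      using emeasure_UN_countable[of Z "\<lambda>z. {x \<in> X. x - z \<in> Y}" "basis_measure B"] Z(1)
      by simp
  qed
  have shift: "emeasure (basis_measure B) {x \<in> C. x - z \<in> D} = emeasure (basis_measure B) {x \<in> D. x - (- z) \<in> C}"
    if "z \<in> Z" for z
  proof -
    have "emeasure (basis_measure B) {x \<in> C. x - z \<in> D} = (\<integral>\<^sup>+x. indicator {x \<in> C. x - z \<in> D} x \<partial>basis_measure B)"
      by (simp add: nn_integral_indicator)
    also have "\<dots> = (\<integral>\<^sup>+x. indicator {x \<in> C. x - z \<in> D} (x + z) \<partial>basis_measure B)"
      using that Z fin by (subst nn_integral_basis_measure_translate) auto
    also have "\<dots> = (\<integral>\<^sup>+x. indicator {x \<in> D. x - (- z) \<in> C} x \<partial>basis_measure B)"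
      by (intro nn_integral_cong) (auto simp: indicator_def)
    also have "\<dots> = emeasure (basis_measure B) {x \<in> D. x - (- z) \<in> C}"
      by (simp add: nn_integral_indicator)
    finally show ?thesis .
  qed
  have "bij_betw uminus Z Z"
    using Z(3) by (intro bij_betwI[of _ _ _ uminus]) auto
  then have "(\<integral>\<^sup>+z. emeasure (basis_measure B) {x \<in> D. x - (- z) \<in> C} \<partial>count_space Z) =
      (\<integral>\<^sup>+z. emeasure (basis_measure B) {x \<in> D. x - z \<in> C} \<partial>count_space Z)"
    by (rule nn_integral_bij_count_space)
  moreover have "(\<integral>\<^sup>+z. emeasure (basis_measure B) {x \<in> C. x - z \<in> D} \<partial>count_space Z) =
      (\<integral>\<^sup>+z. emeasure (basis_measure B) {x \<in> D. x - (- z) \<in> C} \<partial>count_space Z)"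
    by (intro nn_integral_cong) (use shift in simp)
  ultimately show ?thesis
    using piece[OF _ _ C D] piece[OF _ _ D C] by simp
qed


definition unit_cell :: "'v::real_vector set \<Rightarrow> 'v set" where
  "unit_cell B = {\<Sum>b\<in>B. c b *\<^sub>R b | c. \<forall>b\<in>B. 0 \<le> c b \<and> c b < (1::real)}"

lemma independent_coordinates:
  fixes B :: "'v::euclidean_space set"
  assumes "independent B"
  shows "\<exists>\<phi> :: 'v \<Rightarrow> 'v \<Rightarrow> real. (\<forall>b. linear (\<phi> b)) \<and>
    (\<forall>b\<in>B. \<forall>c. \<phi> b (\<Sum>b\<in>B. c b *\<^sub>R b) = c b) \<and>
    (\<forall>x\<in>span B. (\<Sum>b\<in>B. \<phi> b x *\<^sub>R b) = x)"
proof -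
  have fin: "finite B" using assms by (rule independent_imp_finite)
  have "\<exists>\<phi>. \<forall>b. linear (\<phi> b) \<and> (\<forall>x\<in>B. \<phi> b x = (if x = b then 1 else 0 :: real))"
  proof (rule choice, rule allI)
    fix b
    show "\<exists>g. linear g \<and> (\<forall>x\<in>B. g x = (if x = b then 1 else 0 :: real))"
      using linear_independent_extend[OF assms, of "\<lambda>x. if x = b then 1 else 0 :: real"] .
  qed
  then obtain \<phi> :: "'v \<Rightarrow> 'v \<Rightarrow> real" where \<phi>: "\<And>b. linear (\<phi> b)"
    "\<And>b x. x \<in> B \<Longrightarrow> \<phi> b x = (if x = b then 1 else 0)"
    by auto
  have 1: "\<phi> b (\<Sum>b\<in>B. c b *\<^sub>R b) = c b" if "b \<in> B" for b c
    using that fin by (simp add: linear_sum[OF \<phi>(1)] linear_scale[OF \<phi>(1)] \<phi>(2) if_distrib cong: if_cong)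
  have "(\<Sum>b\<in>B. \<phi> b x *\<^sub>R b) = x" if "x \<in> span B" for x
  proof -
    have "x \<in> range (\<lambda>u. \<Sum>b\<in>B. u b *\<^sub>R b)" using that span_finite[OF fin] by simp
    then obtain u where "x = (\<Sum>b\<in>B. u b *\<^sub>R b)" by (rule imageE)
    then show ?thesis using 1[of _ u] by simp
  qed
  with \<phi>(1) 1 show ?thesis by (intro exI[of _ \<phi>] conjI) simp_all
qed

text \<open>
  Subtracting the integral parts of the coordinates moves every point of the span into the cell, and in
  exactly one way because the cell is half-open.
\<close>

lemma unit_cell_facts:
  fixes B :: "'v::euclidean_space set"
  assumes B: "independent B"
  defines "Z \<equiv> {\<Sum>b\<in>B. of_int (c b) *\<^sub>R b | c. True}"
  shows "unit_cell B \<in> sets borel" "emeasure (basis_measure B) (unit_cell B) = 1"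
    "fundamental_domain (span B) Z (unit_cell B)"
proof -
  have fin: "finite B" using B by (rule independent_imp_finite)
  from independent_coordinates[OF B] obtain \<phi> :: "'v \<Rightarrow> 'v \<Rightarrow> real" where
    coords: "(\<forall>b. linear (\<phi> b)) \<and> (\<forall>b\<in>B. \<forall>c. \<phi> b (\<Sum>b\<in>B. c b *\<^sub>R b) = c b) \<and>
      (\<forall>x\<in>span B. (\<Sum>b\<in>B. \<phi> b x *\<^sub>R b) = x)"
    by (rule exE)
  have \<phi>: "linear (\<phi> b)"
    "b \<in> B \<Longrightarrow> \<phi> b (\<Sum>b\<in>B. c b *\<^sub>R b) = c b"
    "x \<in> span B \<Longrightarrow> (\<Sum>b\<in>B. \<phi> b x *\<^sub>R b) = x" for b c x
    using coords by simp_all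
  have sp: "(\<Sum>b\<in>B. c b *\<^sub>R b) \<in> span B" for c
    by (intro span_sum span_scale span_base)
  have cell: "unit_cell B = {x \<in> span B. \<forall>b\<in>B. \<phi> b x \<in> {0..<1}}" (is "_ = ?R")
  proof
    show "unit_cell B \<subseteq> ?R" using sp by (auto simp: unit_cell_def \<phi>(2))
    show "?R \<subseteq> unit_cell B"
    proof
      fix x assume x: "x \<in> ?R"
      then have "x = (\<Sum>b\<in>B. \<phi> b x *\<^sub>R b)" using \<phi>(3)[of x] by simp
      then show "x \<in> unit_cell B"
        unfolding unit_cell_def using x by (intro CollectI exI[of _ "\<lambda>b. \<phi> b x"]) simp
    qed
  qed
  have "\<phi> b \<in> borel_measurable borel" for b
    using \<phi>(1) by (intro borel_measurable_continuous_onI linear_continuous_on)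
      (simp add: linear_conv_bounded_linear)
  then have m: "\<phi> b -` {0..<1} \<in> sets borel" for b
    using measurable_sets[of "\<phi> b" borel borel "{0..<1}"] by simp
  have "unit_cell B = span B \<inter> (\<Inter>b\<in>B. \<phi> b -` {0..<1})" by (auto simp: cell)
  moreover have "(\<Inter>b\<in>B. \<phi> b -` {0..<1}) \<in> sets borel"
  proof (cases "B = {}")
    case False
    then show ?thesis using m fin by (intro sets.finite_INT) auto
  qed simp
  ultimately show meas: "unit_cell B \<in> sets borel"
    by (simp add: borel_closed closed_subspace[OF subspace_span] sets.Int)
  have "emeasure (basis_measure B) (unit_cell B) =
      emeasure (PiM B (\<lambda>_. lborel)) ((\<lambda>c. \<Sum>b\<in>B. c b *\<^sub>R b) -` unit_cell B \<inter> space (PiM B (\<lambda>_. lborel)))"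
    unfolding basis_measure_def by (rule emeasure_distr) (simp_all add: meas)
  also have "(\<lambda>c. \<Sum>b\<in>B. c b *\<^sub>R b) -` unit_cell B \<inter> space (PiM B (\<lambda>_. lborel)) = (\<Pi>\<^sub>E b\<in>B. {0..<1::real})"
    using sp by (auto simp: cell \<phi>(2) space_PiM PiE_iff)
  also have "emeasure (PiM B (\<lambda>_. lborel)) (\<Pi>\<^sub>E b\<in>B. {0..<1::real}) = 1"
    using fin by (simp add: product_lborel.emeasure_PiM)
  finally show "emeasure (basis_measure B) (unit_cell B) = 1" .
  show "fundamental_domain (span B) Z (unit_cell B)"
    unfolding fundamental_domain_def
  proof (intro conjI ballI)
    show "unit_cell B \<subseteq> span B" by (auto simp: cell)
    fix x assume x: "x \<in> span B"
    define z where "z = (\<Sum>b\<in>B. of_int \<lfloor>\<phi> b x\<rfloor> *\<^sub>R b)"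
    show "\<exists>!z. z \<in> Z \<and> x - z \<in> unit_cell B"
    proof (intro ex1I[of _ z] conjI)
      show "z \<in> Z" by (auto simp: Z_def z_def)
      have "\<phi> b (x - z) \<in> {0..<1}" if "b \<in> B" for b
        using that by (simp add: linear_diff[OF \<phi>(1)] \<phi>(2) z_def) linarith
      moreover have "x - z \<in> span B" using x sp by (simp add: z_def span_diff)
      ultimately show "x - z \<in> unit_cell B" by (simp add: cell)
    next
      fix z' assume z': "z' \<in> Z \<and> x - z' \<in> unit_cell B"
      then obtain c where c: "z' = (\<Sum>b\<in>B. of_int (c b) *\<^sub>R b)" by (auto simp: Z_def)
      have "c b = \<lfloor>\<phi> b x\<rfloor>" if "b \<in> B" for b
      proof -
        have "\<phi> b (x - z') \<in> {0..<1}" using z' that by (simp add: cell)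
        then show ?thesis
          using that by (simp add: linear_diff[OF \<phi>(1)] \<phi>(2) c) linarith
      qed
      then show "z' = z" by (simp add: c z_def)
    qed
  qed
qed

text \<open>
  The unit cells of both bases are fundamental domains of the same lattice, so one of them has measure
  one for both measures.
\<close>

lemma basis_measure_eq_if_lattice_basis:
  assumes "lattice_basis S B" "lattice_basis S C"
  shows "basis_measure B = basis_measure C"
proof -
  define Z where "Z = {x \<in> S. \<forall>b\<in>Basis. x \<bullet> b \<in> \<int>}"
  have B: "independent B" "span B = S" "Z = {\<Sum>b\<in>B. of_int (c b) *\<^sub>R b | c. True}"
    and C: "independent C" "span C = S" "Z = {\<Sum>b\<in>C. of_int (c b) *\<^sub>R b | c. True}"
    using assms by (simp_all add: lattice_basis_def Z_def)
  have fin: "finite B" "finite C" using B C by (auto intro: independent_imp_finite)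
  have "Z \<subseteq> (\<lambda>c. \<Sum>b\<in>B. of_int (c b) *\<^sub>R b) ` (\<Pi>\<^sub>E b\<in>B. UNIV)"
  proof
    fix z assume "z \<in> Z"
    then obtain c where "z = (\<Sum>b\<in>B. of_int (c b) *\<^sub>R b)" by (auto simp: B(3))
    then have "z = (\<Sum>b\<in>B. of_int (restrict c B b) *\<^sub>R b)" by simp
    then show "z \<in> (\<lambda>c. \<Sum>b\<in>B. of_int (c b) *\<^sub>R b) ` (\<Pi>\<^sub>E b\<in>B. UNIV)"
      by (intro image_eqI[of _ _ "restrict c B"]) auto
  qed
  moreover have "countable (\<Pi>\<^sub>E b\<in>B. (UNIV :: int set))"
    using fin by (intro countable_PiE) auto
  ultimately have "countable Z" using countable_subset[OF _ countable_image] by blast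
  moreover have "Z \<subseteq> span B" by (simp add: Z_def B)
  moreover have "- z \<in> Z" if "z \<in> Z" for z
    using that B(2) by (auto simp: Z_def intro: span_neg)
  ultimately have "emeasure (basis_measure C) (unit_cell B) = emeasure (basis_measure C) (unit_cell C)"
    using unit_cell_facts[OF B(1), folded B(3)] unit_cell_facts[OF C(1), folded C(3)] fin B(2) C(2)
    by (intro emeasure_fundamental_domains[of C Z]) simp_all
  then show ?thesis
    using unit_cell_facts[OF B(1)] unit_cell_facts[OF C(1)]
    by (intro basis_measure_eqI[OF fin, of "unit_cell B"]) (simp_all add: B(2) C(2))
qed

lemma lattice_measure_eq:
  assumes "lattice_basis S B"
  shows "lattice_measure S = basis_measure B"
proof -
  have "lattice_basis S (SOME B. lattice_basis S B)" using assms by (rule someI)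
  from basis_measure_eq_if_lattice_basis[OF this assms] show ?thesis
    by (simp add: lattice_measure_def basis_measure_def)
qed

section \<open>A closed formula for the Laplace transform of one cone\<close>

text \<open>
  The elements above a given nonzero element form a chain. This is the only property of nested sets that
  enters the computation of the integral.
\<close>

definition forest :: "'a::{finite, bounded_lattice} set \<Rightarrow> bool" where
  "forest N \<longleftrightarrow> bot \<notin> N \<and>
     (\<forall>a\<in>N. \<forall>b\<in>N. \<forall>c. c \<noteq> bot \<longrightarrow> c \<le> a \<longrightarrow> c \<le> b \<longrightarrow> a \<le> b \<or> b \<le> a)"

lemma forestD: "forest N \<Longrightarrow> a \<in> N \<Longrightarrow> b \<in> N \<Longrightarrow> c \<noteq> bot \<Longrightarrow> c \<le> a \<Longrightarrow> c \<le> b \<Longrightarrow> a \<le> b \<or> b \<le> a"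
  unfolding forest_def by blast

lemma forest_subset: "forest N \<Longrightarrow> M \<subseteq> N \<Longrightarrow> forest M"
  unfolding forest_def by (meson subsetD)

definition max_below :: "'a::order set \<Rightarrow> 'a \<Rightarrow> 'a set" where
  "max_below S c = {d \<in> S. d < c \<and> \<not> (\<exists>e\<in>S. d < e \<and> e < c)}"

definition excess :: "('a::order \<Rightarrow> 'k::field) \<Rightarrow> 'a set \<Rightarrow> 'a \<Rightarrow> 'k" where
  "excess v S c = (\<Sum>d\<in>max_below S c. v d)"

text \<open>
  One summand of the closed formula for the Laplace transform of the cone of a forest with root \<open>top\<close>,
  where \<open>u c\<close> and \<open>v c\<close> stand for \<open>E\<^sub>c\<^sup>+\<close> and \<open>E\<^sub>c\<^sup>-\<close>. The root has no second factor because its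
  \<open>m\<close>-coordinate vanishes on the cone.
\<close>

definition tree_term ::
  "'a::{order, order_top} set \<Rightarrow> 'a set \<Rightarrow> ('a \<Rightarrow> 'k::field) \<Rightarrow> ('a \<Rightarrow> 'k) \<Rightarrow> 'k" where
  "tree_term N S u v = (-1) ^ card S * (\<Prod>c\<in>N. inverse (u c + excess v S c)) *
     (\<Prod>c\<in>N - {top}. inverse (v c - excess v S c))"

definition tree_wave :: "'a::{order, order_top} set \<Rightarrow> ('a \<Rightarrow> 'k::field) \<Rightarrow> ('a \<Rightarrow> 'k) \<Rightarrow> 'k" where
  "tree_wave N u v = (\<Sum>S\<in>Pow (N - {top}). tree_term N S u v)"

text \<open>
  Integrating out a leaf \<open>c\<^sub>0\<close> shifts the energies of the elements above it: this amount is added to \<open>u h\<close>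
  and subtracted from \<open>v h\<close>.
\<close>

definition absorb :: "'a::order \<Rightarrow> ('a \<Rightarrow> 'k::field) \<Rightarrow> 'a \<Rightarrow> 'k" where
  "absorb c0 v h = (if c0 < h then v c0 else 0)"

lemma max_below_exists:
  assumes "finite S" "e \<in> S" "e < c"
  shows "\<exists>d\<in>max_below S c. e \<le> (d::'a::order)"
proof -
  have "finite {d \<in> S. d < c}" using assms by simp
  then obtain d where d: "d \<in> {d \<in> S. d < c}" "e \<le> d"
    "\<And>x. x \<in> {d \<in> S. d < c} \<Longrightarrow> d \<le> x \<Longrightarrow> x = d"
    using finite_has_maximal2[of "{d \<in> S. d < c}" e] assms by auto
  then have "d \<in> max_below S c"
    unfolding max_below_def by (auto simp: less_le)
  with d show ?thesis by blast
qed

text \<open>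
  After a minimal element \<open>c\<^sub>0\<close> of the forest is added to \<open>S\<close>, it counts in the excess at \<open>c\<close> only if no
  other element of \<open>S\<close> lies between them. If there is one, then by the forest property exactly one element
  of \<open>max_below S c\<close> lies above \<open>c\<^sub>0\<close>, and the reduction of its energy by \<open>v c\<^sub>0\<close> cancels the summand
  \<open>absorb c\<^sub>0 v c\<close>.
\<close>

lemma excess_insert_minimal:
  fixes N :: "'a::{finite, bounded_lattice} set"
  assumes N: "forest N" and c0: "c0 \<in> N" and min: "\<And>d. d \<in> N \<Longrightarrow> \<not> d < c0"
    and S: "S \<subseteq> N - {c0}" and c: "c \<in> N"
  shows "excess v (insert c0 S) c = absorb c0 v c + excess (\<lambda>h. v h - absorb c0 v h) S c"
proof -
  define P where "P \<longleftrightarrow> (\<exists>e\<in>S. c0 < e \<and> e < c)"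
  have c0S: "c0 \<notin> S" and SN: "S \<subseteq> N" using S by auto
  have mb: "max_below (insert c0 S) c = max_below S c \<union> (if c0 < c \<and> \<not> P then {c0} else {})"
    using min SN by (auto simp: max_below_def P_def)
  have "c0 \<notin> max_below S c" using c0S by (simp add: max_below_def)
  then have 1: "excess v (insert c0 S) c = excess v S c + (if c0 < c \<and> \<not> P then v c0 else 0)"
    by (simp add: excess_def mb)
  have up: "{d \<in> max_below S c. c0 < d} = {} \<or> (\<exists>d. {d \<in> max_below S c. c0 < d} = {d})"
  proof -
    have "d = d'" if "d \<in> max_below S c" "d' \<in> max_below S c" "c0 < d" "c0 < d'" for d d'
    proof -
      have "c0 \<noteq> bot" using N c0 by (auto simp: forest_def)
      moreover have "d \<in> N" "d' \<in> N" "c0 \<le> d" "c0 \<le> d'"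
        using that SN by (auto simp: max_below_def)
      ultimately have "d \<le> d' \<or> d' \<le> d" using forestD[OF N] by blast
      then show "d = d'" using that by (auto simp: max_below_def order.strict_iff_order)
    qed
    then show ?thesis by blast
  qed
  have P: "P \<longleftrightarrow> {d \<in> max_below S c. c0 < d} \<noteq> {}"
  proof
    assume P
    then obtain e where "e \<in> S" "c0 < e" "e < c" by (auto simp: P_def)
    then obtain d where "d \<in> max_below S c" "e \<le> d"
      using max_below_exists[of S e c] by auto
    with \<open>c0 < e\<close> show "{d \<in> max_below S c. c0 < d} \<noteq> {}" by (auto intro: less_le_trans)
  next
    assume "{d \<in> max_below S c. c0 < d} \<noteq> {}"
    then show P by (auto simp: P_def max_below_def)
  qed
  have "excess (\<lambda>h. v h - absorb c0 v h) S c = excess v S c - (\<Sum>d\<in>max_below S c. absorb c0 v d)"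
    by (simp add: excess_def sum_subtractf)
  also have "(\<Sum>d\<in>max_below S c. absorb c0 v d) = (\<Sum>d\<in>{d \<in> max_below S c. c0 < d}. v c0)"
    unfolding absorb_def by (intro sum.mono_neutral_cong_right) auto
  also have "\<dots> = (if P then v c0 else 0)"
  proof (cases "{d \<in> max_below S c. c0 < d} = {}")
    case True
    then have "\<not> P" using P by blast
    then show ?thesis unfolding True by simp
  next
    case False
    then obtain d where d: "{d \<in> max_below S c. c0 < d} = {d}" using up by blast
    have P using P False by blast
    then show ?thesis unfolding d by simp
  qed
  finally have 2: "excess (\<lambda>h. v h - absorb c0 v h) S c = excess v S c - (if P then v c0 else 0)" .
  have "P \<Longrightarrow> c0 < c" by (auto simp: P_def)
  then show ?thesis unfolding 1 2 by (auto simp: absorb_def)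
qed

text \<open>
  Sorting the sets \<open>S\<close> by whether they contain the leaf yields two copies of the formula for the
  smaller forest. This matches the integral over the fibre of the cone, which is a difference of two
  exponentials.
\<close>

lemma tree_wave_remove_leaf:
  fixes N :: "'a::{finite, bounded_lattice} set" and u v :: "'a \<Rightarrow> 'k::field"
  assumes N: "forest N" and c0: "c0 \<in> N" "c0 \<noteq> top" and min: "\<And>d. d \<in> N \<Longrightarrow> \<not> d < c0"
  shows "tree_wave N u v = inverse (u c0) * inverse (v c0) *
    (tree_wave (N - {c0}) u v -
     tree_wave (N - {c0}) (\<lambda>h. u h + absorb c0 v h) (\<lambda>h. v h - absorb c0 v h))"
    (is "_ = ?c * (_ - tree_wave _ ?u ?v)")
proof -
  let ?M = "N - {c0} - {top}"
  have NM: "N - {top} = insert c0 ?M" using c0 by auto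
  have nb: "max_below S c0 = {}" if "S \<subseteq> N" for S
    using that min by (auto simp: max_below_def)
  have 1: "tree_term N S u v = ?c * tree_term (N - {c0}) S u v" if "S \<in> Pow ?M" for S
  proof -
    have "max_below S c0 = {}" by (rule nb) (use that in auto)
    moreover have "(\<Prod>c\<in>N. inverse (u c + excess v S c)) =
        inverse (u c0 + excess v S c0) * (\<Prod>c\<in>N - {c0}. inverse (u c + excess v S c))"
      using c0 by (intro prod.remove) auto
    moreover have "(\<Prod>c\<in>N - {top}. inverse (v c - excess v S c)) =
        inverse (v c0 - excess v S c0) * (\<Prod>c\<in>?M. inverse (v c - excess v S c))"
      unfolding NM by (intro prod.insert) auto
    ultimately show ?thesis by (simp add: tree_term_def excess_def)
  qed
  have 2: "tree_term N (insert c0 S) u v = - (?c * tree_term (N - {c0}) S ?u ?v)" if "S \<in> Pow ?M" for S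
  proof -
    have c0S: "c0 \<notin> S" using that by auto
    have "max_below (insert c0 S) c0 = {}" by (rule nb) (use that c0 in auto)
    moreover have "(\<Prod>c\<in>N. inverse (u c + excess v (insert c0 S) c)) =
        inverse (u c0 + excess v (insert c0 S) c0) * (\<Prod>c\<in>N - {c0}. inverse (u c + excess v (insert c0 S) c))"
      using c0 by (intro prod.remove) auto
    moreover have "(\<Prod>c\<in>N - {top}. inverse (v c - excess v (insert c0 S) c)) =
        inverse (v c0 - excess v (insert c0 S) c0) * (\<Prod>c\<in>?M. inverse (v c - excess v (insert c0 S) c))"
      unfolding NM by (intro prod.insert) auto
    moreover have e: "excess v (insert c0 S) c = absorb c0 v c + excess ?v S c" if "c \<in> N" for c
      using excess_insert_minimal[OF N c0(1) min _ that, of S v] \<open>S \<in> Pow ?M\<close> by auto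
    have "(\<Prod>c\<in>N - {c0}. inverse (u c + excess v (insert c0 S) c)) =
        (\<Prod>c\<in>N - {c0}. inverse (?u c + excess ?v S c))"
      by (intro prod.cong) (simp_all add: e algebra_simps)
    moreover have "(\<Prod>c\<in>?M. inverse (v c - excess v (insert c0 S) c)) =
        (\<Prod>c\<in>?M. inverse (?v c - excess ?v S c))"
      by (intro prod.cong) (simp_all add: e algebra_simps)
    ultimately show ?thesis using c0S by (simp add: tree_term_def excess_def)
  qed
  have "tree_wave N u v = (\<Sum>S\<in>Pow ?M. tree_term N S u v) + (\<Sum>S\<in>insert c0 ` Pow ?M. tree_term N S u v)"
    unfolding tree_wave_def NM Pow_insert by (intro sum.union_disjoint) auto
  also have "(\<Sum>S\<in>insert c0 ` Pow ?M. tree_term N S u v) = (\<Sum>S\<in>Pow ?M. tree_term N (insert c0 S) u v)"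
  proof -
    have "inj_on (insert c0) (Pow ?M)" by (auto simp: inj_on_def)
    then show ?thesis by (simp add: sum.reindex)
  qed
  also have "(\<Sum>S\<in>Pow ?M. tree_term N S u v) = ?c * tree_wave (N - {c0}) u v"
    unfolding tree_wave_def sum_distrib_left by (intro sum.cong refl 1) 
  also have "(\<Sum>S\<in>Pow ?M. tree_term N (insert c0 S) u v) = - (?c * tree_wave (N - {c0}) ?u ?v)"
    unfolding tree_wave_def sum_distrib_left sum_negf[symmetric] by (intro sum.cong refl 2)
  finally show ?thesis by (simp add: right_diff_distrib)
qed

lemma inner_plus_vec [simp]: "plus_vec h \<bullet> y = p_coord h y" "y \<bullet> plus_vec h = p_coord h y"
  by (cases y, simp add: plus_vec_def inner_axis inner_commute)+

lemma inner_minus_vec [simp]: "minus_vec h \<bullet> y = m_coord h y" "y \<bullet> minus_vec h = m_coord h y"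
  by (cases y, simp add: minus_vec_def inner_axis inner_commute)+

lemma coord_plus_vec [simp]: "p_coord g (plus_vec h) = (if g = h then 1 else 0)" "m_coord g (plus_vec h) = 0"
  by (auto simp: plus_vec_def axis_def)

lemma coord_minus_vec [simp]: "m_coord g (minus_vec h) = (if g = h then 1 else 0)" "p_coord g (minus_vec h) = 0"
  by (auto simp: minus_vec_def axis_def)

lemma coord_sum [simp]:
  "p_coord g (\<Sum>x\<in>X. a x) = (\<Sum>x\<in>X. p_coord g (a x))" "m_coord g (\<Sum>x\<in>X. a x) = (\<Sum>x\<in>X. m_coord g (a x))"
  by (induction X rule: infinite_finite_induct) auto

definition plus_pole :: "'a::{finite, order} set \<Rightarrow> 'a \<Rightarrow> 'a energy_space" where
  "plus_pole S c = plus_vec c + (\<Sum>d\<in>max_below S c. minus_vec d)"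

definition minus_pole :: "'a::{finite, order} set \<Rightarrow> 'a \<Rightarrow> 'a energy_space" where
  "minus_pole S c = minus_vec c - (\<Sum>d\<in>max_below S c. minus_vec d)"

definition tree_poles :: "'a::{finite, bounded_lattice} set \<Rightarrow> 'a energy_space set" where
  "tree_poles N = {plus_pole S c | S c. S \<subseteq> N - {top} \<and> c \<in> N} \<union>
     {minus_pole S c | S c. S \<subseteq> N - {top} \<and> c \<in> N - {top}}"

lemma tree_polesI:
  "S \<subseteq> N - {top} \<Longrightarrow> c \<in> N \<Longrightarrow> plus_pole S c \<in> tree_poles N"
  "S \<subseteq> N - {top} \<Longrightarrow> c \<in> N - {top} \<Longrightarrow> minus_pole S c \<in> tree_poles N"
  unfolding tree_poles_def by blast+

abbreviation tree_ratfun :: "'a::{finite, bounded_lattice} set \<Rightarrow> 'a energy_space ratfun" where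
  "tree_ratfun N \<equiv> tree_wave N (\<lambda>h. of_polyfun (E_plus h)) (\<lambda>h. of_polyfun (E_minus h))"

lemma inner_poles:
  "plus_pole S c \<bullet> y = p_coord c y + excess (\<lambda>h. m_coord h y) S c"
  "minus_pole S c \<bullet> y = m_coord c y - excess (\<lambda>h. m_coord h y) S c"
  by (simp_all add: plus_pole_def minus_pole_def excess_def inner_add_left inner_diff_left inner_sum_left)

lemma of_polyfun_poles:
  "of_polyfun (E_plus c) + excess (\<lambda>h. of_polyfun (E_minus h)) S c = of_polyfun (linear_form (plus_pole S c))"
  "of_polyfun (E_minus c) - excess (\<lambda>h. of_polyfun (E_minus h)) S c = of_polyfun (linear_form (minus_pole S c))"
  by (simp_all add: plus_pole_def minus_pole_def excess_def E_plus_def E_minus_def linear_form_simps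
      linear_form_sum of_polyfun_simps of_polyfun_sum)

lemma p_coord_plus_pole: "p_coord g (plus_pole S c) = (if g = c then 1 else 0)"
  by (simp add: plus_pole_def)

lemma m_coord_plus_pole: "m_coord g (plus_pole S c) = (if g \<in> max_below S c then 1 else 0)"
  by (simp add: plus_pole_def)

lemma p_coord_minus_pole: "p_coord g (minus_pole S c) = 0"
  by (simp add: minus_pole_def)

lemma m_coord_minus_pole: "m_coord c (minus_pole S c) = 1"
proof -
  have "c \<notin> max_below S c" by (simp add: max_below_def)
  then show ?thesis by (auto simp: minus_pole_def intro!: sum.neutral)
qed

lemma zero_notin_tree_poles: "0 \<notin> tree_poles N"
proof -
  have "0 \<noteq> plus_pole S c" for S and c :: 'a
  proof
    assume "0 = plus_pole S c"
    then have "p_coord c 0 = p_coord c (plus_pole S c)" by (rule arg_cong)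
    then show False by (simp add: p_coord_plus_pole)
  qed
  moreover have "0 \<noteq> minus_pole S c" for S and c :: 'a
  proof
    assume "0 = minus_pole S c"
    then have "m_coord c 0 = m_coord c (minus_pole S c)" by (rule arg_cong)
    then show False by (simp add: m_coord_minus_pole)
  qed
  ultimately show ?thesis unfolding tree_poles_def by blast
qed

text \<open>
  The vectors \<open>plus_pole S c\<close> lie in the cone of the forest, so these denominators do not vanish on the
  interior of its dual. The poles \<open>minus_pole S c\<close> are spurious: they may meet this interior.
\<close>

lemma evaluates_off_tree_ratfun:
  "evaluates_off (tree_poles N) (tree_ratfun N) (\<lambda>y. tree_wave N (\<lambda>h. p_coord h y) (\<lambda>h. m_coord h y))"
proof -
  note nz = zero_notin_tree_poles[of N]
  have sgn: "evaluates_off (tree_poles N) ((-1) ^ n) (\<lambda>y. (-1) ^ n)" for n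
  proof -
    have "of_polyfun (- p) = - of_polyfun p" for p :: "'a energy_space polyfun"
      by (simp add: of_polyfun_def)
    then have "of_polyfun ((-1) ^ n) = (-1 :: 'a energy_space ratfun) ^ n"
      by (induction n) (simp_all add: of_polyfun_simps)
    moreover have "peval ((-1) ^ n) = (\<lambda>y :: 'a energy_space. (-1) ^ n)" 
      by (rule ext, induction n) simp_all
    ultimately show ?thesis
      using evaluates_off_of_polyfun[OF nz, of "(-1) ^ n"] by simp
  qed
  have inv: "evaluates_off (tree_poles N) (inverse (of_polyfun (linear_form (plus_pole S c))))
      (\<lambda>y. inverse (plus_pole S c \<bullet> y))" if "S \<subseteq> N - {top}" "c \<in> N" for S c
    by (rule evaluates_off_inverse[OF nz]) (intro tree_polesI that)
  have inv': "evaluates_off (tree_poles N) (inverse (of_polyfun (linear_form (minus_pole S c))))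
      (\<lambda>y. inverse (minus_pole S c \<bullet> y))" if "S \<subseteq> N - {top}" "c \<in> N - {top}" for S c
    by (rule evaluates_off_inverse[OF nz]) (intro tree_polesI that)
  show ?thesis
    unfolding tree_wave_def tree_term_def of_polyfun_poles inner_poles[symmetric]
  proof (rule evaluates_off_sum[OF nz])
    fix S assume "S \<in> Pow (N - {top})"
    then have S: "S \<subseteq> N - {top}" by simp
    have plus: "evaluates_off (tree_poles N) (\<Prod>c\<in>N. inverse (of_polyfun (linear_form (plus_pole S c))))
        (\<lambda>y. \<Prod>c\<in>N. inverse (plus_pole S c \<bullet> y))"
      by (rule evaluates_off_prod[OF nz]) (rule inv[OF S])
    have minus: "evaluates_off (tree_poles N)
        (\<Prod>c\<in>N - {top}. inverse (of_polyfun (linear_form (minus_pole S c))))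
        (\<lambda>y. \<Prod>c\<in>N - {top}. inverse (minus_pole S c \<bullet> y))"
      by (rule evaluates_off_prod[OF nz]) (rule inv'[OF S])
    show "evaluates_off (tree_poles N)
      ((-1) ^ card S * (\<Prod>c\<in>N. inverse (of_polyfun (linear_form (plus_pole S c)))) *
        (\<Prod>c\<in>N - {top}. inverse (of_polyfun (linear_form (minus_pole S c)))))
      (\<lambda>y. (-1) ^ card S * (\<Prod>c\<in>N. inverse (plus_pole S c \<bullet> y)) *
        (\<Prod>c\<in>N - {top}. inverse (minus_pole S c \<bullet> y)))"
      using evaluates_off_mult[OF nz evaluates_off_mult[OF nz sgn[of "card S"] plus] minus] .
  qed
qed

section \<open>The Laplace integral over the cone of a forest\<close>

text \<open>
  The upper bound of \<open>m\<^sub>c\<close> in the causal cone. Including \<open>- m\<close> at the root makes all ancestors uniform and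
  does not change the values on the cone, where this coordinate is zero.
\<close>

definition ancestor_form :: "'a::{finite, order} \<Rightarrow> 'a energy_space" where
  "ancestor_form c = (\<Sum>h\<in>{c<..}. plus_vec h - minus_vec h)"

lemma coord_ancestor_form [simp]:
  "p_coord h (ancestor_form c) = (if c < h then 1 else 0)"
  "m_coord h (ancestor_form c) = (if c < h then - 1 else 0)"
  by (simp_all add: ancestor_form_def sum_subtractf)

lemma inner_ancestor_form: "x \<bullet> ancestor_form c = (\<Sum>h\<in>{c<..}. p_coord h x - m_coord h x)"
  by (simp add: ancestor_form_def inner_sum_right inner_diff_right)

text \<open>
  At the root the upper bound is dropped: the form is an empty sum there, and the causal inequality of the
  root only says that \<open>p\<close> is nonnegative at the root.
\<close>

definition tree_cone :: "'a::{finite, bounded_lattice} set \<Rightarrow> 'a energy_space set" where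
  "tree_cone N = {x. (\<forall>g. g \<notin> N \<longrightarrow> p_coord g x = 0 \<and> m_coord g x = 0) \<and> m_coord top x = 0 \<and>
     (\<forall>c\<in>N. 0 \<le> p_coord c x \<and> 0 \<le> m_coord c x \<and> (c \<noteq> top \<longrightarrow> m_coord c x \<le> x \<bullet> ancestor_form c))}"

definition tree_basis :: "'a::{finite, bounded_lattice} set \<Rightarrow> 'a energy_space set" where
  "tree_basis N = plus_vec ` N \<union> minus_vec ` (N - {top})"

lemma plus_vec_neq_minus_vec: "plus_vec g \<noteq> minus_vec h"
proof
  assume "plus_vec g = minus_vec h"
  then have "p_coord g (plus_vec g) = p_coord g (minus_vec h)" by (rule arg_cong)
  then show False by simp
qed

lemma plus_vec_eq_iff [simp]: "plus_vec g = plus_vec h \<longleftrightarrow> g = h"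
  by (auto simp: plus_vec_def axis_eq_axis)

lemma minus_vec_eq_iff [simp]: "minus_vec g = minus_vec h \<longleftrightarrow> g = h"
  by (auto simp: minus_vec_def axis_eq_axis)

lemma finite_tree_basis: "finite (tree_basis N)"
  by (simp add: tree_basis_def)

lemma span_tree_basis:
  assumes "x \<in> span (tree_basis N)"
  shows "(\<forall>g. g \<notin> N \<longrightarrow> p_coord g x = 0 \<and> m_coord g x = 0) \<and> m_coord top x = 0"
  using assms
proof (induction rule: span_induct_alt)
  case base
  show ?case by simp
next
  case (step c x y)
  then show ?case by (auto simp: tree_basis_def split: if_splits)
qed

lemma in_span_tree_basis:
  assumes "\<forall>g. g \<notin> N \<longrightarrow> p_coord g x = 0 \<and> m_coord g x = 0" "m_coord top x = 0"
  shows "x \<in> span (tree_basis N)"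
proof -
  let ?z = "(\<Sum>c\<in>N. p_coord c x *\<^sub>R plus_vec c) + (\<Sum>c\<in>N - {top}. m_coord c x *\<^sub>R minus_vec c)"
  have "p_coord g x = p_coord g ?z" and "m_coord g x = m_coord g ?z" for g
    using assms by (auto simp: if_distrib sum.If_cases cong: if_cong)
  then have "x = ?z" by (metis (no_types, lifting) prod_eqI vec_eq_iff)
  also have "\<dots> \<in> span (tree_basis N)"
    by (intro span_add span_sum span_scale span_base) (auto simp: tree_basis_def)
  finally show ?thesis .
qed

text \<open>
  The elements above \<open>c\<close> form a chain. If \<open>f\<close> is the least of them, the form at \<open>c\<close> is \<open>p\<^sub>f\<close> plus the
  difference of the form at \<open>f\<close> and \<open>m\<^sub>f\<close>, which is nonnegative by an inequality of the cone. For
  elements outside the forest this shows that their causal inequality is implied by the others.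
\<close>

lemma ancestor_form_nonneg:
  assumes N: "forest N" "top \<in> N" and x: "x \<in> tree_cone N" and c: "c \<noteq> bot" "c \<noteq> top"
  shows "0 \<le> x \<bullet> ancestor_form c"
proof -
  have "top \<in> N \<inter> {c<..}" using N c by (simp add: top.not_eq_extremum)
  then obtain f where f: "f \<in> N \<inter> {c<..}" "\<And>h. h \<in> N \<inter> {c<..} \<Longrightarrow> h \<le> f \<Longrightarrow> h = f"
    using finite_has_minimal[of "N \<inter> {c<..}"] by auto
  have up: "N \<inter> {c<..} = insert f (N \<inter> {f<..})"
  proof -
    have "f < h" if "h \<in> N" "c < h" "h \<noteq> f" for h
      using forestD[OF N(1), of f h c] f that c(1) by (auto simp: less_le)
    then show ?thesis using f(1) by (auto intro: less_trans)
  qed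
  have restr: "x \<bullet> ancestor_form d = (\<Sum>h\<in>N \<inter> {d<..}. p_coord h x - m_coord h x)" for d
    unfolding inner_ancestor_form using x
    by (intro sum.mono_neutral_right) (auto simp: tree_cone_def)
  have "x \<bullet> ancestor_form c = (p_coord f x - m_coord f x) + x \<bullet> ancestor_form f"
    unfolding restr up by simp
  moreover have "0 \<le> p_coord f x" using f x by (auto simp: tree_cone_def)
  moreover have "m_coord f x \<le> x \<bullet> ancestor_form f"
  proof (cases "f = top")
    case True
    then have "{f<..} = {}" by auto
    then have "x \<bullet> ancestor_form f = 0" by (simp add: inner_ancestor_form)
    then show ?thesis using x True by (simp add: tree_cone_def)
  next
    case False
    then show ?thesis using f x by (auto simp: tree_cone_def)
  qed
  ultimately show ?thesis by simp
qed

text \<open>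
  No inequality of the smaller cone involves the coordinates of a minimal element, so the cone over the
  larger forest is fibred over the cone of the smaller one, with fibre a ray times a segment.
\<close>

lemma tree_cone_fibre:
  assumes c0: "c0 \<in> N" "c0 \<noteq> top" and min: "\<And>d. d \<in> N \<Longrightarrow> \<not> d < c0"
    and x: "x \<in> span (tree_basis (N - {c0}))"
  shows "x + t *\<^sub>R minus_vec c0 + s *\<^sub>R plus_vec c0 \<in> tree_cone N \<longleftrightarrow>
    x \<in> tree_cone (N - {c0}) \<and> 0 \<le> s \<and> 0 \<le> t \<and> t \<le> x \<bullet> ancestor_form c0"
proof -
  note z = span_tree_basis[OF x]
  have a: "(x + t *\<^sub>R minus_vec c0 + s *\<^sub>R plus_vec c0) \<bullet> ancestor_form c = x \<bullet> ancestor_form c"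
    if "c \<in> N" for c
    using min[OF that] by (simp add: inner_add_left)
  have z0: "p_coord c0 x = 0" "m_coord c0 x = 0" using z by auto
  let ?z = "x + t *\<^sub>R minus_vec c0 + s *\<^sub>R plus_vec c0"
  have 1: "(\<forall>g. g \<notin> N \<longrightarrow> p_coord g ?z = 0 \<and> m_coord g ?z = 0) \<and> m_coord top ?z = 0"
    using z c0 by auto
  have 2: "(0 \<le> p_coord c ?z \<and> 0 \<le> m_coord c ?z \<and> (c \<noteq> top \<longrightarrow> m_coord c ?z \<le> ?z \<bullet> ancestor_form c)) \<longleftrightarrow>
      (if c = c0 then 0 \<le> s \<and> 0 \<le> t \<and> t \<le> x \<bullet> ancestor_form c0
       else 0 \<le> p_coord c x \<and> 0 \<le> m_coord c x \<and> (c \<noteq> top \<longrightarrow> m_coord c x \<le> x \<bullet> ancestor_form c))"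
    if "c \<in> N" for c
    unfolding a[OF that] using c0 z0 by auto
  have "?z \<in> tree_cone N \<longleftrightarrow> (\<forall>c\<in>N. (if c = c0 then 0 \<le> s \<and> 0 \<le> t \<and> t \<le> x \<bullet> ancestor_form c0
       else 0 \<le> p_coord c x \<and> 0 \<le> m_coord c x \<and> (c \<noteq> top \<longrightarrow> m_coord c x \<le> x \<bullet> ancestor_form c)))"
    unfolding tree_cone_def mem_Collect_eq using 1 2 by simp
  also have "\<dots> \<longleftrightarrow> x \<in> tree_cone (N - {c0}) \<and> 0 \<le> s \<and> 0 \<le> t \<and> t \<le> x \<bullet> ancestor_form c0"
    unfolding tree_cone_def mem_Collect_eq using z c0 by auto
  finally show ?thesis .
qed

lemma closed_tree_cone: "closed (tree_cone N)"
  unfolding tree_cone_def Ball_def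
  by (intro closed_Collect_conj closed_Collect_all closed_Collect_imp open_Collect_const
      closed_Collect_eq closed_Collect_le continuous_intros)

lemma borel_tree_cone [measurable]: "tree_cone N \<in> sets borel"
  by (simp add: borel_closed closed_tree_cone)

lemma nn_integral_exp_ray:
  assumes "0 < (u::real)"
  shows "(\<integral>\<^sup>+s. ennreal (indicator {0..} s * exp (- (s * u))) \<partial>lborel) = ennreal (inverse u)"
proof -
  have "(\<integral>\<^sup>+s. ennreal (exp (- (s * u))) * indicator {0..} s \<partial>lborel) = ennreal (0 - (- inverse u * exp (- (0 * u))))"
  proof (rule nn_integral_FTC_atLeast)
    show "((\<lambda>s. - inverse u * exp (- (s * u))) has_real_derivative exp (- (x * u))) (at x)" for x
      using assms by (auto intro!: derivative_eq_intros)
    have "((\<lambda>s. exp (- (s * u))) \<longlongrightarrow> 0) at_top"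
      using filterlim_at_top_mult_tendsto_pos[OF tendsto_const assms filterlim_ident]
      by (intro filterlim_compose[OF exp_at_bot]) (simp add: filterlim_uminus_at_top)
    then show "((\<lambda>s. - inverse u * exp (- (s * u))) \<longlongrightarrow> 0) at_top"
      using tendsto_mult_left[of _ 0 at_top "- inverse u"] by simp
  qed auto
  then show ?thesis by (simp add: ennreal_mult' ennreal_indicator mult.commute)
qed

lemma nn_integral_exp_segment:
  assumes "(v::real) \<noteq> 0" "0 \<le> q"
  shows "(\<integral>\<^sup>+t. ennreal (indicator {0..q} t * exp (- (t * v))) \<partial>lborel) =
    ennreal ((1 - exp (- (q * v))) * inverse v)"
proof -
  have "(\<integral>\<^sup>+t. ennreal (exp (- (t * v))) * indicator {0..q} t \<partial>lborel) =
      ennreal (- inverse v * exp (- (q * v)) - (- inverse v * exp (- (0 * v))))"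
    by (rule nn_integral_FTC_Icc) (use assms in \<open>auto intro!: derivative_eq_intros\<close>)
  then show ?thesis by (simp add: ennreal_mult' ennreal_indicator mult.commute algebra_simps)
qed

lemma exp_segment_nonneg:
  assumes "(v::real) \<noteq> 0" "0 \<le> q"
  shows "0 \<le> (1 - exp (- (q * v))) * inverse v"
proof (cases "v > 0")
  case True
  then show ?thesis using assms by auto
next
  case False
  then have "v < 0" using assms by simp
  then have "q * v \<le> 0" using assms by (simp add: mult_nonneg_nonpos)
  then show ?thesis using \<open>v < 0\<close> by (intro mult_nonpos_nonpos) auto
qed

text \<open>
  The segment contributes \<open>(1 - exp (- q v)) / v\<close> and the ray contributes \<open>1 / u\<close>.
\<close>

lemma nn_integral_tree_cone_fibre:
  assumes N: "forest N" "top \<in> N" and c0: "c0 \<in> N" "c0 \<noteq> top" and min: "\<And>d. d \<in> N \<Longrightarrow> \<not> d < c0"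
    and uv: "0 < p_coord c0 y" "m_coord c0 y \<noteq> 0"
  shows "(\<integral>\<^sup>+x. ennreal (indicator (tree_cone N) x * exp (- (x \<bullet> y))) \<partial>basis_measure (tree_basis N)) =
    (\<integral>\<^sup>+x. ennreal (indicator (tree_cone (N - {c0})) x * exp (- (x \<bullet> y)) *
        (inverse (p_coord c0 y) * ((1 - exp (- (x \<bullet> ancestor_form c0 * m_coord c0 y))) * inverse (m_coord c0 y))))
      \<partial>basis_measure (tree_basis (N - {c0})))"
proof -
  let ?u = "p_coord c0 y" and ?v = "m_coord c0 y" and ?M = "N - {c0}"
  let ?f = "\<lambda>x. ennreal (indicator (tree_cone N) x * exp (- (x \<bullet> y)))"
  have fM: "forest ?M" "top \<in> ?M" using N c0 forest_subset[OF N(1), of ?M] by auto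
  have c0bot: "c0 \<noteq> bot" using N c0 by (auto simp: forest_def)
  have B: "tree_basis N = insert (plus_vec c0) (insert (minus_vec c0) (tree_basis ?M))"
    using c0 by (auto simp: tree_basis_def)
  have new: "plus_vec c0 \<notin> insert (minus_vec c0) (tree_basis ?M)" "minus_vec c0 \<notin> tree_basis ?M"
    using plus_vec_neq_minus_vec plus_vec_neq_minus_vec[symmetric] by (auto simp: tree_basis_def)
  have [measurable]: "?f \<in> borel_measurable borel" by measurable
  have "(\<integral>\<^sup>+x. ?f x \<partial>basis_measure (tree_basis N)) =
      (\<integral>\<^sup>+x. (\<integral>\<^sup>+t. (\<integral>\<^sup>+s. ?f (x + t *\<^sub>R minus_vec c0 + s *\<^sub>R plus_vec c0) \<partial>lborel) \<partial>lborel)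
        \<partial>basis_measure (tree_basis ?M))"
    unfolding B
    by (subst nn_integral_basis_measure_insert[OF _ new(1)], simp add: finite_tree_basis, simp)
      (rule nn_integral_basis_measure_insert[OF finite_tree_basis new(2)], measurable)
  also have "\<dots> = (\<integral>\<^sup>+x. ennreal (indicator (tree_cone ?M) x * exp (- (x \<bullet> y)) *
        (inverse ?u * ((1 - exp (- (x \<bullet> ancestor_form c0 * ?v))) * inverse ?v)))
      \<partial>basis_measure (tree_basis ?M))"
  proof (rule nn_integral_cong_AE, use AE_basis_measure_span[of "tree_basis ?M"] in \<open>elim eventually_mono\<close>)
    fix x assume x: "x \<in> span (tree_basis ?M)"
    define q where "q = x \<bullet> ancestor_form c0"
    define K where "K = (indicator (tree_cone ?M) x * exp (- (x \<bullet> y)) :: real)"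
    have K: "0 \<le> K" by (simp add: K_def)
    have "?f (x + t *\<^sub>R minus_vec c0 + s *\<^sub>R plus_vec c0) =
        ennreal K * (ennreal (indicator {0..q} t * exp (- (t * ?v))) *
          ennreal (indicator {0..} s * exp (- (s * ?u))))" for t s
    proof -
      have "indicator (tree_cone N) (x + t *\<^sub>R minus_vec c0 + s *\<^sub>R plus_vec c0) =
          (indicator (tree_cone ?M) x * indicator {0..q} t * indicator {0..} s :: real)"
        using tree_cone_fibre[OF c0 min x, of t s] by (auto simp: indicator_def q_def)
      moreover have "exp (- ((x + t *\<^sub>R minus_vec c0 + s *\<^sub>R plus_vec c0) \<bullet> y)) =
          exp (- (x \<bullet> y)) * exp (- (t * ?v)) * exp (- (s * ?u))"
        by (simp add: inner_add_left flip: exp_add)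
      ultimately show ?thesis
        using K by (simp add: K_def mult_ac flip: ennreal_mult')
    qed
    then have "(\<integral>\<^sup>+t. (\<integral>\<^sup>+s. ?f (x + t *\<^sub>R minus_vec c0 + s *\<^sub>R plus_vec c0) \<partial>lborel) \<partial>lborel) =
        ennreal K * ((\<integral>\<^sup>+t. ennreal (indicator {0..q} t * exp (- (t * ?v))) \<partial>lborel) *
          (\<integral>\<^sup>+s. ennreal (indicator {0..} s * exp (- (s * ?u))) \<partial>lborel))"
      by (simp add: nn_integral_cmult nn_integral_multc)
    also have "\<dots> = ennreal (K * (inverse ?u * ((1 - exp (- (q * ?v))) * inverse ?v)))"
    proof (cases "x \<in> tree_cone ?M")
      case True
      have q: "0 \<le> q" unfolding q_def by (rule ancestor_form_nonneg[OF fM True c0bot c0(2)])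
      show ?thesis
        unfolding nn_integral_exp_ray[OF uv(1)] nn_integral_exp_segment[OF uv(2) q]
        using K uv exp_segment_nonneg[OF uv(2) q] by (simp add: ennreal_mult' mult.commute)
    next
      case False
      then show ?thesis by (simp add: K_def)
    qed
    finally show "(\<integral>\<^sup>+t. (\<integral>\<^sup>+s. ?f (x + t *\<^sub>R minus_vec c0 + s *\<^sub>R plus_vec c0) \<partial>lborel) \<partial>lborel) =
        ennreal (indicator (tree_cone ?M) x * exp (- (x \<bullet> y)) *
        (inverse ?u * ((1 - exp (- (x \<bullet> ancestor_form c0 * ?v))) * inverse ?v)))"
      by (simp add: K_def q_def)
  qed
  finally show ?thesis .
qed


lemma tree_cone_attach_leaf:
  assumes c0: "c0 \<in> N" "c0 \<noteq> top" and min: "\<And>d. d \<in> N \<Longrightarrow> \<not> d < c0"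
    and x: "x \<in> tree_cone (N - {c0})" and t: "0 \<le> t" "t \<le> x \<bullet> ancestor_form c0" and s: "0 \<le> s"
  shows "x + t *\<^sub>R minus_vec c0 + s *\<^sub>R plus_vec c0 \<in> tree_cone N"
proof -
  have "x \<in> span (tree_basis (N - {c0}))"
    using x by (intro in_span_tree_basis) (simp_all add: tree_cone_def)
  then show ?thesis using tree_cone_fibre[OF c0 min] x t s by blast
qed

lemma tree_poles_mono:
  assumes "M \<subseteq> N"
  shows "tree_poles M \<subseteq> tree_poles N"
proof
  fix l assume "l \<in> tree_poles M"
  then consider S c where "l = plus_pole S c" "S \<subseteq> M - {top}" "c \<in> M"
    | S c where "l = minus_pole S c" "S \<subseteq> M - {top}" "c \<in> M - {top}"
    unfolding tree_poles_def by blast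
  then show "l \<in> tree_poles N"
    using assms by cases (auto intro!: tree_polesI)
qed

text \<open>
  Induction by removing a minimal element \<open>c\<^sub>0\<close>. The exponential \<open>exp (- q v)\<close> coming from the upper end
  of the fibre turns the integrand at \<open>y\<close> into the one at \<open>y' = y + v \<cdot> ancestor_form c\<^sub>0\<close>, so the
  induction hypothesis is used at both points. The point \<open>y'\<close> is again positive on the smaller cone,
  since pairing with it amounts to pairing \<open>y\<close> with the upper end of the fibre, which lies in the
  larger cone.
\<close>

theorem has_integral_tree_cone:
  assumes "forest N" "top \<in> N"
    and "\<And>x. x \<in> tree_cone N \<Longrightarrow> x \<noteq> 0 \<Longrightarrow> 0 < x \<bullet> y"
    and "\<And>l. l \<in> tree_poles N \<Longrightarrow> l \<bullet> y \<noteq> 0"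
  shows "has_bochner_integral (basis_measure (tree_basis N))
    (\<lambda>x. indicator (tree_cone N) x * exp (- (x \<bullet> y)))
    (tree_wave N (\<lambda>h. p_coord h y) (\<lambda>h. m_coord h y))"
  using assms
proof (induction "card N" arbitrary: N y rule: less_induct)
  case less
  note N = less.prems(1,2) and pos = less.prems(3) and gen = less.prems(4)
  show ?case
  proof (cases "N = {top}")
    case True
    have "plus_vec top \<in> tree_cone N" by (auto simp: tree_cone_def True)
    moreover have "plus_vec top \<noteq> (0 :: 'a energy_space)"
      using coord_plus_vec(1)[of top top] by (metis fst_zero zero_index zero_neq_one)
    ultimately have u: "0 < p_coord top y" using pos[of "plus_vec top"] by simp
    have cone: "s *\<^sub>R plus_vec top \<in> tree_cone N \<longleftrightarrow> 0 \<le> s" for s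
      by (auto simp: tree_cone_def True)
    have "(\<integral>\<^sup>+x. ennreal (indicator (tree_cone N) x * exp (- (x \<bullet> y))) \<partial>basis_measure (insert (plus_vec top) {})) =
        (\<integral>\<^sup>+s. ennreal (indicator {0..} s * exp (- (s * p_coord top y))) \<partial>lborel)"
      by (subst nn_integral_basis_measure_insert, simp, simp, measurable)
        (subst nn_integral_basis_measure_empty, measurable, simp add: indicator_def cone)
    moreover have "tree_wave N (\<lambda>h. p_coord h y) (\<lambda>h. m_coord h y) = inverse (p_coord top y)"
      by (simp add: tree_wave_def tree_term_def True excess_def max_below_def)
    moreover have "tree_basis N = {plus_vec top}" by (auto simp: tree_basis_def True)
    ultimately show ?thesis
      using u by (intro has_bochner_integral_nn_integral) (auto simp: nn_integral_exp_ray)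
  next
    case False
    then obtain c0 where c0': "c0 \<in> N - {top}" "\<And>d. d \<in> N - {top} \<Longrightarrow> d \<le> c0 \<Longrightarrow> d = c0"
      using finite_has_minimal[of "N - {top}"] N by auto
    have c0: "c0 \<in> N" "c0 \<noteq> top" using c0' by auto
    have min: "\<not> d < c0" if "d \<in> N" for d
      using c0'(2)[of d] that by (cases "d = top") (auto simp: less_le top_unique)
    let ?M = "N - {c0}" and ?u = "p_coord c0 y" and ?v = "m_coord c0 y"
    define y' where "y' = y + ?v *\<^sub>R ancestor_form c0"
    have M: "forest ?M" "top \<in> ?M" "card ?M < card N"
      using N c0 forest_subset[OF N(1), of ?M] card_Diff1_less[of N c0] by auto
    have c0bot: "c0 \<noteq> bot" using N c0 by (auto simp: forest_def)
    note q = ancestor_form_nonneg[OF M(1,2) _ c0bot c0(2)]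
    note lift = tree_cone_attach_leaf[OF c0 min]
    have u: "0 < ?u"
    proof -
      have "plus_vec c0 \<in> tree_cone N"
        using lift[of 0 0 1] by (simp add: tree_cone_def inner_ancestor_form)
      moreover have "plus_vec c0 \<noteq> (0 :: 'a energy_space)"
        using coord_plus_vec(1)[of c0 c0] by (metis fst_zero zero_index zero_neq_one)
      ultimately show ?thesis using pos[of "plus_vec c0"] by simp
    qed
    have v: "?v \<noteq> 0"
      using gen[of "minus_pole {} c0"] tree_polesI(2)[of "{}" N c0] c0
      by (simp add: inner_poles excess_def max_below_def)
    have y': "p_coord h y' = p_coord h y + absorb c0 (\<lambda>h. m_coord h y) h"
      "m_coord h y' = m_coord h y - absorb c0 (\<lambda>h. m_coord h y) h" for h
      by (simp_all add: y'_def absorb_def)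
    have xy': "x \<bullet> y' = x \<bullet> y + (x \<bullet> ancestor_form c0) * ?v" for x
      by (simp add: y'_def inner_add_right mult.commute)
    have 1: "has_bochner_integral (basis_measure (tree_basis ?M))
      (\<lambda>x. indicator (tree_cone ?M) x * exp (- (x \<bullet> y))) (tree_wave ?M (\<lambda>h. p_coord h y) (\<lambda>h. m_coord h y))"
    proof (rule less.hyps[OF M(3,1,2)])
      show "0 < x \<bullet> y" if "x \<in> tree_cone ?M" "x \<noteq> 0" for x
        using pos[of x] lift[of x 0 0] q that by simp
      show "l \<bullet> y \<noteq> 0" if "l \<in> tree_poles ?M" for l
        using that gen tree_poles_mono[of ?M N] by blast
    qed
    have 2: "has_bochner_integral (basis_measure (tree_basis ?M))
      (\<lambda>x. indicator (tree_cone ?M) x * exp (- (x \<bullet> y'))) (tree_wave ?M (\<lambda>h. p_coord h y') (\<lambda>h. m_coord h y'))"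
    proof (rule less.hyps[OF M(3,1,2)])
      show "0 < x \<bullet> y'" if x: "x \<in> tree_cone ?M" "x \<noteq> 0" for x
      proof -
        let ?z = "x + (x \<bullet> ancestor_form c0) *\<^sub>R minus_vec c0"
        have "?z \<in> tree_cone N" using lift[of x "x \<bullet> ancestor_form c0" 0] q[OF x(1)] x by simp
        moreover have "?z \<noteq> 0"
        proof
          assume z: "?z = 0"
          have "m_coord c0 x = 0" using x by (auto simp: tree_cone_def)
          then have "x \<bullet> ancestor_form c0 = m_coord c0 ?z" by simp
          also have "\<dots> = 0" unfolding z by simp
          finally show False using z x by simp
        qed
        ultimately show ?thesis using pos[of ?z] by (simp add: xy' inner_add_left)
      qed
      show "l \<bullet> y' \<noteq> 0" if "l \<in> tree_poles ?M" for l
      proof -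
        consider S c where "l = plus_pole S c" "S \<subseteq> ?M - {top}" "c \<in> ?M"
          | S c where "l = minus_pole S c" "S \<subseteq> ?M - {top}" "c \<in> ?M - {top}"
          using \<open>l \<in> tree_poles ?M\<close> unfolding tree_poles_def by blast
        then show ?thesis
        proof cases
          case (1 S c)
          have "l \<bullet> y' = plus_pole (insert c0 S) c \<bullet> y"
            unfolding 1(1) inner_poles y'
            using excess_insert_minimal[OF N(1) c0(1) min, of S c "\<lambda>h. m_coord h y"] 1 by (simp add: subset_Diff_insert)
          moreover have "plus_pole (insert c0 S) c \<in> tree_poles N"
            by (rule tree_polesI) (use 1 c0 in auto)
          ultimately show ?thesis using gen by simp
        next
          case (2 S c)
          have "l \<bullet> y' = minus_pole (insert c0 S) c \<bullet> y"
            unfolding 2(1) inner_poles y'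
            using excess_insert_minimal[OF N(1) c0(1) min, of S c "\<lambda>h. m_coord h y"] 2 by (simp add: subset_Diff_insert)
          moreover have "minus_pole (insert c0 S) c \<in> tree_poles N"
            by (rule tree_polesI) (use 2 c0 in auto)
          ultimately show ?thesis using gen by simp
        qed
      qed
    qed
    define g where "g x = indicator (tree_cone ?M) x * exp (- (x \<bullet> y)) *
        (inverse ?u * ((1 - exp (- (x \<bullet> ancestor_form c0 * ?v))) * inverse ?v))" for x
    have "has_bochner_integral (basis_measure (tree_basis ?M))
       (\<lambda>x. inverse ?u * inverse ?v * (indicator (tree_cone ?M) x * exp (- (x \<bullet> y)) -
          indicator (tree_cone ?M) x * exp (- (x \<bullet> y'))))
       (inverse ?u * inverse ?v * (tree_wave ?M (\<lambda>h. p_coord h y) (\<lambda>h. m_coord h y) -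
          tree_wave ?M (\<lambda>h. p_coord h y') (\<lambda>h. m_coord h y')))"
      by (intro has_bochner_integral_mult_right has_bochner_integral_diff 1 2)
    moreover have "(\<lambda>x. inverse ?u * inverse ?v * (indicator (tree_cone ?M) x * exp (- (x \<bullet> y)) -
          indicator (tree_cone ?M) x * exp (- (x \<bullet> y')))) = g"
      by (rule ext) (simp add: g_def xy' algebra_simps exp_add exp_diff exp_minus divide_inverse)
    moreover have "inverse ?u * inverse ?v * (tree_wave ?M (\<lambda>h. p_coord h y) (\<lambda>h. m_coord h y) -
          tree_wave ?M (\<lambda>h. p_coord h y') (\<lambda>h. m_coord h y')) =
        tree_wave N (\<lambda>h. p_coord h y) (\<lambda>h. m_coord h y)"
      unfolding y' by (rule tree_wave_remove_leaf[OF N(1) c0 min, symmetric])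
    ultimately have g: "has_bochner_integral (basis_measure (tree_basis ?M)) g
        (tree_wave N (\<lambda>h. p_coord h y) (\<lambda>h. m_coord h y))" by simp
    have g_nonneg: "0 \<le> g x" for x
      using exp_segment_nonneg[OF v q, of x] u by (cases "x \<in> tree_cone ?M") (simp_all add: g_def)
    have "0 \<le> tree_wave N (\<lambda>h. p_coord h y) (\<lambda>h. m_coord h y)"
      using Bochner_Integration.integral_nonneg[of "basis_measure (tree_basis ?M)" g]
        has_bochner_integral_integral_eq[OF g] g_nonneg by simp
    moreover have "(\<integral>\<^sup>+x. ennreal (indicator (tree_cone N) x * exp (- (x \<bullet> y))) \<partial>basis_measure (tree_basis N)) =
        ennreal (tree_wave N (\<lambda>h. p_coord h y) (\<lambda>h. m_coord h y))"
      using nn_integral_tree_cone_fibre[OF N c0 min u v]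
        nn_integral_eq_integral[of "basis_measure (tree_basis ?M)" g] g g_nonneg
      by (simp add: g_def[symmetric] has_bochner_integral_iff)
    ultimately show ?thesis by (intro has_bochner_integral_nn_integral) auto
  qed
qed

text \<open>
  Coordinates with respect to standard basis vectors are inner products, so integral points of a
  coordinate subspace are integral combinations.
\<close>

lemma lattice_basis_Basis_subset:
  fixes B :: "'v::euclidean_space set"
  assumes B: "B \<subseteq> Basis"
  shows "lattice_basis (span B) B"
proof -
  have fin: "finite B" using B finite_Basis finite_subset by blast
  have repr: "x = (\<Sum>b\<in>B. (x \<bullet> b) *\<^sub>R b)" if "x \<in> span B" for x
  proof -
    have "x \<bullet> b = 0" if "b \<in> Basis - B" for b
      using \<open>x \<in> span B\<close>
    proof (induction rule: span_induct_alt)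
      case (step c z y)
      then have "z \<bullet> b = 0" using that B by (auto simp: inner_Basis)
      then show ?case using step by (simp add: inner_add_left)
    qed simp
    then have "(\<Sum>b\<in>Basis. (x \<bullet> b) *\<^sub>R b) = (\<Sum>b\<in>B. (x \<bullet> b) *\<^sub>R b)"
      using B by (intro sum.mono_neutral_right) auto
    then show ?thesis by (simp add: euclidean_representation)
  qed
  have "{x \<in> span B. \<forall>b\<in>Basis. x \<bullet> b \<in> \<int>} = {\<Sum>b\<in>B. of_int (c b) *\<^sub>R b | c. True}" (is "?L = ?R")
  proof
    show "?L \<subseteq> ?R"
    proof
      fix x assume x: "x \<in> ?L"
      have "x = (\<Sum>b\<in>B. (x \<bullet> b) *\<^sub>R b)" using repr x by blast
      also have "\<dots> = (\<Sum>b\<in>B. of_int \<lfloor>x \<bullet> b\<rfloor> *\<^sub>R b)"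
        using x B by (intro sum.cong refl) (metis (no_types, lifting) mem_Collect_eq of_int_floor subsetD)
      finally show "x \<in> ?R" by (intro CollectI exI[of _ "\<lambda>b. \<lfloor>x \<bullet> b\<rfloor>"]) simp
    qed
    show "?R \<subseteq> ?L"
    proof
      fix x assume "x \<in> ?R"
      then obtain c where x: "x = (\<Sum>b\<in>B. of_int (c b) *\<^sub>R b)" by blast
      have "x \<in> span B" unfolding x by (intro span_sum span_scale span_base)
      moreover have "x \<bullet> b \<in> \<int>" if "b \<in> Basis" for b
      proof -
        have "x \<bullet> b = (\<Sum>b'\<in>B. of_int (c b') * (if b' = b then 1 else 0))"
          unfolding x inner_sum_left using that B
          by (intro sum.cong) (auto simp: inner_Basis)
        also have "\<dots> \<in> \<int>" by (intro Ints_sum Ints_mult) auto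
        finally show ?thesis .
      qed
      ultimately show "x \<in> ?L" by blast
    qed
  qed
  then show ?thesis
    unfolding lattice_basis_def using independent_mono[OF independent_Basis B] by blast
qed

lemma tree_basis_subset_Basis: "tree_basis N \<subseteq> Basis"
  by (auto simp: tree_basis_def plus_vec_def minus_vec_def Basis_prod_def Basis_vec_def)

lemma span_tree_cone:
  assumes "top \<in> N"
  shows "span (tree_cone N) = span (tree_basis N)"
proof -
  have plus: "plus_vec c \<in> tree_cone N" if "c \<in> N" for c
    using that by (auto simp: tree_cone_def)
  \<comment> \<open>The vector \<open>c\<^sup>-\<close> is not in the cone, but it is a difference of two of its elements.\<close>
  have "plus_vec top + minus_vec c \<in> tree_cone N" if "c \<in> N - {top}" for c
    using that assms by (auto simp: tree_cone_def inner_add_left top.not_eq_extremum)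
  then have "(plus_vec top + minus_vec c) - plus_vec top \<in> span (tree_cone N)" if "c \<in> N - {top}" for c
    using that plus[OF assms] by (intro span_diff span_base) auto
  then have "tree_basis N \<subseteq> span (tree_cone N)"
    using plus unfolding tree_basis_def by (simp add: image_subset_iff span_base)
  moreover have "tree_cone N \<subseteq> span (tree_basis N)"
    using in_span_tree_basis by (auto simp: tree_cone_def)
  ultimately show ?thesis by (simp add: span_eq)
qed

lemma lattice_measure_tree_cone:
  "top \<in> N \<Longrightarrow> lattice_measure (span (tree_cone N)) = basis_measure (tree_basis N)"
  using lattice_measure_eq[OF lattice_basis_Basis_subset[OF tree_basis_subset_Basis]]
  by (simp add: span_tree_cone)

text \<open>
  Otherwise moving \<open>y\<close> slightly in direction \<open>- x\<close> would leave the dual cone.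
\<close>

lemma interior_dual_cone_pos:
  assumes "y \<in> interior (dual_cone C)" "x \<in> C" "x \<noteq> 0"
  shows "0 < x \<bullet> (y :: 'v::euclidean_space)"
proof -
  obtain e where e: "0 < e" "cball y e \<subseteq> dual_cone C"
    using assms(1) by (auto simp: mem_interior_cball)
  let ?z = "y - (e / norm x) *\<^sub>R x"
  have "?z \<in> cball y e" using e assms by (simp add: dist_norm)
  then have "?z \<in> dual_cone C" using e(2) by (rule rev_subsetD)
  then have "0 \<le> x \<bullet> ?z" using assms(2) by (simp add: dual_cone_def)
  then have "(e / norm x) * (x \<bullet> x) \<le> x \<bullet> y" by (simp add: inner_diff_right)
  moreover have "0 < (e / norm x) * (x \<bullet> x)" using e assms by simp
  ultimately show ?thesis by linarith
qed

lemma half_in_interior_dual_cone: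
  assumes "y \<in> interior (dual_cone C)"
  shows "(1 / 2) *\<^sub>R y \<in> interior (dual_cone (C :: 'v::euclidean_space set))"
proof (rule interiorI)
  show "open ((\<lambda>z. 2 *\<^sub>R z) -` interior (dual_cone C))"
    by (intro open_vimage continuous_intros) simp
  show "(1 / 2) *\<^sub>R y \<in> (\<lambda>z. 2 *\<^sub>R z) -` interior (dual_cone C)" using assms by simp
  show "(\<lambda>z. 2 *\<^sub>R z) -` interior (dual_cone C) \<subseteq> dual_cone C"
    using interior_subset[of "dual_cone C"] by (force simp: dual_cone_def)
qed

lemma tree_cone_nonneg: "x \<in> tree_cone N \<Longrightarrow> 0 \<le> p_coord h x \<and> 0 \<le> m_coord h x"
  by (cases "h \<in> N") (auto simp: tree_cone_def)

lemma interior_dual_tree_cone_nonempty: "interior (dual_cone (tree_cone N)) \<noteq> {}"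
proof -
  \<comment> \<open>The cone lies in the nonnegative orthant, so the open positive orthant is in its dual.\<close>
  let ?W = "(\<Inter>h. {y. 0 < p_coord h y} \<inter> {y. 0 < m_coord h y}) :: 'a energy_space set"
  have "open ?W"
    by (intro open_INT open_Int open_Collect_less continuous_intros finite_class.finite_UNIV ballI)
  moreover have "?W \<subseteq> dual_cone (tree_cone N)"
  proof
    fix y assume "y \<in> ?W"
    then have "0 \<le> x \<bullet> y" if "x \<in> tree_cone N" for x
      unfolding inner_prod_def inner_vec_def
      using tree_cone_nonneg[OF that] by (intro add_nonneg_nonneg sum_nonneg) (auto simp: less_imp_le)
    then show "y \<in> dual_cone (tree_cone N)" by (simp add: dual_cone_def)
  qed
  moreover have "(1, 1) \<in> ?W" by simp
  ultimately have "(1, 1) \<in> interior (dual_cone (tree_cone N))" by (intro interiorI)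
  then show ?thesis by blast
qed

lemma finite_tree_poles: "finite (tree_poles N)"
proof -
  have "tree_poles N \<subseteq> case_prod plus_pole ` UNIV \<union> case_prod minus_pole ` UNIV"
    unfolding tree_poles_def by force
  then show ?thesis by (rule finite_subset) simp
qed

lemma peval_prod: "peval (prod p X) y = (\<Prod>x\<in>X. peval (p x) y)"
  by (induction X rule: infinite_finite_induct) simp_all

text \<open>
  Points \<open>z\<close> with \<open>y - z\<close> in the dual cone provide integrable majorants near \<open>y\<close>. The point \<open>y / 2\<close> is one
  of them, and a generic one is close to it.
\<close>

lemma generic_dominating_point:
  assumes "y \<in> interior (dual_cone (tree_cone N))"
  shows "\<exists>z. z \<in> interior (dual_cone (tree_cone N)) \<and> y - z \<in> interior (dual_cone (tree_cone N)) \<and>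
    (\<forall>l\<in>tree_poles N. l \<bullet> z \<noteq> 0)"
proof (rule ccontr)
  assume neg: "\<not> ?thesis"
  let ?U = "interior (dual_cone (tree_cone N))"
  define W where "W = ?U \<inter> (\<lambda>z. y - z) -` ?U"
  define q where "q = (\<Prod>l\<in>tree_poles N. linear_form l)"
  have "open W" unfolding W_def by (intro open_Int open_vimage continuous_intros) simp_all
  moreover have "y - (1 / 2) *\<^sub>R y = (1 / 2) *\<^sub>R y" by (simp add: algebra_simps flip: scaleR_add_left)
  then have "(1 / 2) *\<^sub>R y \<in> W" using half_in_interior_dual_cone[OF assms] by (simp add: W_def)
  moreover have "peval q z = 0" if "z \<in> W" for z
  proof -
    have "z \<in> ?U" "y - z \<in> ?U" using that by (simp_all add: W_def)
    then have "\<exists>l\<in>tree_poles N. l \<bullet> z = 0" using neg by blast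
    then show ?thesis using finite_tree_poles[of N] by (simp add: q_def peval_prod)
  qed
  ultimately have "q = 0" by (rule polyfun_zero_on_open)
  then show False using zero_notin_tree_poles[of N] finite_tree_poles[of N] by (auto simp: q_def)
qed

definition tree_integral :: "'a::{finite, bounded_lattice} set \<Rightarrow> 'a energy_space \<Rightarrow> real" where
  "tree_integral N y = (LINT x|basis_measure (tree_basis N). indicator (tree_cone N) x * exp (- (x \<bullet> y)))"

lemma tree_integral_generic:
  assumes "forest N" "top \<in> N" "y \<in> interior (dual_cone (tree_cone N))" "\<forall>l\<in>tree_poles N. l \<bullet> y \<noteq> 0"
  shows "integrable (basis_measure (tree_basis N)) (\<lambda>x. indicator (tree_cone N) x * exp (- (x \<bullet> y)))"
    and "tree_integral N y = tree_wave N (\<lambda>h. p_coord h y) (\<lambda>h. m_coord h y)"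
proof -
  have "has_bochner_integral (basis_measure (tree_basis N))
    (\<lambda>x. indicator (tree_cone N) x * exp (- (x \<bullet> y)))
    (tree_wave N (\<lambda>h. p_coord h y) (\<lambda>h. m_coord h y))"
    by (rule has_integral_tree_cone) (use assms interior_dual_cone_pos in auto)
  then show "integrable (basis_measure (tree_basis N)) (\<lambda>x. indicator (tree_cone N) x * exp (- (x \<bullet> y)))"
    and "tree_integral N y = tree_wave N (\<lambda>h. p_coord h y) (\<lambda>h. m_coord h y)"
    by (simp_all add: has_bochner_integral_iff tree_integral_def)
qed

lemma indicator_exp_mono:
  assumes "w - z \<in> dual_cone C"
  shows "norm (indicator C x * exp (- (x \<bullet> w)) :: real) \<le> indicator C x * exp (- (x \<bullet> z))"
proof (cases "x \<in> C")
  case True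
  then have "0 \<le> x \<bullet> (w - z)" using assms by (simp add: dual_cone_def)
  then show ?thesis using True by (simp add: inner_diff_right)
qed simp

lemma integrable_tree_cone:
  assumes N: "forest N" "top \<in> N" and y: "y \<in> interior (dual_cone (tree_cone N))"
  shows "integrable (basis_measure (tree_basis N)) (\<lambda>x. indicator (tree_cone N) x * exp (- (x \<bullet> y)))"
proof -
  obtain z where z: "z \<in> interior (dual_cone (tree_cone N))" "y - z \<in> interior (dual_cone (tree_cone N))"
    "\<forall>l\<in>tree_poles N. l \<bullet> z \<noteq> 0"
    using generic_dominating_point[OF y] by blast
  have "y - z \<in> dual_cone (tree_cone N)" using z(2) interior_subset by blast
  note bound = indicator_exp_mono[OF this]
  show ?thesis
  proof (rule Bochner_Integration.integrable_bound[OF tree_integral_generic(1)[OF N z(1,3)]])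
    show "AE x in basis_measure (tree_basis N). norm (indicator (tree_cone N) x * exp (- (x \<bullet> y)))
        \<le> norm (indicator (tree_cone N) x * exp (- (x \<bullet> z)))"
      using bound by (intro AE_I2) (metis abs_ge_self order_trans real_norm_def)
  qed measurable
qed

text \<open>
  Dominated convergence, with the integrand at a generic dominating point as majorant.
\<close>

lemma continuous_on_tree_integral:
  assumes N: "forest N" "top \<in> N"
  shows "continuous_on (interior (dual_cone (tree_cone N))) (tree_integral N)"
proof -
  let ?U = "interior (dual_cone (tree_cone N))"
  have "isCont (tree_integral N) y" if y: "y \<in> ?U" for y
  proof -
    obtain z where z: "z \<in> ?U" "y - z \<in> ?U" "\<forall>l\<in>tree_poles N. l \<bullet> z \<noteq> 0"
      using generic_dominating_point[OF y] by blast
    define V where "V = (\<lambda>w. w - z) -` ?U"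
    have V: "open V" "y \<in> V"
      unfolding V_def using z by (auto intro!: open_vimage continuous_intros)
    have "continuous_on V (tree_integral N)"
      unfolding continuous_on_sequentially
    proof (intro allI ballI impI)
      fix s w assume s: "w \<in> V" "(\<forall>n. s n \<in> V) \<and> s \<longlonglongrightarrow> w"
      show "(tree_integral N \<circ> s) \<longlonglongrightarrow> tree_integral N w"
        unfolding tree_integral_def o_def
      proof (rule integral_dominated_convergence[OF _ _ tree_integral_generic(1)[OF N z(1,3)]])
        show "AE x in basis_measure (tree_basis N).
          (\<lambda>n. indicator (tree_cone N) x * exp (- (x \<bullet> s n))) \<longlonglongrightarrow> indicator (tree_cone N) x * exp (- (x \<bullet> w))"
          using s by (intro AE_I2 tendsto_intros) auto
        show "AE x in basis_measure (tree_basis N).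
          norm (indicator (tree_cone N) x * exp (- (x \<bullet> s n))) \<le> indicator (tree_cone N) x * exp (- (x \<bullet> z))" for n
        proof (intro AE_I2 indicator_exp_mono)
          show "s n - z \<in> dual_cone (tree_cone N)"
            using s interior_subset[of "dual_cone (tree_cone N)"] by (auto simp: V_def)
        qed
      qed auto
    qed
    then show ?thesis using V continuous_on_eq_continuous_at by blast
  qed
  then show ?thesis by (simp add: continuous_at_imp_continuous_on)
qed

text \<open>
  Off the poles the integral is given by the closed formula. By continuity the numerator of the formula
  equals the integral times its denominator everywhere on the interior of the dual cone, so the spurious
  poles cancel. Uniqueness holds because polynomials agreeing on a nonempty open set are equal.
\<close>

theorem cone_laplace_tree_cone:
  fixes N :: "'a::{finite, bounded_lattice} set"
  assumes N: "forest N" "top \<in> N"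
  shows "cone_laplace (tree_cone N) = tree_ratfun N"
proof -
  let ?U = "interior (dual_cone (tree_cone N))"
  obtain P ls where P: "set ls \<subseteq> tree_poles N" "tree_ratfun N = Fract P (\<Prod>l\<leftarrow>ls. linear_form l)"
    "\<And>y. \<forall>l\<in>tree_poles N. l \<bullet> y \<noteq> 0 \<Longrightarrow>
      peval P y = tree_wave N (\<lambda>h. p_coord h y) (\<lambda>h. m_coord h y) * (\<Prod>l\<leftarrow>ls. l \<bullet> y)"
    using evaluates_off_tree_ratfun[of N] unfolding evaluates_off_def by blast
  have ls: "0 \<notin> set ls" using P(1) zero_notin_tree_poles by blast
  have "peval P y = tree_integral N y * (\<Prod>l\<leftarrow>ls. l \<bullet> y)" if y: "y \<in> ?U" for y
  proof (rule polyfun_eq_on_open[where q = "\<Prod>l\<in>tree_poles N. linear_form l" and U = ?U and F = "peval P"])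
    have "continuous_on ?U (\<lambda>y. peval (\<Prod>l\<leftarrow>ls. linear_form l) y)" by (rule continuous_on_peval)
    then show "continuous_on ?U (\<lambda>y. tree_integral N y * (\<Prod>l\<leftarrow>ls. l \<bullet> y))"
      using continuous_on_tree_integral[OF N] by (intro continuous_intros) (simp_all add: peval_prod_list o_def)
    show "(\<Prod>l\<in>tree_poles N. linear_form l) \<noteq> 0"
      using zero_notin_tree_poles[of N] finite_tree_poles[of N] by auto
    show "peval P z = tree_integral N z * (\<Prod>l\<leftarrow>ls. l \<bullet> z)"
      if "z \<in> ?U" "peval (\<Prod>l\<in>tree_poles N. linear_form l) z \<noteq> 0" for z
    proof -
      have "\<forall>l\<in>tree_poles N. l \<bullet> z \<noteq> 0"
        using that(2) finite_tree_poles[of N] by (auto simp: peval_prod)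
      then show ?thesis using P(3) tree_integral_generic(2)[OF N that(1)] by simp
    qed
  qed (simp_all add: y continuous_on_peval)
  from Fract_cancel_spurious_poles[OF open_interior continuous_on_tree_integral[OF N] ls this]
  obtain P' Q' where PQ: "tree_ratfun N = Fract P' Q'" "Q' \<noteq> 0"
    "\<And>y. y \<in> ?U \<Longrightarrow> peval Q' y \<noteq> 0 \<and> peval P' y / peval Q' y = tree_integral N y"
    using interior_dual_tree_cone_nonempty[of N] unfolding P(2) by blast
  note m = lattice_measure_tree_cone[OF N(2)]
  show ?thesis
    unfolding cone_laplace_def m set_integrable_def set_lebesgue_integral_def real_scaleR_def
      tree_integral_def[symmetric]
  proof (rule the_equality)
    show "\<exists>P Q. tree_ratfun N = Fract P Q \<and>
      (\<forall>y\<in>?U. integrable (basis_measure (tree_basis N)) (\<lambda>x. indicator (tree_cone N) x * exp (- (x \<bullet> y))) \<and>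
         peval Q y \<noteq> 0 \<and> peval P y / peval Q y = tree_integral N y)"
      using PQ integrable_tree_cone[OF N] by blast
  next
    fix r assume "\<exists>P Q. r = Fract P Q \<and>
      (\<forall>y\<in>?U. integrable (basis_measure (tree_basis N)) (\<lambda>x. indicator (tree_cone N) x * exp (- (x \<bullet> y))) \<and>
         peval Q y \<noteq> 0 \<and> peval P y / peval Q y = tree_integral N y)"
    then obtain P2 Q2 where r: "r = Fract P2 Q2"
      "\<And>y. y \<in> ?U \<Longrightarrow> peval Q2 y \<noteq> 0 \<and> peval P2 y / peval Q2 y = tree_integral N y" by blast
    obtain y0 where y0: "y0 \<in> ?U" using interior_dual_tree_cone_nonempty[of N] by blast
    then have "Q2 \<noteq> 0" using r(2)[OF y0] by auto
    moreover have "P2 * Q' - P' * Q2 = 0"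
    proof (rule polyfun_zero_on_open[OF open_interior y0])
      fix y assume y: "y \<in> ?U"
      have nz: "peval Q2 y \<noteq> 0" "peval Q' y \<noteq> 0" using r(2)[OF y] PQ(3)[OF y] by simp_all
      have "peval P2 y / peval Q2 y = peval P' y / peval Q' y" using r(2)[OF y] PQ(3)[OF y] by simp
      then have "peval P2 y * peval Q' y = peval P' y * peval Q2 y" by (simp only: frac_eq_eq[OF nz])
      then show "peval (P2 * Q' - P' * Q2) y = 0" by simp
    qed
    ultimately show "r = tree_ratfun N" using PQ by (simp add: r(1) eq_fract)
  qed
qed

section \<open>The wavefunction as a sum over maximal nested sets\<close>

lemma nested_cone_eq:
  "nested_cone N = {x. (\<forall>g. 0 \<le> p_coord g x \<and> 0 \<le> m_coord g x) \<and>
     (\<forall>g. g \<notin> N \<longrightarrow> p_coord g x = 0 \<and> m_coord g x = 0)}" (is "_ = ?R")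
proof
  have "convex_cone ?R"
    unfolding convex_cone_iff by (auto intro: add_nonneg_nonneg mult_nonneg_nonneg)
  moreover have "plus_vec ` N \<union> minus_vec ` N \<subseteq> ?R" by auto
  ultimately show "nested_cone N \<subseteq> ?R"
    unfolding nested_cone_def by (intro hull_minimal)
next
  show "?R \<subseteq> nested_cone N"
  proof
    fix x assume x: "x \<in> ?R"
    let ?K = "convex_cone hull (plus_vec ` N \<union> minus_vec ` N)"
    have sum: "(\<Sum>c\<in>X. a c) \<in> ?K" if "\<And>c. c \<in> X \<Longrightarrow> a c \<in> ?K" for X and a :: "'a \<Rightarrow> _"
      using that by (induction X rule: infinite_finite_induct)
        (auto simp: convex_cone_hull_contains_0 convex_cone_hull_add)
    let ?z = "(\<Sum>c\<in>N. p_coord c x *\<^sub>R plus_vec c) + (\<Sum>c\<in>N. m_coord c x *\<^sub>R minus_vec c)"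
    have "p_coord g x = p_coord g ?z" and "m_coord g x = m_coord g ?z" for g
      using x by (auto simp: if_distrib sum.If_cases cong: if_cong)
    then have "x = ?z" by (metis (no_types, lifting) prod_eqI vec_eq_iff)
    also have "\<dots> \<in> ?K"
      using x by (intro convex_cone_hull_add sum convex_cone_hull_mul hull_inc) auto
    finally show "x \<in> nested_cone N" by (simp add: nested_cone_def)
  qed
qed

lemma causal_form_eq:
  assumes x: "\<forall>h. h \<notin> K \<longrightarrow> p_coord h x = 0 \<and> m_coord h x = 0" "m_coord top x = 0" and g: "g \<noteq> top"
  shows "causal_form K g x = x \<bullet> ancestor_form g - m_coord g x"
proof -
  have "{g<..} = insert top {h. g < h \<and> h < top}"
    using g by (auto simp: top.not_eq_extremum)
  then have "x \<bullet> ancestor_form g = p_coord top x + (\<Sum>h\<in>{h. g < h \<and> h < top}. p_coord h x - m_coord h x)"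
    using x by (simp add: inner_ancestor_form)
  also have "(\<Sum>h\<in>{h. g < h \<and> h < top}. p_coord h x - m_coord h x) =
      (\<Sum>h\<in>{h\<in>K. g < h \<and> h < top}. p_coord h x - m_coord h x)"
    using x by (intro sum.mono_neutral_right) auto
  finally show ?thesis by (simp add: causal_form_def)
qed

text \<open>
  Only the causal inequalities of elements of \<open>N\<close> matter, and they can be expressed without reference
  to the ambient set \<open>K\<close>. Hence the same nested set gives the same cone for \<open>G\<close> and for the set \<open>H\<close> in the
  residue formula.
\<close>

lemma nested_cone_Int_causal_cone:
  assumes N: "forest N" "top \<in> N" "N \<subseteq> K" and K: "bot \<notin> K"
  shows "nested_cone N \<inter> causal_cone K = tree_cone N"
proof
  show "nested_cone N \<inter> causal_cone K \<subseteq> tree_cone N"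
  proof
    fix x assume x: "x \<in> nested_cone N \<inter> causal_cone K"
    have z: "\<forall>h. h \<notin> N \<longrightarrow> p_coord h x = 0 \<and> m_coord h x = 0" "\<forall>g. 0 \<le> p_coord g x \<and> 0 \<le> m_coord g x"
      using x by (simp_all add: nested_cone_eq)
    have t: "m_coord top x = 0" "\<forall>g\<in>K. 0 \<le> causal_form K g x" using x by (simp_all add: causal_cone_def)
    have "m_coord c x \<le> x \<bullet> ancestor_form c" if "c \<in> N" "c \<noteq> top" for c
    proof -
      have "\<forall>h. h \<notin> K \<longrightarrow> p_coord h x = 0 \<and> m_coord h x = 0" using z N by blast
      from causal_form_eq[OF this t(1) that(2)] show ?thesis using t(2) N that by force
    qed
    then show "x \<in> tree_cone N" using z t by (simp add: tree_cone_def)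
  qed
next
  show "tree_cone N \<subseteq> nested_cone N \<inter> causal_cone K"
  proof
    fix x assume x: "x \<in> tree_cone N"
    have z: "\<forall>h. h \<notin> N \<longrightarrow> p_coord h x = 0 \<and> m_coord h x = 0" "m_coord top x = 0"
      using x by (simp_all add: tree_cone_def)
    have pos: "\<forall>g. 0 \<le> p_coord g x \<and> 0 \<le> m_coord g x" using tree_cone_nonneg[OF x] by blast
    have "x \<in> span (tree_basis N)" using in_span_tree_basis z by blast
    moreover have "tree_basis N \<subseteq> plus_vec ` K \<union> minus_vec ` K"
      using N by (auto simp: tree_basis_def)
    ultimately have "x \<in> span (plus_vec ` K \<union> minus_vec ` K)" using span_mono by blast
    moreover have "0 \<le> causal_form K g x" if g: "g \<in> K" for g
    proof (cases "g = top")
      case True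
      then have "{f \<in> K. g < f \<and> f < top} = {}" by auto
      then show ?thesis using pos z True by (simp add: causal_form_def)
    next
      case False
      have e: "causal_form K g x = x \<bullet> ancestor_form g - m_coord g x"
        by (rule causal_form_eq) (use z N False in auto)
      have "g \<noteq> bot" using g K by blast
      from ancestor_form_nonneg[OF N(1,2) x this False]
      show ?thesis unfolding e using x z False by (cases "g \<in> N") (simp_all add: tree_cone_def)
    qed
    ultimately show "x \<in> nested_cone N \<inter> causal_cone K"
      using z pos by (simp add: nested_cone_eq causal_cone_def)
  qed
qed

lemma maximal_nested_set_exists:
  fixes K :: "'a::{finite, lattice} set"
  assumes "N \<in> nested_sets K"
  shows "\<exists>M\<in>maximal_sets (nested_sets K). N \<subseteq> M"
  using finite_has_maximal2[OF _ assms] by (auto simp: maximal_sets_def)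

lemma top_in_maximal_nested_set:
  fixes K :: "'a::{finite, bounded_lattice} set"
  assumes "top \<in> K" and N: "N \<in> maximal_sets (nested_sets K)"
  shows "top \<in> N"
proof -
  have NK: "N \<in> nested_sets K" using N by (simp add: maximal_sets_def)
  have "insert top N \<in> nested_sets K"
    unfolding nested_sets_def
  proof (intro CollectI conjI allI impI)
    show "insert top N \<subseteq> K" using NK assms by (auto simp: nested_sets_def)
    fix S assume S: "S \<subseteq> insert top N" "finite S" "2 \<le> card S" "pairwise incomparable S"
    have "top \<notin> S"
    proof
      assume top: "top \<in> S"
      moreover have "S \<noteq> {top}" using S(3) by auto
      ultimately obtain s where "s \<in> S" "s \<noteq> top" by blast
      then have "incomparable s top" using S(4) top by (simp add: pairwise_def)
      then show False by (simp add: incomparable_def)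
    qed
    then have "S \<subseteq> N" using S(1) by blast
    then show "Sup_fin S \<notin> K" using NK S by (simp add: nested_sets_def)
  qed
  moreover have "N \<subseteq> insert top N" by blast
  ultimately have "N = insert top N" using N unfolding maximal_sets_def by blast
  then show ?thesis by blast
qed

text \<open>
  The cones of maximal nested sets contain all cones of the universe fan, and they are pairwise not
  contained in each other because the cone of \<open>N\<close> contains the rays \<open>c\<^sup>+\<close> for \<open>c \<in> N\<close>.
\<close>

theorem wavefunction_eq_sum:
  fixes K :: "'a::{finite, bounded_lattice} set"
  assumes top: "top \<in> K" and bot: "bot \<notin> K" and forest: "\<And>N. N \<in> nested_sets K \<Longrightarrow> forest N"
  shows "wavefunction K = (\<Sum>N\<in>maximal_sets (nested_sets K). tree_ratfun N)"
proof -
  let ?M = "maximal_sets (nested_sets K)"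
  let ?C = "\<lambda>N. nested_cone N \<inter> causal_cone K"
  have M: "N \<in> nested_sets K" "forest N" "top \<in> N" "N \<subseteq> K" if "N \<in> ?M" for N
    using that top_in_maximal_nested_set[OF top that] forest
    by (auto simp: maximal_sets_def nested_sets_def)
  have C: "?C N = tree_cone N" if "N \<in> ?M" for N
    using nested_cone_Int_causal_cone M[OF that] bot by blast
  have cvx: "convex (nested_cone N)" "convex (causal_cone K)" for N
  proof -
    show "convex (nested_cone N)" by (simp add: nested_cone_def convex_convex_cone_hull)
    have "convex_cone (causal_cone K)"
      unfolding convex_cone_iff
    proof (intro conjI ballI allI impI)
      show "0 \<in> causal_cone K" by (simp add: causal_cone_def causal_form_def span_zero)
      fix x y assume "x \<in> causal_cone K" "y \<in> causal_cone K"
      moreover have "causal_form K g (x + y) = causal_form K g x + causal_form K g y" for g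
        by (simp add: causal_form_def sum.distrib sum_subtractf)
      ultimately show "x + y \<in> causal_cone K" by (simp add: causal_cone_def span_add)
    next
      fix x and c :: real assume "x \<in> causal_cone K" "0 \<le> c"
      moreover have "causal_form K g (c *\<^sub>R x) = c * causal_form K g x" for g
        by (simp add: causal_form_def sum_distrib_left algebra_simps)
      ultimately show "c *\<^sub>R x \<in> causal_cone K" by (simp add: causal_cone_def span_scale)
    qed
    then show "convex (causal_cone K)" by (simp add: convex_cone_def)
  qed
  have mono: "A \<subseteq> B \<Longrightarrow> nested_cone A \<subseteq> nested_cone B" for A B
    unfolding nested_cone_def by (intro hull_mono) auto
  have in_fan: "?C N \<in> universe_fan K" if "N \<in> ?M" for N
  proof -
    have "nested_cone N \<in> nested_fan K"
      using M(1)[OF that] cvx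
      by (auto simp: nested_fan_def nested_cone_def convex_cone_hull_nonempty intro!: bexI[of _ N] face_of_refl)
    moreover have "?C N face_of ?C N" using cvx by (intro face_of_refl convex_Int)
    moreover have "0 \<in> tree_cone N" by (simp add: tree_cone_def)
    then have "?C N \<noteq> {}" using C[OF that] by blast
    ultimately show ?thesis unfolding universe_fan_def by blast
  qed
  have below: "\<exists>N\<in>?M. F \<subseteq> ?C N" if F: "F \<in> universe_fan K" for F
  proof -
    obtain D N where "N \<in> nested_sets K" "D face_of nested_cone N" "F face_of (D \<inter> causal_cone K)"
      using F unfolding universe_fan_def nested_fan_def by blast
    moreover obtain N' where "N' \<in> ?M" "N \<subseteq> N'"
      using maximal_nested_set_exists \<open>N \<in> nested_sets K\<close> by blast
    ultimately show ?thesis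
      using face_of_imp_subset mono[of N N'] by blast
  qed
  have inj: "N = N'" if "N \<in> ?M" "N' \<in> ?M" "?C N \<subseteq> ?C N'" for N N'
  proof -
    have "N \<subseteq> N'"
    proof
      fix c assume c: "c \<in> N"
      have "plus_vec c \<in> tree_cone N" using c by (auto simp: tree_cone_def)
      then have "plus_vec c \<in> tree_cone N'" using that C by blast
      then have "c \<notin> N' \<longrightarrow> p_coord c (plus_vec c) = 0" by (simp add: tree_cone_def del: coord_plus_vec)
      then show "c \<in> N'" by auto
    qed
    then show ?thesis using that by (auto simp: maximal_sets_def)
  qed
  have "maximal_sets (universe_fan K) = ?C ` ?M"
  proof
    show "maximal_sets (universe_fan K) \<subseteq> ?C ` ?M"
    proof
      fix F assume F: "F \<in> maximal_sets (universe_fan K)"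
      then obtain N where N: "N \<in> ?M" "F \<subseteq> ?C N"
        using below[of F] by (auto simp: maximal_sets_def)
      then have "F = ?C N" using F in_fan[of N] by (simp add: maximal_sets_def)
      then show "F \<in> ?C ` ?M" using N(1) by (rule image_eqI)
    qed
    show "?C ` ?M \<subseteq> maximal_sets (universe_fan K)"
    proof
      fix F assume "F \<in> ?C ` ?M"
      then obtain N where N: "N \<in> ?M" "F = ?C N" by blast
      have "F = D" if "D \<in> universe_fan K" "F \<subseteq> D" for D
      proof -
        obtain N' where "N' \<in> ?M" "D \<subseteq> ?C N'" using below \<open>D \<in> universe_fan K\<close> by blast
        then have "N = N'" using inj N that by blast
        then show ?thesis using N that \<open>D \<subseteq> ?C N'\<close> by blast
      qed
      then show "F \<in> maximal_sets (universe_fan K)"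
        using in_fan N by (simp add: maximal_sets_def)
    qed
  qed
  moreover have "inj_on ?C ?M" using inj by (auto simp: inj_on_def)
  ultimately have "wavefunction K = (\<Sum>N\<in>?M. cone_laplace (?C N))"
    by (simp add: wavefunction_def fan_laplace_def sum.reindex)
  also have "\<dots> = (\<Sum>N\<in>?M. tree_ratfun N)"
    by (intro sum.cong refl) (simp add: C M cone_laplace_tree_cone)
  finally show ?thesis .
qed

section \<open>Nested sets of a stable nestoid\<close>

text \<open>
  If \<open>x = a' \<squnion> b\<close> were in \<open>G\<close>, then \<open>x\<close> and \<open>a\<close> would be incomparable with join \<open>a \<squnion> b\<close>
  outside \<open>G\<close>, so their meet would be \<open>bot\<close>, although it lies above \<open>a'\<close>.
\<close>

lemma nestable_join_notin_mono:
  assumes G: "nestable G" and ab: "a \<in> G" "b \<in> G" "sup a b \<notin> G" and a': "a' \<in> G" "a' \<le> a"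
  shows "sup a' b \<notin> G"
proof
  assume x: "sup a' b \<in> G"
  have e: "sup (sup a' b) a = sup a b"
    using a'(2) by (metis sup.absorb2 sup.assoc sup.commute)
  have "\<not> sup a' b \<le> a" using ab by (metis le_sup_iff sup.absorb1)
  moreover have "\<not> a \<le> sup a' b" using ab e x by (metis sup.absorb1)
  ultimately have "incomparable (sup a' b) a" by (simp add: incomparable_def)
  then have "inf (sup a' b) a = bot" using G ab x e by (simp add: nestable_def)
  moreover have "a' \<le> inf (sup a' b) a" using a' by simp
  ultimately have "a' = bot" by (simp add: bot_unique)
  then show False using a' G by (auto simp: nestable_def)
qed

definition compatible :: "'a::lattice set \<Rightarrow> 'a \<Rightarrow> 'a \<Rightarrow> bool" where
  "compatible G a b \<longleftrightarrow> a \<le> b \<or> b \<le> a \<or> sup a b \<notin> G"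

lemma compatible_sym: "compatible G a b \<longleftrightarrow> compatible G b a"
  by (auto simp: compatible_def sup.commute)

lemma nested_sets_compatible:
  assumes "N \<in> nested_sets G" "a \<in> N" "b \<in> N"
  shows "compatible G a b"
proof (rule ccontr)
  assume c: "\<not> compatible G a b"
  then have "pairwise incomparable {a, b}" "card {a, b} = 2"
    by (auto simp: compatible_def pairwise_def incomparable_def)
  moreover have "{a, b} \<subseteq> N" using assms by blast
  moreover have "Sup_fin S \<notin> G" if "S \<subseteq> N" "finite S" "2 \<le> card S" "pairwise incomparable S" for S
    using assms(1) that by (simp add: nested_sets_def)
  ultimately have "Sup_fin {a, b} \<notin> G" by (metis finite.emptyI finite_insert order_refl)
  then show False using c by (simp add: compatible_def)
qed

text \<open>
  Stability reduces nestedness to a condition on pairs: the join of one element with several others,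
  each of which has join outside \<open>G\<close> with it, is outside \<open>G\<close>.
\<close>

lemma nested_sets_iff_compatible:
  assumes G: "stable_nestoid G"
  shows "N \<in> nested_sets G \<longleftrightarrow> N \<subseteq> G \<and> (\<forall>a\<in>N. \<forall>b\<in>N. compatible G a b)"
proof
  assume N: "N \<in> nested_sets G"
  then have "N \<subseteq> G" by (simp add: nested_sets_def)
  then show "N \<subseteq> G \<and> (\<forall>a\<in>N. \<forall>b\<in>N. compatible G a b)"
    using nested_sets_compatible[OF N] by blast
next
  assume N: "N \<subseteq> G \<and> (\<forall>a\<in>N. \<forall>b\<in>N. compatible G a b)"
  have "Sup_fin S \<notin> G" if S: "S \<subseteq> N" "2 \<le> card S" "pairwise incomparable S" for S
  proof -
    obtain f where f: "f \<in> S" using S(2) by fastforce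
    have ne: "S - {f} \<noteq> {}"
    proof
      assume "S - {f} = {}"
      then have "S = {f}" using f by blast
      then show False using S(2) by simp
    qed
    have "\<forall>g\<in>S - {f}. sup f g \<notin> G"
    proof
      fix g assume g: "g \<in> S - {f}"
      then have "incomparable f g" using S(3) f by (auto simp: pairwise_def)
      moreover have "compatible G f g" using N S(1) f g by blast
      ultimately show "sup f g \<notin> G" by (simp add: compatible_def incomparable_def)
    qed
    moreover have "f \<in> G" "S - {f} \<subseteq> G" using N S(1) f by auto
    ultimately have "Sup_fin (insert f (S - {f})) \<notin> G"
      using G ne unfolding stable_nestoid_def by blast
    then show ?thesis using f by (simp add: insert_absorb)
  qed
  then show "N \<in> nested_sets G" using N by (simp add: nested_sets_def)
qed

text \<open>
  If \<open>K\<close> contains the joins of its incomparable elements that lie in \<open>G\<close>, compatibility with respect to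
  \<open>K\<close> and to \<open>G\<close> coincide on \<open>K\<close>.
\<close>

lemma nested_sets_subset_eq:
  assumes G: "stable_nestoid G" and K: "K \<subseteq> G"
    and closed: "\<And>a b. a \<in> K \<Longrightarrow> b \<in> K \<Longrightarrow> \<not> a \<le> b \<Longrightarrow> \<not> b \<le> a \<Longrightarrow> sup a b \<in> G \<Longrightarrow> sup a b \<in> K"
  shows "nested_sets K = {N \<in> nested_sets G. N \<subseteq> K}"
proof
  show "nested_sets K \<subseteq> {N \<in> nested_sets G. N \<subseteq> K}"
  proof
    fix N assume N: "N \<in> nested_sets K"
    then have NK: "N \<subseteq> K" by (simp add: nested_sets_def)
    have "compatible G a b" if "a \<in> N" "b \<in> N" for a b
      using nested_sets_compatible[OF N that] closed[of a b] NK that by (auto simp: compatible_def)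
    then show "N \<in> {N \<in> nested_sets G. N \<subseteq> K}"
      using NK K by (auto simp: nested_sets_iff_compatible[OF G])
  qed
  show "{N \<in> nested_sets G. N \<subseteq> K} \<subseteq> nested_sets K"
    using K by (auto simp: nested_sets_def)
qed

text \<open>
  Incomparable elements of a nested set have join outside \<open>G\<close>, hence meet \<open>bot\<close>.
\<close>

lemma nested_set_forest:
  assumes G: "nestable G" and N: "N \<in> nested_sets G"
  shows "forest N"
  unfolding forest_def
proof (intro conjI ballI allI impI)
  have NG: "N \<subseteq> G" using N by (simp add: nested_sets_def)
  then show "bot \<notin> N" using G by (auto simp: nestable_def)
  fix a b c assume a: "a \<in> N" "b \<in> N" "c \<noteq> bot" "c \<le> a" "c \<le> b"
  show "a \<le> b \<or> b \<le> a"
  proof (rule ccontr)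
    assume "\<not> (a \<le> b \<or> b \<le> a)"
    moreover from this have "sup a b \<notin> G"
      using nested_sets_compatible[OF N a(1,2)] by (auto simp: compatible_def)
    ultimately have "inf a b = bot"
      using G a(1,2) NG by (auto simp: nestable_def incomparable_def)
    moreover have "c \<le> inf a b" using a by simp
    ultimately show False using a(3) by (simp add: bot_unique)
  qed
qed

lemma maximal_setsD: "C \<in> maximal_sets K \<Longrightarrow> D \<in> K \<Longrightarrow> C \<subseteq> D \<Longrightarrow> C = D"
  by (simp add: maximal_sets_def)

locale stable_region =
  fixes G :: "'a::{finite, bounded_lattice} set" and f :: 'a and A :: "'a set"
  assumes G: "stable_nestoid G"
    and region: "causal_region G (insert f A)"
    and A_less: "\<And>g. g \<in> A \<Longrightarrow> g < f"
begin

abbreviation "I \<equiv> region_inside G f A"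
abbreviation "H \<equiv> insert f (region_outside G f A)"

lemma nestable: "nestable G"
  using G by (simp add: stable_nestoid_def nestoid_def)

lemma R_nested: "insert f A \<in> nested_sets G"
  using region by (simp add: causal_region_def)

lemma f_in: "f \<in> G" and A_in: "A \<subseteq> G"
  using R_nested by (auto simp: nested_sets_def)

lemma A_joins:
  assumes "g \<in> A" "g' \<in> A" "g \<noteq> g'"
  shows "sup g g' \<notin> G"
proof -
  obtain r where r: "{s \<in> insert f A. \<forall>t\<in>insert f A. \<not> s < t} = {r}" "pairwise incomparable (insert f A - {r})"
    using region by (auto simp: causal_region_def)
  have "\<not> f < t" if "t \<in> insert f A" for t
    using that A_less by (auto dest: less_asym)
  then have "f \<in> {s \<in> insert f A. \<forall>t\<in>insert f A. \<not> s < t}" by blast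
  then have "r = f" unfolding r(1) by simp
  moreover have "g \<noteq> f" "g' \<noteq> f" using assms A_less by auto
  ultimately have "incomparable g g'"
    using r(2) assms by (auto simp: pairwise_def)
  then show ?thesis
    using nested_sets_compatible[OF R_nested, of g g'] assms by (auto simp: compatible_def incomparable_def)
qed

lemma H_subset: "H \<subseteq> G" and I_subset: "I \<subseteq> G"
  using f_in by (auto simp: region_outside_def upper_part_def lower_part_def region_inside_def)

lemma H_cases:
  assumes "h \<in> H"
  obtains "h = f" | "h \<in> G" "f < h" | "h \<in> G" "sup h f \<notin> G" | g where "h \<in> G" "g \<in> A" "h \<le> g"
  using assms by (auto simp: region_outside_def upper_part_def lower_part_def)

lemma H_intros:
  "f \<in> H" "h \<in> G \<Longrightarrow> f < h \<Longrightarrow> h \<in> H" "h \<in> G \<Longrightarrow> sup h f \<notin> G \<Longrightarrow> h \<in> H"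
  "h \<in> G \<Longrightarrow> g \<in> A \<Longrightarrow> h \<le> g \<Longrightarrow> h \<in> H"
  by (auto simp: region_outside_def upper_part_def lower_part_def)

lemma join_notin_mono:
  "a \<in> G \<Longrightarrow> b \<in> G \<Longrightarrow> sup a b \<notin> G \<Longrightarrow> a' \<in> G \<Longrightarrow> a' \<le> a \<Longrightarrow> sup a' b \<notin> G"
  by (rule nestable_join_notin_mono[OF nestable])

lemma stable_pair:
  assumes "h \<in> G" "a \<in> G" "b \<in> G" "sup a h \<notin> G" "sup b h \<notin> G"
  shows "sup (sup a b) h \<notin> G"
proof -
  have "Sup_fin (insert h {a, b}) \<notin> G"
    using G assms unfolding stable_nestoid_def
    by (metis empty_iff insertE insert_not_empty insert_subset empty_subsetI sup.commute)
  moreover have "Sup_fin (insert h {a, b}) = sup (sup a b) h"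
    by (simp add: sup.commute)
  ultimately show ?thesis by simp
qed

text \<open>
  The elements of \<open>H\<close> that are not greater than or equal to \<open>f\<close> come in two kinds, those whose join with \<open>f\<close> is outside \<open>G\<close> and those below some
  element of \<open>A\<close>. Joins of two of the first kind remain of that kind by stability; joins of elements of
  different kinds, or below different elements of \<open>A\<close>, are outside \<open>G\<close> by monotonicity.
\<close>

lemma H_closed:
  assumes a: "a \<in> H" and b: "b \<in> H" and ab: "\<not> a \<le> b" "\<not> b \<le> a" "sup a b \<in> G"
  shows "sup a b \<in> H"
proof -
  have above: "sup a b \<in> H" if "f < a \<or> f < b"
    using that ab by (intro H_intros(2)) (auto intro: less_le_trans)
  have mixed: "sup x y \<notin> G" if "x \<in> G" "sup x f \<notin> G" "y \<in> G" "y \<le> f" for x y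
    using join_notin_mono[of f x y] that f_in by (simp add: sup.commute)
  show ?thesis
    using a
  proof (cases rule: H_cases)
    case 1
    note a = 1
    show ?thesis
      using b
    proof (cases rule: H_cases)
      case (4 g)
      then have "b \<le> a" using A_less[of g] a by (meson less_imp_le order_trans)
      then show ?thesis using ab by simp
    qed (use a ab in \<open>simp_all add: sup.commute less_imp_le\<close>)
  next
    case 2
    then show ?thesis using above by blast
  next
    case 3
    note a = 3
    show ?thesis
      using b
    proof (cases rule: H_cases)
      case 1
      then show ?thesis using a ab by simp
    next
      case 2
      then show ?thesis using above by blast
    next
      case 3
      then show ?thesis using stable_pair[of f a b] a f_in ab by (intro H_intros(3)) simp_all
    next
      case (4 g)
      then have "b \<le> f" using A_less[of g] by (meson less_imp_le order_trans)
      then show ?thesis using mixed[of a b] a 4 ab by simp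
    qed
  next
    case (4 g)
    note a = 4
    have af: "a \<le> f" using a A_less[of g] by (meson less_imp_le order_trans)
    show ?thesis
      using b
    proof (cases rule: H_cases)
      case 1
      then show ?thesis using af ab by simp
    next
      case 2
      then show ?thesis using above by blast
    next
      case 3
      then show ?thesis using mixed[of b a] af a ab by (simp add: sup.commute)
    next
      case (4 g')
      show ?thesis
      proof (cases "g = g'")
        case True
        then show ?thesis using a 4 ab by (intro H_intros(4)[of _ g]) simp_all
      next
        case False
        have gs: "g \<in> G" "g' \<in> G" using a 4 A_in by auto
        have "sup a g' \<notin> G" using join_notin_mono[OF gs A_joins[OF a(2) 4(2) False] a(1,3)] .
        then have "sup b a \<notin> G" using join_notin_mono[of g' a b] gs a 4 by (simp add: sup.commute)
        then show ?thesis using ab by (simp add: sup.commute)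
      qed
    qed
  qed
qed

lemma I_closed:
  assumes "a \<in> I" "b \<in> I" "sup a b \<in> G"
  shows "sup a b \<in> I"
  unfolding region_inside_def
proof (intro CollectI conjI ballI)
  show "sup a b \<in> G" by fact
  show "sup a b \<le> f" using assms by (simp add: region_inside_def)
  fix g assume g: "g \<in> A"
  show "g < sup a b \<or> sup (sup a b) g \<notin> G"
  proof (cases "g < a \<or> g < b")
    case True
    then show ?thesis by (auto intro: less_le_trans)
  next
    case False
    then have "sup a g \<notin> G" "sup b g \<notin> G" "a \<in> G" "b \<in> G" "g \<in> G"
      using assms g A_in by (auto simp: region_inside_def)
    then show ?thesis using stable_pair by blast
  qed
qed

lemma nested_sets_H: "nested_sets H = {N \<in> nested_sets G. N \<subseteq> H}"
  by (rule nested_sets_subset_eq[OF G H_subset H_closed])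

lemma nested_sets_I: "nested_sets I = {N \<in> nested_sets G. N \<subseteq> I}"
  by (rule nested_sets_subset_eq[OF G I_subset]) (rule I_closed)

text \<open>
  Elements inside and outside the region never obstruct each other, so nested sets of the two parts can
  be combined freely.
\<close>

lemma compatible_I_H:
  assumes a: "a \<in> I" and b: "b \<in> H"
  shows "compatible G a b"
proof -
  have aG: "a \<in> G" "a \<le> f" using a by (auto simp: region_inside_def)
  show ?thesis
    using b
  proof (cases rule: H_cases)
    case 1
    then show ?thesis using aG by (simp add: compatible_def)
  next
    case 2
    then show ?thesis using aG by (simp add: compatible_def order_trans[OF aG(2) less_imp_le])
  next
    case 3
    then show ?thesis
      using join_notin_mono[of f b a] aG f_in by (simp add: compatible_def sup.commute)
  next
    case (4 g)
    then have "g < a \<or> sup a g \<notin> G" using a by (simp add: region_inside_def)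
    then show ?thesis
    proof
      assume "g < a"
      then show ?thesis using 4 by (simp add: compatible_def order_trans[OF _ less_imp_le])
    next
      assume "sup a g \<notin> G"
      then have "sup b a \<notin> G"
        using join_notin_mono[of g a b] 4 aG A_in by (auto simp: sup.commute)
      then show ?thesis by (simp add: compatible_def sup.commute)
    qed
  qed
qed

lemma f_in_I: "f \<in> I"
  using f_in A_less by (simp add: region_inside_def)

lemma A_disjoint_I:
  assumes "a \<in> I" "g \<in> A"
  shows "\<not> a \<le> g"
proof
  assume "a \<le> g"
  moreover have "g < a \<or> sup a g \<notin> G" using assms by (simp add: region_inside_def)
  ultimately show False using assms A_in by (auto simp: sup.absorb2)
qed

lemma I_Int_H: "I \<inter> H = {f}"
proof -
  have "a = f" if "a \<in> I" "a \<in> H" for a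
    using that(2)
  proof (cases rule: H_cases)
    case 2
    then show ?thesis using that(1) by (auto simp: region_inside_def)
  next
    case 3
    then show ?thesis using that(1) f_in by (simp add: region_inside_def sup.absorb2)
  next
    case (4 g)
    then show ?thesis using A_disjoint_I[OF that(1)] by blast
  qed
  then show ?thesis using f_in_I by blast
qed

lemma nested_subset_I_Un_H:
  assumes N: "N \<in> nested_sets G" "insert f A \<subseteq> N"
  shows "N \<subseteq> I \<union> H"
proof
  fix h assume h: "h \<in> N"
  have hG: "h \<in> G" using N h by (auto simp: nested_sets_def)
  have c: "compatible G h b" if "b \<in> insert f A" for b
    using nested_sets_compatible[OF N(1) h] that N(2) by blast
  show "h \<in> I \<union> H"
  proof (cases "h \<in> H")
    case False
    have "h \<le> f" using c[of f] False H_intros(1) H_intros(2,3)[of h] hG by (auto simp: compatible_def less_le)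
    moreover have "g < h \<or> sup h g \<notin> G" if "g \<in> A" for g
      using c[of g] that False H_intros(4)[of h g] hG by (auto simp: compatible_def less_le)
    ultimately show ?thesis using hG by (simp add: region_inside_def)
  qed blast
qed

text \<open>
  This forces the region into every maximal nested set of \<open>H\<close>, so the nested sets of \<open>H\<close> need no
  restriction in the bijection below.
\<close>

lemma R_compatible_H:
  assumes r: "r \<in> insert f A" and b: "b \<in> H"
  shows "compatible G r b"
proof (cases "r = f")
  case True
  then show ?thesis using compatible_I_H[OF f_in_I b] by simp
next
  case False
  then have rA: "r \<in> A" "r \<le> f" "r \<in> G" using r A_less A_in by (auto intro: less_imp_le)
  show ?thesis
    using b
  proof (cases rule: H_cases)
    case 1
    then show ?thesis using rA by (simp add: compatible_def)
  next
    case 2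
    then show ?thesis using order_trans[OF rA(2) less_imp_le] by (simp add: compatible_def)
  next
    case 3
    then show ?thesis
      using join_notin_mono[of f b r] rA f_in by (simp add: compatible_def sup.commute)
  next
    case (4 g)
    show ?thesis
    proof (cases "g = r")
      case True
      then show ?thesis using 4 by (simp add: compatible_def)
    next
      case False
      then have "sup b r \<notin> G"
        using join_notin_mono[of g r b] A_joins[of g r] 4 rA A_in by auto
      then show ?thesis by (simp add: compatible_def sup.commute)
    qed
  qed
qed

lemma R_subset_H: "insert f A \<subseteq> H"
  using H_intros A_in by blast

lemma R_subset_maximal_H:
  assumes "N \<in> maximal_sets (nested_sets H)"
  shows "insert f A \<subseteq> N"
proof -
  have N: "N \<in> nested_sets G" "N \<subseteq> H" "N \<in> nested_sets H"
    using assms nested_sets_H by (auto simp: maximal_sets_def)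
  have "N \<union> insert f A \<in> nested_sets G"
    using N R_nested R_compatible_H compatible_sym[of G]
    unfolding nested_sets_iff_compatible[OF G] by (metis Un_iff Un_subset_iff subsetD)
  then have "N \<union> insert f A \<in> nested_sets H"
    using N R_subset_H unfolding nested_sets_H by blast
  then have "N = N \<union> insert f A" by (rule maximal_setsD[OF assms]) (rule Un_upper1)
  then show ?thesis by blast
qed

lemma f_in_maximal_I:
  assumes "N \<in> maximal_sets (nested_sets I)"
  shows "f \<in> N"
proof -
  have N: "N \<in> nested_sets G" "N \<subseteq> I"
    using assms nested_sets_I by (auto simp: maximal_sets_def)
  have "compatible G f b" if "b \<in> I" for b
    using that by (simp add: region_inside_def compatible_def)
  then have "insert f N \<in> nested_sets G"
    using N f_in compatible_sym[of G] unfolding nested_sets_iff_compatible[OF G]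
    by (metis insert_iff insert_subset subsetD compatible_def order_refl)
  then have "insert f N \<in> nested_sets I" using N f_in_I unfolding nested_sets_I by blast
  then have "N = insert f N" by (rule maximal_setsD[OF assms]) (rule subset_insertI)
  then show ?thesis by blast
qed

lemma nested_Un:
  assumes "N1 \<in> nested_sets I" "N2 \<in> nested_sets H"
  shows "N1 \<union> N2 \<in> nested_sets G"
proof -
  have 1: "N1 \<in> nested_sets G" "N1 \<subseteq> I" and 2: "N2 \<in> nested_sets G" "N2 \<subseteq> H"
    using assms nested_sets_I nested_sets_H by auto
  have "compatible G a b" if "a \<in> N1" "b \<in> N2" for a b
    using compatible_I_H that 1 2 by blast
  then show ?thesis
    using 1 2 compatible_sym[of G] unfolding nested_sets_iff_compatible[OF G]
    by (metis Un_iff Un_subset_iff)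
qed

lemma nested_Int:
  assumes "N \<in> nested_sets G"
  shows "N \<inter> I \<in> nested_sets I" "N \<inter> H \<in> nested_sets H"
  using assms unfolding nested_sets_I nested_sets_H nested_sets_iff_compatible[OF G] by auto

text \<open>
  A nested set containing the region splits into its parts inside and outside. Since these two parts
  are automatically compatible, maximality can be tested on each of them separately.
\<close>

lemma maximal_nested_sets_region:
  "{N \<in> maximal_sets (nested_sets G). insert f A \<subseteq> N} =
    (\<lambda>(N1, N2). N1 \<union> N2) ` (maximal_sets (nested_sets I) \<times> maximal_sets (nested_sets H))"
proof (intro equalityI subsetI)
  fix N assume "N \<in> {N \<in> maximal_sets (nested_sets G). insert f A \<subseteq> N}"
  then have N: "N \<in> nested_sets G" "insert f A \<subseteq> N"
    and max: "\<And>D. D \<in> nested_sets G \<Longrightarrow> N \<subseteq> D \<Longrightarrow> N = D"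
    by (auto simp: maximal_sets_def)
  have cover: "N = (N \<inter> I) \<union> (N \<inter> H)" using nested_subset_I_Un_H[OF N] by blast
  have "N \<inter> I \<in> maximal_sets (nested_sets I)"
    unfolding maximal_sets_def
  proof (intro CollectI conjI ballI impI)
    fix D assume D: "D \<in> nested_sets I" "N \<inter> I \<subseteq> D"
    have "N = D \<union> (N \<inter> H)"
      by (rule max) (use nested_Un[OF D(1) nested_Int(2)[OF N(1)]] cover D in auto)
    moreover have "D \<subseteq> I" using D by (auto simp: nested_sets_def)
    ultimately show "N \<inter> I = D" using D by blast
  qed (rule nested_Int[OF N(1)])
  moreover have "N \<inter> H \<in> maximal_sets (nested_sets H)"
    unfolding maximal_sets_def
  proof (intro CollectI conjI ballI impI)
    fix D assume D: "D \<in> nested_sets H" "N \<inter> H \<subseteq> D"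
    have "N = (N \<inter> I) \<union> D"
      by (rule max) (use nested_Un[OF nested_Int(1)[OF N(1)] D(1)] cover D in auto)
    moreover have "D \<subseteq> H" using D(1) unfolding nested_sets_def by blast
    ultimately show "N \<inter> H = D" using D by blast
  qed (rule nested_Int[OF N(1)])
  ultimately show "N \<in> (\<lambda>(N1, N2). N1 \<union> N2) ` (maximal_sets (nested_sets I) \<times> maximal_sets (nested_sets H))"
    using cover by (intro image_eqI[of _ _ "(N \<inter> I, N \<inter> H)"]) auto
next
  fix N assume "N \<in> (\<lambda>(N1, N2). N1 \<union> N2) ` (maximal_sets (nested_sets I) \<times> maximal_sets (nested_sets H))"
  then obtain N1 N2 where N: "N = N1 \<union> N2"
    and 1: "N1 \<in> maximal_sets (nested_sets I)" and 2: "N2 \<in> maximal_sets (nested_sets H)" by auto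
  have nest: "N1 \<in> nested_sets I" "N2 \<in> nested_sets H" using 1 2 by (auto simp: maximal_sets_def)
  have R: "insert f A \<subseteq> N" using R_subset_maximal_H[OF 2] N by blast
  have "N = D" if D: "D \<in> nested_sets G" "N \<subseteq> D" for D
  proof -
    have "N1 \<subseteq> D \<inter> I" "N2 \<subseteq> D \<inter> H" using nest N D by (auto simp: nested_sets_def)
    then have "N1 = D \<inter> I" "N2 = D \<inter> H"
      using maximal_setsD[OF 1 nested_Int(1)[OF D(1)]] maximal_setsD[OF 2 nested_Int(2)[OF D(1)]] by simp_all
    moreover have "D \<subseteq> I \<union> H" using nested_subset_I_Un_H[OF D(1)] R D(2) by blast
    ultimately show ?thesis using N by blast
  qed
  moreover have "N \<in> nested_sets G" unfolding N by (rule nested_Un[OF nest])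
  ultimately have "N \<in> maximal_sets (nested_sets G)" unfolding maximal_sets_def by blast
  then show "N \<in> {N \<in> maximal_sets (nested_sets G). insert f A \<subseteq> N}" using R by blast
qed

lemma inj_on_Un_maximal:
  "inj_on (\<lambda>(N1, N2). N1 \<union> N2) (maximal_sets (nested_sets I) \<times> maximal_sets (nested_sets H))"
proof -
  have inv: "(N1 \<union> N2) \<inter> I = N1 \<and> (N1 \<union> N2) \<inter> H = N2"
    if "N1 \<in> maximal_sets (nested_sets I)" "N2 \<in> maximal_sets (nested_sets H)" for N1 N2
  proof -
    have f: "f \<in> N1" "f \<in> N2" using f_in_maximal_I[OF that(1)] R_subset_maximal_H[OF that(2)] by auto
    have sub: "N1 \<subseteq> I" "N2 \<subseteq> H" using that by (simp_all add: maximal_sets_def nested_sets_def)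
    have "N2 \<inter> I \<subseteq> I \<inter> H" "N1 \<inter> H \<subseteq> I \<inter> H" using sub by auto
    then have "N2 \<inter> I \<subseteq> {f}" "N1 \<inter> H \<subseteq> {f}" unfolding I_Int_H .
    then show ?thesis using f sub by auto
  qed
  show ?thesis
  proof (rule inj_on_inverseI[where g = "\<lambda>N. (N \<inter> I, N \<inter> H)"])
    fix p assume p: "p \<in> maximal_sets (nested_sets I) \<times> maximal_sets (nested_sets H)"
    obtain N1 N2 where [simp]: "p = (N1, N2)" by (cases p)
    show "((case p of (N1, N2) \<Rightarrow> N1 \<union> N2) \<inter> I, (case p of (N1, N2) \<Rightarrow> N1 \<union> N2) \<inter> H) = p"
      using inv[of N1 N2] p by simp
  qed
qed

end

section \<open>The residue\<close>

context stable_region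
begin

text \<open>The ray of the universe fan dual to the hyperplane \<open>E\<^sub>R = 0\<close>.\<close>

definition ray :: "'a energy_space" where
  "ray = plus_vec f + (\<Sum>g\<in>A. minus_vec g)"

abbreviation "E \<equiv> linear_form ray"

lemma region_energy_eq: "region_energy f A = E"
  by (simp add: region_energy_def ray_def E_plus_def E_minus_def linear_form_simps linear_form_sum)

lemma coord_ray: "p_coord g ray = (if g = f then 1 else 0)" "m_coord g ray = (if g \<in> A then 1 else 0)"
  by (simp_all add: ray_def)

lemma ray_nonzero: "ray \<noteq> 0"
proof
  assume "ray = 0"
  then have "p_coord f ray = p_coord f 0" by (rule arg_cong)
  then show False by (simp add: coord_ray)
qed

lemmas reg_add = regular_along_add[OF ray_nonzero]
  and reg_diff = regular_along_diff[OF ray_nonzero]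
  and reg_mult = regular_along_mult[OF ray_nonzero]
  and reg_sum = regular_along_sum[OF ray_nonzero]
  and reg_prod = regular_along_prod[OF ray_nonzero]
  and reg_inverse = regular_along_inverse_linear_form[OF ray_nonzero]
  and reg_of = regular_along_of_polyfun[OF ray_nonzero]

text \<open>
  The hyperplane determines the pole, by comparing coordinates: the \<open>p\<close>-coordinates give \<open>c\<close>, and the
  \<open>m\<close>-coordinates give the set of maximal elements of \<open>S\<close> below \<open>c\<close>.
\<close>

lemma plus_pole_notin_span:
  assumes "\<not> (c = f \<and> max_below S c = A)"
  shows "plus_pole S c \<notin> span {ray}"
proof
  assume "plus_pole S c \<in> span {ray}"
  then obtain k where k: "plus_pole S c = k *\<^sub>R ray" by (auto simp: span_singleton)
  have "p_coord c (plus_pole S c) = p_coord c (k *\<^sub>R ray)" unfolding k ..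
  then have "c = f" "k = 1" by (simp_all add: p_coord_plus_pole coord_ray split: if_splits)
  moreover have "g \<in> max_below S c \<longleftrightarrow> g \<in> A" for g
  proof -
    have "m_coord g (plus_pole S c) = m_coord g (k *\<^sub>R ray)" unfolding k ..
    then show ?thesis using \<open>k = 1\<close> by (simp add: m_coord_plus_pole coord_ray split: if_splits)
  qed
  ultimately show False using assms by blast
qed

text \<open>
  A multiple of \<open>ray\<close> without \<open>f\<^sup>+\<close>-component is zero. In particular the spurious poles are never poles
  along the hyperplane.
\<close>

lemma m_pole_notin_span:
  assumes "p_coord f l = 0" "m_coord h l = 1"
  shows "l \<notin> span {ray}"
proof
  assume "l \<in> span {ray}"
  then obtain k where k: "l = k *\<^sub>R ray" by (auto simp: span_singleton)
  have "k = 0" using assms(1) unfolding k by (simp add: coord_ray)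
  then show False using assms(2) unfolding k by simp
qed

abbreviation "tree_summand N S \<equiv>
  tree_term N S (\<lambda>h. of_polyfun (E_plus h)) (\<lambda>h. of_polyfun (E_minus h) :: 'a energy_space ratfun)"

abbreviation "plus_factor S c \<equiv> inverse (of_polyfun (linear_form (plus_pole S c)))"
abbreviation "minus_factor S c \<equiv> inverse (of_polyfun (linear_form (minus_pole S c)))"

lemma tree_summand_eq:
  "tree_summand N S = (-1) ^ card S * (\<Prod>c\<in>N. plus_factor S c) * (\<Prod>c\<in>N - {top}. minus_factor S c)"
  by (simp only: tree_term_def of_polyfun_poles)

lemma reg_minus_one_power: "regular_along E ((-1) ^ n)"
proof -
  have "regular_along E (- 1)"
    using reg_diff[OF regular_along_0[OF ray_nonzero] regular_along_1[OF ray_nonzero]] by simp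
  then show ?thesis using reg_prod[of "{..<n}" "\<lambda>_. - 1"] by simp
qed

lemma reg_plus_factor: "\<not> (c = f \<and> max_below S c = A) \<Longrightarrow> regular_along E (plus_factor S c)"
  by (rule reg_inverse[OF plus_pole_notin_span])

lemma reg_minus_factor: "regular_along E (minus_factor S c)"
  by (rule reg_inverse[OF m_pole_notin_span[OF p_coord_minus_pole m_coord_minus_pole]])

lemma reg_tree_summand:
  assumes "\<not> (f \<in> N \<and> max_below S f = A)"
  shows "regular_along E (tree_summand N S)"
  unfolding tree_summand_eq
proof (intro reg_mult reg_prod reg_minus_one_power reg_minus_factor)
  show "regular_along E (plus_factor S c)" if "c \<in> N" for c
    using assms that by (intro reg_plus_factor) auto
qed

lemma reg_E_tree_summand: "regular_along E (of_polyfun E * tree_summand N S)"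
proof (cases "f \<in> N \<and> max_below S f = A")
  case False
  then show ?thesis by (intro reg_mult[OF reg_of] reg_tree_summand)
next
  case True
  \<comment> \<open>The factor \<open>E\<close> cancels the only pole.\<close>
  then have "plus_pole S f = ray" by (simp add: plus_pole_def ray_def)
  moreover have "of_polyfun E \<noteq> 0"
    using ray_nonzero by (simp add: of_polyfun_def eq_fract Zero_fract_def)
  moreover have "(\<Prod>c\<in>N. plus_factor S c) = plus_factor S f * (\<Prod>c\<in>N - {f}. plus_factor S c)"
    using True by (intro prod.remove) auto
  ultimately have "of_polyfun E * tree_summand N S =
      (-1) ^ card S * (\<Prod>c\<in>N - {f}. plus_factor S c) * (\<Prod>c\<in>N - {top}. minus_factor S c)"
    unfolding tree_summand_eq by simp
  then show ?thesis
    by (auto intro!: reg_mult reg_prod reg_minus_one_power reg_minus_factor reg_plus_factor)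
qed

text \<open>
  The summands of the closed formula that have a pole along the hyperplane when the region is contained
  in \<open>N\<close>.
\<close>

definition singular_part :: "'a set \<Rightarrow> 'a energy_space ratfun" where
  "singular_part N = (\<Sum>S\<in>{S \<in> Pow (N - {top}). max_below S f = A}. tree_summand N S)"

lemma reg_tree_ratfun_minus_singular: "regular_along E (tree_ratfun N - singular_part N)"
proof -
  have "tree_ratfun N = singular_part N + (\<Sum>S\<in>{S \<in> Pow (N - {top}). max_below S f \<noteq> A}. tree_summand N S)"
    unfolding tree_wave_def singular_part_def
    by (subst sum.union_disjoint[symmetric]) (auto intro!: sum.cong)
  moreover have "regular_along E (\<Sum>S\<in>{S \<in> Pow (N - {top}). max_below S f \<noteq> A}. tree_summand N S)"
    by (intro reg_sum reg_tree_summand) auto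
  ultimately show ?thesis by simp
qed

lemma reg_tree_ratfun:
  assumes "\<not> insert f A \<subseteq> N"
  shows "regular_along E (tree_ratfun N)"
  unfolding tree_wave_def
proof (intro reg_sum reg_tree_summand notI)
  fix S assume "S \<in> Pow (N - {top})" "f \<in> N \<and> max_below S f = A"
  moreover from this have "A \<subseteq> N" by (auto simp: max_below_def)
  ultimately show False using assms by blast
qed

definition shift_factor :: "'a set \<Rightarrow> 'a energy_space ratfun" where
  "shift_factor N = (\<Prod>h\<in>N - {f}. 1 / (of_polyfun (E_plus h + (\<Sum>g\<in>{g\<in>A. g \<le> h}. E_minus g)) *
     of_polyfun (E_minus h - (\<Sum>g\<in>{g\<in>A. g \<le> h}. E_minus g))))"

text \<open>
  Let \<open>d\<close> be maximal in \<open>S\<close> below \<open>h\<close>. It lies below some \<open>g\<close> in \<open>A\<close>, and the forest property makes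
  \<open>g\<close> and \<open>h\<close> comparable. Since \<open>h\<close> is inside the region, \<open>g < h\<close>, so \<open>d = g\<close>. Thus the excess at an inside
  element of a singular summand is the energy shift of the amplitude.
\<close>

lemma max_below_inside:
  assumes N: "N \<in> nested_sets G" and S: "S \<subseteq> N" "max_below S f = A" and h: "h \<in> N" "h \<in> I" "h \<noteq> f"
  shows "max_below S h = {g \<in> A. g \<le> h}"
proof -
  have hf: "h < f" using h by (simp add: region_inside_def less_le)
  have forest: "forest N" by (rule nested_set_forest[OF nestable N])
  show ?thesis
  proof (intro equalityI subsetI)
    fix d assume d: "d \<in> max_below S h"
    then have dS: "d \<in> S" "d < h" by (auto simp: max_below_def)
    then obtain g where g: "g \<in> A" "d \<le> g"
      using max_below_exists[of S d f] S(2) hf by (auto intro: less_trans)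
    have "g \<in> S" using g(1) S(2) by (auto simp: max_below_def)
    have "d \<noteq> bot" using forest dS S(1) by (auto simp: forest_def)
    then have "h \<le> g \<or> g \<le> h"
      using forestD[OF forest h(1), of g d] g dS S(1) \<open>g \<in> S\<close> by auto
    then have gh: "g \<le> h" "g < h" using A_disjoint_I[OF h(2) g(1)] by (auto simp: less_le)
    then have "d = g" using d g \<open>g \<in> S\<close> by (auto simp: max_below_def less_le)
    then show "d \<in> {g \<in> A. g \<le> h}" using g gh by simp
  next
    fix g assume "g \<in> {g \<in> A. g \<le> h}"
    then have g: "g \<in> A" "g \<le> h" by auto
    then have gh: "g < h" using A_disjoint_I[OF h(2) g(1)] by (auto simp: less_le)
    have "g \<in> S" "\<not> (\<exists>e\<in>S. g < e \<and> e < f)" using g(1) S(2) by (auto simp: max_below_def)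
    then show "g \<in> max_below S h" using gh hf by (auto simp: max_below_def dest: less_trans)
  qed
qed

lemma reg_shift_factor: "N \<subseteq> I \<Longrightarrow> regular_along E (shift_factor N)"
proof -
  assume N: "N \<subseteq> I"
  have "regular_along E (1 / (of_polyfun (E_plus h + (\<Sum>g\<in>{g\<in>A. g \<le> h}. E_minus g)) *
     of_polyfun (E_minus h - (\<Sum>g\<in>{g\<in>A. g \<le> h}. E_minus g))))" (is "regular_along E (1 / (of_polyfun ?p * of_polyfun ?m))")
    if h: "h \<in> N - {f}" for h
  proof -
    let ?pv = "plus_vec h + (\<Sum>g\<in>{g\<in>A. g \<le> h}. minus_vec g)"
    let ?mv = "minus_vec h - (\<Sum>g\<in>{g\<in>A. g \<le> h}. minus_vec g)"
    have p: "?p = linear_form ?pv" and m: "?m = linear_form ?mv"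
      by (simp_all add: E_plus_def E_minus_def linear_form_simps linear_form_sum)
    have "h \<notin> A" using A_disjoint_I[of h h] h N by auto
    then have "m_coord h ?mv = 1" by (auto intro!: sum.neutral)
    moreover have "p_coord f ?mv = 0" by simp
    ultimately have 1: "regular_along E (inverse (of_polyfun ?m))"
      unfolding m by (intro reg_inverse m_pole_notin_span)
    have "?pv \<notin> span {ray}"
    proof
      assume "?pv \<in> span {ray}"
      then obtain k where k: "?pv = k *\<^sub>R ray" by (auto simp: span_singleton)
      have "p_coord h ?pv = p_coord h (k *\<^sub>R ray)" unfolding k ..
      then show False using h by (simp add: coord_ray)
    qed
    then have 2: "regular_along E (inverse (of_polyfun ?p))" unfolding p by (rule reg_inverse)
    have "1 / (of_polyfun ?p * of_polyfun ?m) = inverse (of_polyfun ?p) * inverse (of_polyfun ?m)"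
      by (simp add: divide_inverse)
    then show ?thesis using reg_mult[OF 2 1] by simp
  qed
  then show ?thesis unfolding shift_factor_def by (rule reg_prod)
qed

text \<open>
  A singular set \<open>S\<close> contains no inside element other than possibly \<open>f\<close>, because every element of \<open>S\<close> below
  \<open>f\<close> lies below an element of \<open>A\<close>. Hence both sides are sums over the same sets \<open>S\<close>, and the
  summands agree factor by factor.
\<close>

lemma singular_part_Un:
  assumes 1: "N1 \<in> maximal_sets (nested_sets I)" and 2: "N2 \<in> maximal_sets (nested_sets H)"
  shows "singular_part (N1 \<union> N2) = shift_factor N1 * singular_part N2"
proof -
  let ?N = "N1 \<union> N2"
  have nest: "N1 \<in> nested_sets I" "N2 \<in> nested_sets H" using 1 2 by (auto simp: maximal_sets_def)
  have N: "?N \<in> nested_sets G" by (rule nested_Un[OF nest])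
  have sub: "N1 \<subseteq> I" "N2 \<subseteq> H" using nest by (auto simp: nested_sets_def)
  have f12: "f \<in> N1" "f \<in> N2" using f_in_maximal_I[OF 1] R_subset_maximal_H[OF 2] by auto
  have disj: "(N1 - {f}) \<inter> N2 = {}" using sub I_Int_H by blast
  have split: "?N = (N1 - {f}) \<union> N2" using f12 by blast
  have nt: "top \<notin> N1 - {f}"
  proof
    assume "top \<in> N1 - {f}"
    then have "top \<le> f" using sub by (auto simp: region_inside_def)
    then show False using \<open>top \<in> N1 - {f}\<close> by (simp add: top_unique)
  qed
  have split_top: "?N - {top} = (N1 - {f}) \<union> (N2 - {top})" using split nt by blast
  have sets: "{S \<in> Pow (?N - {top}). max_below S f = A} = {S \<in> Pow (N2 - {top}). max_below S f = A}"
  proof -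
    have "S \<inter> (N1 - {f}) = {}" if S: "max_below S f = A" for S
    proof (rule ccontr)
      assume "S \<inter> (N1 - {f}) \<noteq> {}"
      then obtain e where e: "e \<in> S" "e \<in> I" "e \<noteq> f" using sub by blast
      then have "e < f" by (simp add: region_inside_def less_le)
      then obtain g where "g \<in> A" "e \<le> g" using max_below_exists[of S e f] e S by auto
      then show False using A_disjoint_I[OF e(2)] by blast
    qed
    then show ?thesis using split_top by blast
  qed
  have "tree_summand ?N S = shift_factor N1 * tree_summand N2 S"
    if S: "S \<in> {S \<in> Pow (N2 - {top}). max_below S f = A}" for S
  proof -
    have SA: "max_below S f = A" "S \<subseteq> ?N" using S by auto
    have plus: "(\<Prod>c\<in>?N. plus_factor S c) = (\<Prod>c\<in>N1 - {f}. plus_factor S c) * (\<Prod>c\<in>N2. plus_factor S c)"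
      unfolding split using disj by (intro prod.union_disjoint) auto
    have minus: "(\<Prod>c\<in>?N - {top}. minus_factor S c) =
        (\<Prod>c\<in>N1 - {f}. minus_factor S c) * (\<Prod>c\<in>N2 - {top}. minus_factor S c)"
      unfolding split_top using disj by (intro prod.union_disjoint) auto
    have "shift_factor N1 = (\<Prod>c\<in>N1 - {f}. plus_factor S c * minus_factor S c)"
      unfolding shift_factor_def
    proof (rule prod.cong[OF refl])
      fix h assume h: "h \<in> N1 - {f}"
      have "max_below S h = {g \<in> A. g \<le> h}"
        by (rule max_below_inside[OF N SA(2,1)]) (use h sub in auto)
      then have "linear_form (plus_pole S h) = E_plus h + (\<Sum>g\<in>{g\<in>A. g \<le> h}. E_minus g)"
        and "linear_form (minus_pole S h) = E_minus h - (\<Sum>g\<in>{g\<in>A. g \<le> h}. E_minus g)"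
        by (simp_all add: plus_pole_def minus_pole_def E_plus_def E_minus_def linear_form_simps linear_form_sum)
      then show "1 / (of_polyfun (E_plus h + (\<Sum>g\<in>{g\<in>A. g \<le> h}. E_minus g)) *
          of_polyfun (E_minus h - (\<Sum>g\<in>{g\<in>A. g \<le> h}. E_minus g))) = plus_factor S h * minus_factor S h"
        by (simp add: divide_inverse)
    qed
    then show ?thesis
      unfolding tree_summand_eq plus minus prod.distrib by (simp add: mult_ac)
  qed
  then show ?thesis
    unfolding singular_part_def sets sum_distrib_left by (intro sum.cong refl)
qed

lemma shifted_amplitude_eq:
  "shifted_amplitude f I A = (\<Sum>N\<in>maximal_sets (nested_sets I). shift_factor N)"
  by (simp add: shifted_amplitude_def amplitude_at_def shift_factor_def)

lemma reg_shifted_amplitude: "regular_along E (shifted_amplitude f I A)"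
  unfolding shifted_amplitude_eq
  by (intro reg_sum reg_shift_factor) (auto simp: maximal_sets_def nested_sets_def)

lemma bot_notin: "bot \<notin> G" and top_in: "top \<in> G"
  using nestable by (auto simp: nestable_def)

lemma wavefunction_G: "wavefunction G = (\<Sum>N\<in>maximal_sets (nested_sets G). tree_ratfun N)"
  by (rule wavefunction_eq_sum[OF top_in bot_notin nested_set_forest[OF nestable]])

lemma wavefunction_H: "wavefunction H = (\<Sum>N\<in>maximal_sets (nested_sets H). tree_ratfun N)"
proof (rule wavefunction_eq_sum)
  show "top \<in> H"
    using H_intros(1) H_intros(2)[of top] top_in by (cases "f = top") (auto simp: top.not_eq_extremum)
  show "bot \<notin> H" using bot_notin H_subset by blast
  show "forest N" if "N \<in> nested_sets H" for N
    using that nested_set_forest[OF nestable] nested_sets_H by blast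
qed

lemma singular_sum:
  "(\<Sum>N\<in>{N \<in> maximal_sets (nested_sets G). insert f A \<subseteq> N}. singular_part N) =
    shifted_amplitude f I A * (\<Sum>N\<in>maximal_sets (nested_sets H). singular_part N)"
proof -
  have "(\<Sum>N\<in>{N \<in> maximal_sets (nested_sets G). insert f A \<subseteq> N}. singular_part N) =
      (\<Sum>(N1, N2)\<in>maximal_sets (nested_sets I) \<times> maximal_sets (nested_sets H). singular_part (N1 \<union> N2))"
    unfolding maximal_nested_sets_region sum.reindex[OF inj_on_Un_maximal]
    by (simp add: case_prod_unfold)
  also have "\<dots> = (\<Sum>(N1, N2)\<in>maximal_sets (nested_sets I) \<times> maximal_sets (nested_sets H).
      shift_factor N1 * singular_part N2)"
    by (intro sum.cong refl) (auto simp: singular_part_Un)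
  also have "\<dots> = shifted_amplitude f I A * (\<Sum>N\<in>maximal_sets (nested_sets H). singular_part N)"
    by (simp add: shifted_amplitude_eq sum_product sum.cartesian_product)
  finally show ?thesis .
qed

text \<open>
  The singular parts of the two wavefunctions cancel, as rational functions and not only on the
  hyperplane.
\<close>

lemma reg_difference: "regular_along E (wavefunction G - shifted_amplitude f I A * wavefunction H)"
proof -
  let ?MG = "maximal_sets (nested_sets G)" and ?MH = "maximal_sets (nested_sets H)"
  let ?R = "{N \<in> ?MG. insert f A \<subseteq> N}" and ?R' = "{N \<in> ?MG. \<not> insert f A \<subseteq> N}"
  have "(\<Sum>N\<in>?MG. tree_ratfun N) = (\<Sum>N\<in>?R. tree_ratfun N) + (\<Sum>N\<in>?R'. tree_ratfun N)"
    by (subst sum.union_disjoint[symmetric]) (auto intro!: sum.cong)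
  then have "wavefunction G - shifted_amplitude f I A * wavefunction H =
      (\<Sum>N\<in>?R. tree_ratfun N - singular_part N) + (\<Sum>N\<in>?R'. tree_ratfun N) -
      shifted_amplitude f I A * (\<Sum>N\<in>?MH. tree_ratfun N - singular_part N)"
    by (simp add: wavefunction_G wavefunction_H sum_subtractf singular_sum right_diff_distrib
        del: insert_subset)
  moreover have "regular_along E \<dots>"
    by (intro reg_diff reg_add reg_mult reg_sum reg_tree_ratfun_minus_singular reg_shifted_amplitude
        reg_tree_ratfun) simp
  ultimately show ?thesis by simp
qed

lemma reg_E_wavefunction_H: "regular_along E (of_polyfun E * wavefunction H)"
  unfolding wavefunction_H tree_wave_def sum_distrib_left
  by (intro reg_sum reg_E_tree_summand)

lemma residue_wavefunction:
  "at_most_simple_pole E (wavefunction G) \<and>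
   residue E (wavefunction G) =
     restriction E (of_polyfun E * (shifted_amplitude f I A * wavefunction H))"
proof -
  have "regular_along E (of_polyfun E * (shifted_amplitude f I A * wavefunction H))"
    using reg_mult[OF reg_shifted_amplitude reg_E_wavefunction_H] by (simp add: mult_ac)
  from residue_eqI[OF ray_nonzero this reg_difference] show ?thesis by blast
qed

end

theorem corollary3p14:
  fixes G :: "'a::{finite, bounded_lattice} set" and f :: 'a and A :: "'a set"
  assumes "stable_nestoid G"
    and "causal_region G (insert f A)"
    and "\<forall>g\<in>A. g < f"
  shows "at_most_simple_pole (region_energy f A) (wavefunction G)
    \<and> residue (region_energy f A) (wavefunction G)
      = restriction (region_energy f A)
          (of_polyfun (region_energy f A)
            * (shifted_amplitude f (region_inside G f A) A
                * wavefunction (insert f (region_outside G f A))))"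
proof -
  interpret stable_region G f A
    using assms by unfold_locales auto
  show ?thesis unfolding region_energy_eq by (rule residue_wavefunction)
qed

end
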